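(* (a) There exists an algorithm for computing the specialization at its removable singularity $z=\mathbf 1$ of a rational function of the form $$g_{\mathcal P}(z)=\sum_{i\in I}\epsilon_i\frac{z^{a_i}}{\prod_{j=1}^{s_i}(1-z^{b_{ij}})}$$ which runs in time polynomial in the encoding size of its data $\epsilon_i\in\mathbb Q$, $a_i\in\mathbb Z^n$ ($i\in I$), $b_{ij}\in\mathbb Z^n$ ($i\in I$, $j=1,\dots,s_i$), even when the dimension $n$ and the numbers $s_i$ are not fixed. (b) In particular, there exists a polynomial-time algorithm that, given such data describing the rational generating function $g_{\mathcal P}$ of a polytope $\mathcal P\subseteq\mathbb R^n$ in this form, computes a vector $\lambda\in\mathbb Q^n$ with $\langle\lambda,b_{ij}\rangle\ne0$ for all $i,j$ and rational weights $w_{i,l}$ for $i\in I$, $l=0,\dots,s_i$, such that $$\#(\mathcal P\cap\mathbb Z^n)=\sum_{i\in I}\epsilon_i\sum_{l=0}^{s_i}w_{i,l}\langle\lambda,a_i\rangle^l.$$ (c) Likewise, if an integral polytope $\mathcal P$ has dilations with parametric rational generating functions $$g_{k\mathcal P}(z)=\sum_{i\in I}\epsilon_i\frac{z^{a_i+(k-1)v_i}}{\prod_{j=1}^{s_i}(1-z^{b_{ij}})}\quad(k\ge1),$$ with $v_i\in\mathbb Z^n$, then with $\lambda$ and $w_{i,l}$ as in (b) (computed from the data $\epsilon_i,a_i,b_{ij}$), the Ehrhart polynomial $i(\mathcal P,k)=\#(k\mathcal P\cap\mathbb Z^n)$ is given by $$i(\mathcal P,k)=\sum_{m=0}^M\Big(\sum_{i\in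 I}\epsilon_i\langle\lambda,v_i\rangle^m\sum_{l=m}^{s_i}\binom{l}{m}w_{i,l}\langle\lambda,a_i-v_i\rangle^{l-m}\Big)k^m,$$ where $s=\max_{i\in I}s_i$ and $M=\min\{s,\dim\mathcal P\}$.
   Context: $z^{a}=\prod_{l=1}^n z_l^{a_l}$; $\langle\cdot,\cdot\rangle$ is the standard inner product. For a polytope $\mathcal P$, the generating function $g_{\mathcal P}(z)=\sum_{\alpha\in\mathcal P\cap\mathbb Z^n}z^\alpha$, so $g_{\mathcal P}(\mathbf 1)=\#(\mathcal P\cap\mathbb Z^n)$; a sum of the displayed form equals a Laurent polynomial and $z=\mathbf 1$ is a removable singularity, although it is a pole of individual summands. $k\mathcal P=\{k\alpha:\alpha\in\mathcal P\}$. *)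

theory Defs
  imports
    "HOL-Analysis.Analysis"
    "HOL-Analysis.Finite_Function_Topology"
    "HOL-Computational_Algebra.Computational_Algebra"
    "HOL-Library.Log_Nat"
begin

section \<open>Polynomial time\<close>

text \<open>
  The machine model is the random access machine with logarithmic cost criterion (Aho, Hopcroft and
  Ullman), with a one-way input tape and an output tape of integers and with structured control flow
  instead of jumps. The memory is organised into integer-indexed arrays of integers, one for each
  name (a program mentions only finitely many); a scalar variable is an array used at a fixed index.
  Every integer that occurs as an operand, an address or a result is charged with the length of its
  binary representation, so running times agree with those of Turing machines up to a polynomial.
\<close>

type_synonym mem = "string \<Rightarrow> int \<Rightarrow> int"

datatype binop = Add | Sub | Mul | Quo | Less | Equal

datatype aexp = Const int | Cell string aexp | Op binop aexp aexp

datatype com =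
    Skip
  | Assign string aexp aexp  \<comment> \<open>\<open>Assign x e f\<close> is \<open>x[e] := f\<close>\<close>
  | Read string aexp         \<comment> \<open>move the next input integer to \<open>x[e]\<close>\<close>
  | Write aexp
  | Seq com com
  | Cond aexp com com        \<comment> \<open>nonzero means true, as in \<open>While\<close>\<close>
  | While aexp com

fun binop_val :: "binop \<Rightarrow> int \<Rightarrow> int \<Rightarrow> int" where
  "binop_val Add x y = x + y"
| "binop_val Sub x y = x - y"
| "binop_val Mul x y = x * y"
| "binop_val Quo x y = x div y"
| "binop_val Less x y = (if x < y then 1 else 0)"
| "binop_val Equal x y = (if x = y then 1 else 0)"

fun aval :: "mem \<Rightarrow> aexp \<Rightarrow> int" where
  "aval m (Const c) = c"
| "aval m (Cell x e) = m x (aval m e)"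
| "aval m (Op f e1 e2) = binop_val f (aval m e1) (aval m e2)"

text \<open>Binary digits of the absolute value plus one sign bit.\<close>

definition bit_size :: "int \<Rightarrow> nat" where
  "bit_size x = 1 + floorlog 2 (nat \<bar>x\<bar>)"

definition tape_size :: "int list \<Rightarrow> nat" where
  "tape_size xs = sum_list (map bit_size xs)"

fun acost :: "mem \<Rightarrow> aexp \<Rightarrow> nat" where
  "acost m (Const c) = bit_size c"
| "acost m (Cell x e) = acost m e + bit_size (aval m (Cell x e))"
| "acost m (Op f e1 e2) = acost m e1 + acost m e2 + bit_size (aval m (Op f e1 e2))"

text \<open>\<open>exec c s t s'\<close>: started in \<open>s\<close>, the program \<open>c\<close> halts in \<open>s'\<close> at cost \<open>t\<close>. A state consists
  of the memory, the unread part of the input tape, and the output written so far.\<close>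

inductive exec :: "com \<Rightarrow> mem \<times> int list \<times> int list \<Rightarrow> nat \<Rightarrow> mem \<times> int list \<times> int list \<Rightarrow> bool" where
  Skip: "exec Skip s 1 s"
| Assign: "exec (Assign x e f) (m, inp, out) (1 + acost m e + acost m f)
    (m(x := (m x)(aval m e := aval m f)), inp, out)"
| Read: "exec (Read x e) (m, z # inp, out) (1 + acost m e + bit_size z)
    (m(x := (m x)(aval m e := z)), inp, out)"
| Write: "exec (Write e) (m, inp, out) (1 + acost m e) (m, inp, out @ [aval m e])"
| Seq: "exec c1 s t1 s' \<Longrightarrow> exec c2 s' t2 s'' \<Longrightarrow> exec (Seq c1 c2) s (1 + t1 + t2) s''"
| CondTrue: "aval (fst s) e \<noteq> 0 \<Longrightarrow> exec c1 s t s' \<Longrightarrow> exec (Cond e c1 c2) s (1 + acost (fst s) e + t) s'"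
| CondFalse: "aval (fst s) e = 0 \<Longrightarrow> exec c2 s t s' \<Longrightarrow> exec (Cond e c1 c2) s (1 + acost (fst s) e + t) s'"
| WhileFalse: "aval (fst s) e = 0 \<Longrightarrow> exec (While e c) s (1 + acost (fst s) e) s"
| WhileTrue: "aval (fst s) e \<noteq> 0 \<Longrightarrow> exec c s t1 s' \<Longrightarrow> exec (While e c) s' t2 s'' \<Longrightarrow>
    exec (While e c) s (1 + acost (fst s) e + t1 + t2) s''"

definition computes :: "com \<Rightarrow> int list \<Rightarrow> nat \<Rightarrow> int list \<Rightarrow> bool" where
  "computes c xs t ys \<longleftrightarrow> (\<exists>m rest. exec c (\<lambda>_ _. 0, xs, []) t (m, rest, ys))"

text \<open>On every instance satisfying the promise, the program halts within time polynomial in the bit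
  size of the encoded instance, with an output that is correct for the instance.\<close>

definition polytime_algorithm ::
  "com \<Rightarrow> ('a \<Rightarrow> int list) \<Rightarrow> ('a \<Rightarrow> bool) \<Rightarrow> ('a \<Rightarrow> int list \<Rightarrow> bool) \<Rightarrow> bool" where
  "polytime_algorithm c enc promise correct \<longleftrightarrow>
    (\<exists>p :: nat poly. \<forall>x. promise x \<longrightarrow>
      (\<exists>t ys. computes c (enc x) t ys \<and> t \<le> poly p (tape_size (enc x)) \<and> correct x ys))"

text \<open>Rational numbers are written as fractions with positive denominator, not necessarily in lowest
  terms.\<close>

definition codes_rats :: "rat list \<Rightarrow> int list \<Rightarrow> bool" where
  "codes_rats rs ys \<longleftrightarrow> (\<exists>ps :: (int \<times> int) list. (\<forall>(p, q) \<in> set ps. q > 0) \<and>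
     rs = map (\<lambda>(p, q). of_int p / of_int q) ps \<and> ys = concat (map (\<lambda>(p, q). [p, q]) ps))"


section \<open>Vectors and polytopes\<close>

text \<open>The dimension \<open>n\<close> is part of the input of the algorithms, so it cannot be a type: vectors of
  length \<open>n\<close> are finitely supported functions on \<open>nat\<close> that vanish outside \<open>{..<n}\<close>. The type
  \<open>nat \<Rightarrow>\<^sub>0 real\<close> is a real vector space, which makes \<^const>\<open>polytope\<close> available.\<close>

definition vecs :: "nat \<Rightarrow> (nat \<Rightarrow>\<^sub>0 'a::zero) set" where
  "vecs n = {x. Poly_Mapping.keys x \<subseteq> {..<n}}"

definition dot :: "nat \<Rightarrow> (nat \<Rightarrow>\<^sub>0 rat) \<Rightarrow> (nat \<Rightarrow>\<^sub>0 int) \<Rightarrow> rat" where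
  "dot n x a = (\<Sum>l<n. Poly_Mapping.lookup x l * of_int (Poly_Mapping.lookup a l))"

definition real_vec :: "(nat \<Rightarrow>\<^sub>0 int) \<Rightarrow> (nat \<Rightarrow>\<^sub>0 real)" where
  "real_vec a = Poly_Mapping.map of_int a"

definition lattice_points :: "(nat \<Rightarrow>\<^sub>0 real) set \<Rightarrow> (nat \<Rightarrow>\<^sub>0 int) set" where
  "lattice_points P = {\<alpha>. real_vec \<alpha> \<in> P}"

definition polytope_in :: "nat \<Rightarrow> (nat \<Rightarrow>\<^sub>0 real) set \<Rightarrow> bool" where
  "polytope_in n P \<longleftrightarrow> polytope P \<and> P \<subseteq> vecs n"

definition integral_polytope_in :: "nat \<Rightarrow> (nat \<Rightarrow>\<^sub>0 real) set \<Rightarrow> bool" where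
  "integral_polytope_in n P \<longleftrightarrow>
     polytope_in n P \<and> (\<forall>x. x extreme_point_of P \<longrightarrow> x \<in> range real_vec)"

text \<open>\<^const>\<open>aff_dim\<close> is only available on Euclidean spaces. As there, the empty set gets \<open>-1\<close>.\<close>

definition affine_dim :: "(nat \<Rightarrow>\<^sub>0 real) set \<Rightarrow> int" where
  "affine_dim P = (if P = {} then - 1 else int (dim {x - y | x y. x \<in> P \<and> y \<in> P}))"

definition dilate :: "nat \<Rightarrow> (nat \<Rightarrow>\<^sub>0 real) set \<Rightarrow> (nat \<Rightarrow>\<^sub>0 real) set" where
  "dilate k P = (\<lambda>x. real k *\<^sub>R x) ` P"


section \<open>Rational generating functions\<close>

text \<open>Laurent polynomials over \<open>\<rat>\<close> form the group algebra of the exponent lattice. It is an integral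
  domain, and rational functions are the elements of its fraction field.\<close>

type_synonym laurent = "(nat \<Rightarrow>\<^sub>0 int) \<Rightarrow>\<^sub>0 rat"

definition monomial :: "(nat \<Rightarrow>\<^sub>0 int) \<Rightarrow> laurent" where
  "monomial a = Poly_Mapping.single a 1"

definition scalar :: "rat \<Rightarrow> laurent" where
  "scalar c = Poly_Mapping.single 0 c"

definition at_one :: "laurent \<Rightarrow> rat" where
  "at_one p = (\<Sum>a\<in>Poly_Mapping.keys p. Poly_Mapping.lookup p a)"

text \<open>A rational function is regular at \<open>(1, \<dots>, 1)\<close>, i.e. its singularity there (if any) is
  removable, if it has a representation whose denominator does not vanish there.\<close>

definition specializes_to :: "laurent fract \<Rightarrow> rat \<Rightarrow> bool" where
  "specializes_to f r \<longleftrightarrow>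
     (\<exists>p q. f = Fract p q \<and> at_one q \<noteq> 0 \<and> r = at_one p / at_one q)"

definition gen_fun :: "(nat \<Rightarrow>\<^sub>0 real) set \<Rightarrow> laurent" where
  "gen_fun P = (\<Sum>\<alpha>\<in>lattice_points P. monomial \<alpha>)"

text \<open>In \<open>GF n ts\<close>, the list \<open>ts\<close> consists of the triples \<open>(\<epsilon>\<^sub>i, a\<^sub>i, [b\<^sub>i\<^sub>1, \<dots>, b\<^sub>i\<^sub>s])\<close>; indices are
  counted from \<open>0\<close>.\<close>

datatype gf_data =
  GF (gf_dim: nat) (gf_terms: "(rat \<times> (nat \<Rightarrow>\<^sub>0 int) \<times> (nat \<Rightarrow>\<^sub>0 int) list) list")

definition gf_index :: "gf_data \<Rightarrow> nat set" where
  "gf_index D = {..<length (gf_terms D)}"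

definition gf_coeff :: "gf_data \<Rightarrow> nat \<Rightarrow> rat" where
  "gf_coeff D i = fst (gf_terms D ! i)"

definition gf_num :: "gf_data \<Rightarrow> nat \<Rightarrow> (nat \<Rightarrow>\<^sub>0 int)" where
  "gf_num D i = fst (snd (gf_terms D ! i))"

definition gf_len :: "gf_data \<Rightarrow> nat \<Rightarrow> nat" where
  "gf_len D i = length (snd (snd (gf_terms D ! i)))"

definition gf_den :: "gf_data \<Rightarrow> nat \<Rightarrow> nat \<Rightarrow> (nat \<Rightarrow>\<^sub>0 int)" where
  "gf_den D i j = snd (snd (gf_terms D ! i)) ! j"

text \<open>The exponents in the denominators must be nonzero for the summands to be defined.\<close>

definition valid_gf :: "gf_data \<Rightarrow> bool" where
  "valid_gf D \<longleftrightarrow> (\<forall>i\<in>gf_index D. gf_num D i \<in> vecs (gf_dim D) \<and>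
     (\<forall>j<gf_len D i. gf_den D i j \<in> vecs (gf_dim D) \<and> gf_den D i j \<noteq> 0))"

text \<open>The numerator exponents are a parameter, to be used with \<open>a\<^sub>i\<close> and with \<open>a\<^sub>i + (k - 1) v\<^sub>i\<close>.\<close>

definition rat_fun :: "gf_data \<Rightarrow> (nat \<Rightarrow> (nat \<Rightarrow>\<^sub>0 int)) \<Rightarrow> laurent fract" where
  "rat_fun D a = (\<Sum>i\<in>gf_index D. to_fract (scalar (gf_coeff D i)) *
     (to_fract (monomial (a i)) / (\<Prod>j<gf_len D i. 1 - to_fract (monomial (gf_den D i j)))))"

definition represents :: "gf_data \<Rightarrow> (nat \<Rightarrow>\<^sub>0 real) set \<Rightarrow> bool" where
  "represents D P \<longleftrightarrow> rat_fun D (gf_num D) = to_fract (gen_fun P)"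

definition enc_vec :: "nat \<Rightarrow> (nat \<Rightarrow>\<^sub>0 'a::zero) \<Rightarrow> 'a list" where
  "enc_vec n a = map (Poly_Mapping.lookup a) [0..<n]"

text \<open>The dimension is written in unary. This only matters if there are no summands: otherwise some
  vector of length \<open>n\<close> is part of the data, which takes at least \<open>n\<close> bits anyway.\<close>

definition enc_gf :: "gf_data \<Rightarrow> int list" where
  "enc_gf D = replicate (gf_dim D) 1 @ [0, int (length (gf_terms D))] @
     concat (map (\<lambda>(\<epsilon>, a, bs).
       [fst (quotient_of \<epsilon>), snd (quotient_of \<epsilon>), int (length bs)] @
       enc_vec (gf_dim D) a @ concat (map (enc_vec (gf_dim D)) bs)) (gf_terms D))"

end

theory Submission
  imports Defs
begin

text \<open>
  Fix \<open>\<lambda>\<close> with \<open>\<langle>\<lambda>, b\<^sub>i\<^sub>j\<rangle> \<noteq> 0\<close>. Substituting \<open>z\<^sub>l = exp (\<lambda>\<^sub>l t)\<close> is a ring homomorphism from Laurent polynomials to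
  power series in \<open>t\<close> whose constant term is evaluation at \<open>z = 1\<close>, so the specialization is the constant
  term of \<open>\<Sum>\<^sub>i \<epsilon>\<^sub>i exp (\<alpha>\<^sub>i t) / \<Prod>\<^sub>j (1 - exp (\<beta>\<^sub>i\<^sub>j t))\<close> with \<open>\<alpha>\<^sub>i = \<langle>\<lambda>, a\<^sub>i\<rangle>\<close> and \<open>\<beta>\<^sub>i\<^sub>j = \<langle>\<lambda>, b\<^sub>i\<^sub>j\<rangle>\<close>, where
  the poles of the summands cancel. Since \<open>1 - exp (\<beta> t) = - \<beta> t T\<^sub>\<beta>(t)\<close> with \<open>T\<^sub>\<beta>(t) = \<Sum>\<^sub>k (\<beta> t)\<^sup>k / (k + 1)!\<close>,
  one may take \<open>w\<^sub>i\<^sub>,\<^sub>l\<close> to be the coefficient of \<open>t\<close> to the \<open>s\<^sub>i - l\<close> in \<open>\<Prod>\<^sub>j 1 / T\<^sub>\<beta>\<close>, divided by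
  \<open>l! \<Prod>\<^sub>j (- \<beta>\<^sub>i\<^sub>j)\<close>.

  For polynomial time, choose \<open>\<lambda>\<^sub>l = \<Phi> X\<^sup>l\<close>, where \<open>X\<close> exceeds the absolute value of every input number
  (so that \<open>\<langle>\<lambda>, b\<rangle>\<close> is \<open>\<Phi>\<close> times a nonzero number in base \<open>X\<close>) and \<open>\<Phi>\<close> is the factorial of the
  input length. Then \<open>(k + 1)!\<close> divides \<open>\<beta>\<close> in the relevant range, the series \<open>T\<^sub>\<beta>\<close> are integral with
  constant term 1, and dividing by them takes place in the integers; all coefficients have
  polynomially many bits.

  The same weights applied to \<open>a\<^sub>i + (k - 1) v\<^sub>i\<close> give a polynomial in \<open>k\<close> of degree at most \<open>s\<close>. Its
  coefficients above \<open>dim P\<close> vanish, because \<open>dim P\<close> suitable coordinates determine the points of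
  \<open>k P\<close>, which therefore contains only \<open>O(k\<^sup>d)\<close> lattice points for \<open>d = dim P\<close>.
\<close>

section \<open>Resource-bounded weakest preconditions\<close>

lemma bit_size_le_iff: "bit_size x \<le> Suc b \<longleftrightarrow> \<bar>x\<bar> < 2 ^ b"
proof -
  have "bit_size x \<le> Suc b \<longleftrightarrow> floorlog 2 (nat \<bar>x\<bar>) \<le> b"
    by (simp add: bit_size_def)
  also have "\<dots> \<longleftrightarrow> nat \<bar>x\<bar> < 2 ^ b"
    by (subst floorlog_le_iff) auto
  also have "\<dots> \<longleftrightarrow> \<bar>x\<bar> < 2 ^ b"
    by (metis abs_ge_zero nat_less_iff of_nat_numeral of_nat_power)
  finally show ?thesis .
qed

lemma bit_size_le: "\<bar>x\<bar> < 2 ^ b \<Longrightarrow> bit_size x \<le> Suc b"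
  by (simp add: bit_size_le_iff)

lemma bit_size_pos [simp]: "0 < bit_size x"
  by (simp add: bit_size_def)

lemma bit_sizeE:
  obtains a where "bit_size x = Suc a" "\<bar>x\<bar> \<le> 2 ^ a - 1"
  using bit_size_le_iff[of x] by (metis bit_size_pos gr0_implies_Suc le_refl zle_diff1_eq)

text \<open>Rounding down moves a negative quotient away from zero, but never past the dividend.
  Division by zero yields 0, so later size bounds carry no condition on the divisor.\<close>

lemma abs_div_le: "\<bar>x div y\<bar> \<le> \<bar>x\<bar>" for x y :: int
proof -
  have pos: "\<bar>a div b\<bar> \<le> \<bar>a\<bar>" if "b > 0" for a b :: int
  proof (cases "a \<ge> 0")
    case True
    then show ?thesis using that zdiv_mono2[of a 1 b] by (simp add: pos_imp_zdiv_nonneg_iff)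
  next
    case False
    then show ?thesis using that zdiv_mono2_neg[of a 1 b]
      by (simp add: neg_imp_zdiv_neg_iff div_neg_pos_less0 abs_of_neg)
  qed
  consider "y = 0" | "y > 0" | "y < 0" by linarith
  then show ?thesis
    using pos[of y x] pos[of "- y" "- x"] by cases simp_all
qed

text \<open>Additivity over all operations makes the size of a value linear in the leaves of its
  expression. The two sign bits on the right leave a spare bit, which the comparison of 0 with 0,
  whose value is 1, uses up.\<close>

lemma bit_size_binop: "bit_size (binop_val f x y) \<le> bit_size x + bit_size y"
proof -
  obtain a where a: "bit_size x = Suc a" "\<bar>x\<bar> \<le> 2 ^ a - 1" by (rule bit_sizeE)
  obtain b where b: "bit_size y = Suc b" "\<bar>y\<bar> \<le> 2 ^ b - 1" by (rule bit_sizeE)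
  have p: "(1::int) \<le> 2 ^ a" "(1::int) \<le> 2 ^ b" by auto
  have "0 \<le> (2 ^ a - 1) * (2 ^ b - 1 :: int)" using p by simp
  \<comment> \<open>Expanding the product shows that a sum of two magnitudes also fits into a + b
    bits.\<close>
  then have sum: "2 ^ a + 2 ^ b - 1 \<le> (2 ^ (a + b) :: int)"
    by (simp add: algebra_simps power_add)
  have "\<bar>binop_val f x y\<bar> < 2 ^ Suc (a + b)"
  proof (cases f)
    case Add
    then show ?thesis using a b sum p by (simp add: abs_le_iff)
  next
    case Sub
    then show ?thesis using a b sum p by (simp add: abs_le_iff)
  next
    case Mul
    have "\<bar>x\<bar> * \<bar>y\<bar> \<le> (2 ^ a - 1) * (2 ^ b - 1)"
      using a b p by (intro mult_mono) auto
    also have "\<dots> = 2 ^ (a + b) - (2 ^ a + 2 ^ b - 1)" by (simp add: algebra_simps power_add)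
    also have "\<dots> < 2 ^ Suc (a + b)" unfolding power_Suc using p sum by linarith
    finally show ?thesis using Mul by (simp add: abs_mult)
  next
    case Quo
    have "\<bar>x div y\<bar> \<le> \<bar>x\<bar>" by (rule abs_div_le)
    also have "\<dots> \<le> 2 ^ a - 1" by (rule a)
    also have "\<dots> < 2 ^ Suc (a + b)" unfolding power_Suc using p sum by linarith
    finally show ?thesis using Quo by simp
  next
    case Less
    then show ?thesis using sum p unfolding power_Suc by (auto intro: less_le_trans[of _ 2])
  next
    case Equal
    then show ?thesis using sum p unfolding power_Suc by (auto intro: less_le_trans[of _ 2])
  qed
  then have "bit_size (binop_val f x y) \<le> Suc (Suc (a + b))" by (rule bit_size_le)
  then show ?thesis using a b by simp
qed

lemma length_le_tape_size: "length xs \<le> tape_size xs"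
proof (induction xs)
  case (Cons x xs)
  moreover have "1 \<le> bit_size x" using bit_size_pos[of x] by linarith
  ultimately show ?case by (simp add: tape_size_def)
qed (simp add: tape_size_def)

lemma tape_size_append: "tape_size (xs @ ys) = tape_size xs + tape_size ys"
  by (simp add: tape_size_def)

text \<open>\<open>esize e * B\<close> is to bound the bits of the value of \<open>e\<close> over a
  memory of \<open>B\<close>-bit cells. A cell counts 1 whatever its address, because its content is
  bounded directly.\<close>

fun esize :: "aexp \<Rightarrow> nat" where
  "esize (Const c) = bit_size c"
| "esize (Cell x e) = 1"
| "esize (Op f e1 e2) = esize e1 + esize e2"

fun ecost :: "aexp \<Rightarrow> nat" where
  "ecost (Const c) = bit_size c"
| "ecost (Cell x e) = ecost e + 1"
| "ecost (Op f e1 e2) = ecost e1 + ecost e2 + esize (Op f e1 e2)"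

definition mem_bounded :: "nat \<Rightarrow> mem \<Rightarrow> bool" where
  "mem_bounded B m \<longleftrightarrow> (\<forall>x i. bit_size (m x i) \<le> B)"

lemma mem_bounded_pos: "mem_bounded B m \<Longrightarrow> 1 \<le> B"
  unfolding mem_bounded_def by (metis One_nat_def Suc_leI bit_size_pos order_trans)

lemma mem_bounded_upd:
  "mem_bounded B m \<Longrightarrow> bit_size v \<le> B \<Longrightarrow> mem_bounded B (m(x := (m x)(i := v)))"
  by (auto simp: mem_bounded_def)

lemma bit_size_aval: "mem_bounded B m \<Longrightarrow> bit_size (aval m e) \<le> esize e * B"
proof (induction e)
  case (Const c)
  then show ?case using mem_bounded_pos[of B m] by simp
next
  case (Cell x e)
  then show ?case by (simp add: mem_bounded_def)
next
  case (Op f e1 e2)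
  then show ?case
    using bit_size_binop[of f "aval m e1" "aval m e2"] by (simp add: algebra_simps)
qed

lemma acost_le: "mem_bounded B m \<Longrightarrow> acost m e \<le> ecost e * B"
proof (induction e)
  case (Const c)
  then show ?case using mem_bounded_pos[of B m] by simp
next
  case (Cell x e)
  then have "acost m e \<le> ecost e * B" "bit_size (m x (aval m e)) \<le> B"
    by (simp_all add: mem_bounded_def)
  then show ?case by simp
next
  case (Op f e1 e2)
  then show ?case
    using bit_size_aval[OF Op.prems, of "Op f e1 e2"] by (simp add: algebra_simps)
qed

text \<open>A weakest precondition that guarantees termination together with two resource bounds: no loop
  makes more than \<open>K\<close> iterations, and no value stored in memory has more than \<open>B\<close> bits.\<close>

type_synonym state = "mem \<times> int list \<times> int list"

primrec wp :: "nat \<Rightarrow> nat \<Rightarrow> com \<Rightarrow> (state \<Rightarrow> bool) \<Rightarrow> state \<Rightarrow> bool" where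
  "wp K B Skip Q = Q"
| "wp K B (Assign x e f) Q = (\<lambda>(m, inp, out). bit_size (aval m f) \<le> B \<and>
     Q (m(x := (m x)(aval m e := aval m f)), inp, out))"
| "wp K B (Read x e) Q = (\<lambda>(m, inp, out). inp \<noteq> [] \<and> bit_size (hd inp) \<le> B \<and>
     Q (m(x := (m x)(aval m e := hd inp)), tl inp, out))"
| "wp K B (Write e) Q = (\<lambda>(m, inp, out). Q (m, inp, out @ [aval m e]))"
| "wp K B (Seq c1 c2) Q = wp K B c1 (wp K B c2 Q)"
| "wp K B (Cond e c1 c2) Q =
     (\<lambda>s. if aval (fst s) e \<noteq> 0 then wp K B c1 Q s else wp K B c2 Q s)"
| "wp K B (While e c) Q = (\<lambda>s. \<exists>k\<le>K. ((\<lambda>R s. aval (fst s) e \<noteq> 0 \<and> wp K B c R s) ^^ k)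
     (\<lambda>s. aval (fst s) e = 0 \<and> Q s) s)"

text \<open>The indeterminate stands for the iteration bound \<open>K\<close>, so nested loops
  multiply. The factor \<open>[:1, 1:]\<close> is K + 1: the tests of a loop, including the one that
  fails.\<close>

primrec time_bound :: "com \<Rightarrow> nat poly" where
  "time_bound Skip = 1"
| "time_bound (Assign x e f) = [:1 + ecost e + ecost f:]"
| "time_bound (Read x e) = [:2 + ecost e:]"
| "time_bound (Write e) = [:1 + ecost e:]"
| "time_bound (Seq c1 c2) = 1 + time_bound c1 + time_bound c2"
| "time_bound (Cond e c1 c2) = [:1 + ecost e:] + time_bound c1 + time_bound c2"
| "time_bound (While e c) = [:1, 1:] * ([:1 + ecost e:] + time_bound c)"

text \<open>Every elementary step costs at most a constant times \<open>B\<close>, so the bit bound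
  enters the time as a single factor. Loops need an inner induction on the number \<open>k\<close>
  of iterations that \<open>wp\<close> supplies.\<close>

theorem wp_sound:
  assumes "wp K B c Q s" "mem_bounded B (fst s)"
  shows "\<exists>t s'. exec c s t s' \<and> t \<le> poly (time_bound c) K * B \<and> Q s' \<and> mem_bounded B (fst s')"
  using assms
proof (induction c arbitrary: Q s)
  case Skip
  then show ?case using exec.Skip[of s] mem_bounded_pos[of B "fst s"]
    by (intro exI[of _ 1] exI[of _ s]) simp
next
  case (Assign x e f)
  obtain m inp out where s: "s = (m, inp, out)" by (cases s)
  have "1 + acost m e + acost m f \<le> (1 + ecost e + ecost f) * B"
    using acost_le[of B m e] acost_le[of B m f] mem_bounded_pos[of B m] Assign s
    by (simp add: algebra_simps)
  then show ?case
    using Assign s exec.Assign[of x e f m inp out] mem_bounded_upd[of B m]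
    by (intro exI[of _ "1 + acost m e + acost m f"]
        exI[of _ "(m(x := (m x)(aval m e := aval m f)), inp, out)"]) (simp del: fun_upd_apply)
next
  case (Read x e)
  obtain m inp out where s: "s = (m, inp, out)" by (cases s)
  with Read obtain z inp' where inp: "inp = z # inp'" by (cases inp) auto
  have "1 + acost m e + bit_size z \<le> (2 + ecost e) * B"
    using acost_le[of B m e] mem_bounded_pos[of B m] Read s inp
    by (simp add: algebra_simps)
  then show ?case
    using Read s inp exec.Read[of x e m z inp' out] mem_bounded_upd[of B m]
    by (intro exI[of _ "1 + acost m e + bit_size z"]
        exI[of _ "(m(x := (m x)(aval m e := z)), inp', out)"]) (simp del: fun_upd_apply)
next
  case (Write e)
  obtain m inp out where s: "s = (m, inp, out)" by (cases s)
  have "1 + acost m e \<le> (1 + ecost e) * B"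
    using acost_le[of B m e] mem_bounded_pos[of B m] Write s
    by (simp add: algebra_simps)
  then show ?case
    using Write s exec.Write[of e m inp out]
    by (intro exI[of _ "1 + acost m e"] exI[of _ "(m, inp, out @ [aval m e])"]) simp
next
  case (Seq c1 c2)
  from Seq.prems(1) have "wp K B c1 (wp K B c2 Q) s" by simp
  from Seq.IH(1)[OF this Seq.prems(2)] obtain t1 s1 where
    1: "exec c1 s t1 s1" "t1 \<le> poly (time_bound c1) K * B" "wp K B c2 Q s1" "mem_bounded B (fst s1)"
    by blast
  from Seq.IH(2)[OF 1(3,4)] obtain t2 s2 where
    2: "exec c2 s1 t2 s2" "t2 \<le> poly (time_bound c2) K * B" "Q s2" "mem_bounded B (fst s2)"
    by blast
  have "1 + t1 + t2 \<le> poly (time_bound (Seq c1 c2)) K * B"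
    using 1(2) 2(2) mem_bounded_pos[OF Seq.prems(2)] by (simp add: algebra_simps)
  then show ?case using exec.Seq[OF 1(1) 2(1)] 2 by blast
next
  case (Cond e c1 c2)
  have e: "1 + acost (fst s) e \<le> (1 + ecost e) * B"
    using acost_le[OF Cond.prems(2), of e] mem_bounded_pos[OF Cond.prems(2)] by simp
  show ?case
  proof (cases "aval (fst s) e = 0")
    case True
    then have "wp K B c2 Q s" using Cond.prems(1) by simp
    from Cond.IH(2)[OF this Cond.prems(2)] obtain t s' where *: "exec c2 s t s'" "t \<le> poly (time_bound c2) K * B" "Q s'"
        "mem_bounded B (fst s')" by blast
    have "1 + acost (fst s) e + t \<le> poly (time_bound (Cond e c1 c2)) K * B"
      using e * by (simp add: algebra_simps)
    then show ?thesis using exec.CondFalse[OF True *(1)] * by blast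
  next
    case False
    then have "wp K B c1 Q s" using Cond.prems(1) by simp
    from Cond.IH(1)[OF this Cond.prems(2)] obtain t s' where *: "exec c1 s t s'" "t \<le> poly (time_bound c1) K * B" "Q s'"
        "mem_bounded B (fst s')" by blast
    have "1 + acost (fst s) e + t \<le> poly (time_bound (Cond e c1 c2)) K * B"
      using e * by (simp add: algebra_simps)
    then show ?thesis using exec.CondTrue[OF False *(1)] * by blast
  qed
next
  case (While e c)
  let ?T = "(1 + ecost e + poly (time_bound c) K) * B"
  let ?F = "\<lambda>R s. aval (fst s) e \<noteq> 0 \<and> wp K B c R s"
  have loop: "\<exists>t s'. exec (While e c) s t s' \<and> t \<le> (k + 1) * ?T \<and> Q s' \<and> mem_bounded B (fst s')"
    if "(?F ^^ k) (\<lambda>s. aval (fst s) e = 0 \<and> Q s) s" "mem_bounded B (fst s)" for k s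
    using that
  proof (induction k arbitrary: s)
    case 0
    have "1 + acost (fst s) e \<le> ?T"
      using acost_le[OF 0(2), of e] mem_bounded_pos[OF 0(2)] by (simp add: algebra_simps)
    then show ?case using 0 exec.WhileFalse[of s e c]
      by (intro exI[of _ "1 + acost (fst s) e"] exI[of _ s]) simp
  next
    case (Suc k)
    from Suc.prems(1) have e: "aval (fst s) e \<noteq> 0"
      and wp: "wp K B c ((?F ^^ k) (\<lambda>s. aval (fst s) e = 0 \<and> Q s)) s"
      by simp_all
    from While.IH[OF wp Suc.prems(2)] obtain t1 s1 where
      1: "exec c s t1 s1" "t1 \<le> poly (time_bound c) K * B"
        "(?F ^^ k) (\<lambda>s. aval (fst s) e = 0 \<and> Q s) s1" "mem_bounded B (fst s1)"
      by blast
    from Suc.IH[OF 1(3,4)] obtain t2 s2 where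
      2: "exec (While e c) s1 t2 s2" "t2 \<le> (k + 1) * ?T" "Q s2" "mem_bounded B (fst s2)"
      by blast
    have "1 + acost (fst s) e + t1 + t2 \<le> (Suc k + 1) * ?T"
      using acost_le[OF Suc.prems(2), of e] mem_bounded_pos[OF Suc.prems(2)] 1(2) 2(2)
      by (simp add: algebra_simps)
    then show ?case using exec.WhileTrue[OF e 1(1) 2(1)] 2 by blast
  qed
  from While.prems obtain k where k: "k \<le> K"
    "(?F ^^ k) (\<lambda>s. aval (fst s) e = 0 \<and> Q s) s" by auto
  from loop[OF k(2) While.prems(2)] obtain t s' where
    *: "exec (While e c) s t s'" "t \<le> (k + 1) * ?T" "Q s'" "mem_bounded B (fst s')" by blast
  have "(k + 1) * ?T \<le> (K + 1) * ?T" using k by (intro mult_right_mono) auto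
  with * have "t \<le> poly (time_bound (While e c)) K * B" by (simp add: algebra_simps)
  then show ?case using * by blast
qed

lemma wp_mono:
  assumes "wp K B c Q s" "\<And>s. Q s \<Longrightarrow> Q' s"
  shows "wp K B c Q' s"
  using assms
proof (induction c arbitrary: Q Q' s)
  case (Seq c1 c2)
  from Seq.prems(1) have "wp K B c1 (wp K B c2 Q) s" by simp
  then have "wp K B c1 (wp K B c2 Q') s"
    by (rule Seq.IH(1)) (rule Seq.IH(2)[OF _ Seq.prems(2)])
  then show ?case by simp
next
  case (While e c)
  let ?F = "\<lambda>R s. aval (fst s) e \<noteq> 0 \<and> wp K B c R s"
  have "(?F ^^ k) (\<lambda>s. aval (fst s) e = 0 \<and> Q' s) s"
    if "(?F ^^ k) (\<lambda>s. aval (fst s) e = 0 \<and> Q s) s" for k s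
    using that
  proof (induction k arbitrary: s)
    case (Suc k)
    then have "aval (fst s) e \<noteq> 0"
      and wp: "wp K B c ((?F ^^ k) (\<lambda>s. aval (fst s) e = 0 \<and> Q s)) s" by simp_all
    moreover have "wp K B c ((?F ^^ k) (\<lambda>s. aval (fst s) e = 0 \<and> Q' s)) s"
      using While.IH[OF wp Suc.IH] .
    ultimately show ?case by simp
  qed (use While.prems in auto)
  then show ?case using While.prems(1) unfolding wp.simps by blast
qed (auto split: if_splits prod.splits)

text \<open>The invariant is indexed by the number of completed rounds, and \<open>N\<close> is the
  exact number of rounds, so termination and the iteration bound come with the invariant.\<close>

lemma wp_While:
  assumes "I 0 s"
    and "\<And>k s. k < N \<Longrightarrow> I k s \<Longrightarrow> aval (fst s) e \<noteq> 0 \<and> wp K B c (I (Suc k)) s"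
    and "\<And>s. I N s \<Longrightarrow> aval (fst s) e = 0 \<and> Q s"
    and "N \<le> K"
  shows "wp K B (While e c) Q s"
proof -
  let ?F = "\<lambda>R s. aval (fst s) e \<noteq> 0 \<and> wp K B c R s"
  \<comment> \<open>Here \<open>k\<close> counts the rounds still to come, in step with the
    unfolding of the iterated transformer.\<close>
  have "I (N - k) s \<Longrightarrow> k \<le> N \<Longrightarrow> (?F ^^ k) (\<lambda>s. aval (fst s) e = 0 \<and> Q s) s" for k s
  proof (induction k arbitrary: s)
    case (Suc k)
    have "aval (fst s) e \<noteq> 0 \<and> wp K B c (I (Suc (N - Suc k))) s"
      using assms(2)[of "N - Suc k" s] Suc.prems by simp
    moreover have "Suc (N - Suc k) = N - k" using Suc.prems by simp
    ultimately show ?case using Suc.IH Suc.prems by (auto elim!: wp_mono)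
  qed (use assms(3) in auto)
  from this[of N s] show ?thesis using assms(1,4) by auto
qed

section \<open>Scalar variables and counting loops\<close>

abbreviation Var :: "string \<Rightarrow> aexp" where "Var x \<equiv> Cell x (Const 0)"

abbreviation assign_var :: "string \<Rightarrow> aexp \<Rightarrow> com" (infix "::=" 61) where
  "x ::= e \<equiv> Assign x (Const 0) e"

abbreviation seq (infixr ";;" 60) where "c1 ;; c2 \<equiv> Seq c1 c2"

definition For :: "string \<Rightarrow> aexp \<Rightarrow> com \<Rightarrow> com" where
  "For x e c = (x ::= Const 0 ;;
     While (Op Less (Var x) e) (c ;; x ::= Op Add (Var x) (Const 1)))"

text \<open>The rule advances the counter itself; the body has to leave it alone. The bound
  \<open>e\<close> is evaluated anew at every test, hence the third premise. The counter stops at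
  \<open>N\<close>, so values up to \<open>N\<close> inclusive must fit.\<close>

lemma wp_For:
  assumes "I 0 (m(x := (m x)(0 := 0)), inp, out)"
    and "\<And>k m inp out. k < N \<Longrightarrow> m x 0 = int k \<Longrightarrow> I k (m, inp, out) \<Longrightarrow>
       wp K B c (\<lambda>(m, inp, out). m x 0 = int k \<and>
         I (Suc k) (m(x := (m x)(0 := int k + 1)), inp, out)) (m, inp, out)"
    and "\<And>k m inp out. m x 0 = int k \<Longrightarrow> I k (m, inp, out) \<Longrightarrow> aval m e = int N"
    and "\<And>m inp out. I N (m, inp, out) \<Longrightarrow> Q (m, inp, out)"
    and "N \<le> K" and "\<And>k. k \<le> N \<Longrightarrow> bit_size (int k) \<le> B"
  shows "wp K B (For x e c) Q (m, inp, out)"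
proof -
  let ?I = "\<lambda>k (m, inp, out). k \<le> N \<and> m x 0 = int k \<and> I k (m, inp, out)"
  have "wp K B (While (Op Less (Var x) e) (c ;; x ::= Op Add (Var x) (Const 1))) Q
      (m(x := (m x)(0 := 0)), inp, out)"
  proof (rule wp_While[where I = ?I and N = N])
    fix k s
    assume k: "k < N" and I: "?I k s"
    obtain m inp out where s: "s = (m, inp, out)" by (cases s)
    from k I s have "wp K B c (\<lambda>(m, inp, out). m x 0 = int k \<and>
        I (Suc k) (m(x := (m x)(0 := int k + 1)), inp, out)) s"
      using assms(2)[of k m inp out] by simp
    moreover have "bit_size (int (Suc k)) \<le> B" using assms(6)[of "Suc k"] k by simp
    ultimately have "wp K B (c ;; x ::= Op Add (Var x) (Const 1)) (?I (Suc k)) s"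
      using k by (auto elim!: wp_mono simp: ac_simps)
    then show "aval (fst s) (Op Less (Var x) e) \<noteq> 0 \<and>
        wp K B (c ;; x ::= Op Add (Var x) (Const 1)) (?I (Suc k)) s"
      using assms(3)[of m k inp out] I s k by simp
  qed (use assms in \<open>auto\<close>)
  then show ?thesis using assms(6)[of 0] by (simp add: For_def)
qed

section \<open>Suppressing the output of a program\<close>

fun strip_writes :: "com \<Rightarrow> com" where
  "strip_writes (Write e) = Skip"
| "strip_writes (Seq c1 c2) = Seq (strip_writes c1) (strip_writes c2)"
| "strip_writes (Cond e c1 c2) = Cond e (strip_writes c1) (strip_writes c2)"
| "strip_writes (While e c) = While e (strip_writes c)"
| "strip_writes c = c"

text \<open>Expressions never look at the output, so memory and input evolve as before, and
  replacing \<open>Write\<close> by \<open>Skip\<close> can only lower the cost.\<close>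

lemma exec_strip_writes:
  assumes "exec c s t s'"
  shows "\<exists>t'\<le>t. exec (strip_writes c) (fst s, fst (snd s), out) t' (fst s', fst (snd s'), out)"
  using assms
proof induction
  case (Skip s)
  show ?case using exec.Skip by (metis order_refl strip_writes.simps(5))
next
  case (Assign x e f m inp _)
  show ?case using exec.Assign[of x e f m inp out]
    by (intro exI[of _ "1 + acost m e + acost m f"]) (simp del: fun_upd_apply)
next
  case (Read x e m z inp _)
  show ?case using exec.Read[of x e m z inp out]
    by (intro exI[of _ "1 + acost m e + bit_size z"]) (simp del: fun_upd_apply)
next
  case (Write e m inp _)
  show ?case using exec.Skip[of "(m, inp, _)"] by (intro exI[of _ 1]) auto
next
  case (Seq c1 s t1 s' c2 t2 s'')
  then obtain t1' t2' where "t1' \<le> t1" "t2' \<le> t2"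
    "exec (strip_writes c1) (fst s, fst (snd s), out) t1' (fst s', fst (snd s'), out)"
    "exec (strip_writes c2) (fst s', fst (snd s'), out) t2' (fst s'', fst (snd s''), out)" by blast
  then show ?case using exec.Seq by (intro exI[of _ "1 + t1' + t2'"]) auto
next
  case (CondTrue s e c1 t s' c2)
  then obtain t' where "t' \<le> t"
    "exec (strip_writes c1) (fst s, fst (snd s), out) t' (fst s', fst (snd s'), out)" by blast
  then show ?case using CondTrue exec.CondTrue[of "(fst s, fst (snd s), out)" e]
    by (intro exI[of _ "1 + acost (fst s) e + t'"]) auto
next
  case (CondFalse s e c2 t s' c1)
  then obtain t' where "t' \<le> t"
    "exec (strip_writes c2) (fst s, fst (snd s), out) t' (fst s', fst (snd s'), out)" by blast
  then show ?case using CondFalse exec.CondFalse[of "(fst s, fst (snd s), out)" e]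
    by (intro exI[of _ "1 + acost (fst s) e + t'"]) auto
next
  case (WhileFalse s e c)
  then show ?case using exec.WhileFalse[of "(fst s, fst (snd s), out)" e] by auto
next
  case (WhileTrue s e c t1 s' t2 s'')
  then obtain t1' t2' where "t1' \<le> t1" "t2' \<le> t2"
    "exec (strip_writes c) (fst s, fst (snd s), out) t1' (fst s', fst (snd s'), out)"
    "exec (strip_writes (While e c)) (fst s', fst (snd s'), out) t2' (fst s'', fst (snd s''), out)"
    by blast
  then show ?case using WhileTrue exec.WhileTrue[of "(fst s, fst (snd s), out)" e]
    by (intro exI[of _ "1 + acost (fst s) e + t1' + t2'"]) auto
qed

section \<open>Expansion along a one-parameter subgroup\<close>

definition exp_series :: "nat \<Rightarrow> (nat \<Rightarrow>\<^sub>0 rat) \<Rightarrow> laurent \<Rightarrow> rat fps" where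
  "exp_series n lam p =
     (\<Sum>a\<in>Poly_Mapping.keys p. fps_const (Poly_Mapping.lookup p a) * fps_exp (dot n lam a))"

lemma dot_add: "dot n lam (a + b) = dot n lam a + dot n lam b"
  by (simp add: dot_def lookup_add algebra_simps sum.distrib)

lemma dot_0 [simp]: "dot n lam 0 = 0"
  by (simp add: dot_def)

lemma exp_series_superset:
  assumes "finite A" "Poly_Mapping.keys p \<subseteq> A"
  shows "exp_series n lam p =
     (\<Sum>a\<in>A. fps_const (Poly_Mapping.lookup p a) * fps_exp (dot n lam a))"
  unfolding exp_series_def using assms
  by (intro sum.mono_neutral_left) (auto simp: in_keys_iff)

lemma exp_series_add: "exp_series n lam (p + q) = exp_series n lam p + exp_series n lam q"
proof -
  let ?A = "Poly_Mapping.keys p \<union> Poly_Mapping.keys q"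
  have "Poly_Mapping.keys (p + q) \<subseteq> ?A" by (rule keys_add)
  then show ?thesis
    by (simp add: exp_series_superset[of ?A] lookup_add sum.distrib algebra_simps
        flip: fps_const_add)
qed

lemma exp_series_single: "exp_series n lam (Poly_Mapping.single a c) = fps_const c * fps_exp (dot n lam a)"
  by (cases "c = 0") (auto simp: exp_series_def)

lemma exp_series_0 [simp]: "exp_series n lam 0 = 0"
  by (simp add: exp_series_def)

lemma exp_series_sum: "exp_series n lam (\<Sum>x\<in>A. f x) = (\<Sum>x\<in>A. exp_series n lam (f x))"
  by (induction A rule: infinite_finite_induct) (auto simp: exp_series_add)

text \<open>Both sides are bilinear, so monomials suffice; there exponents add and
  \<open>fps_exp\<close> turns sums into products.\<close>

lemma exp_series_mult: "exp_series n lam (p * q) = exp_series n lam p * exp_series n lam q"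
proof -
  let ?s = "\<lambda>p a. Poly_Mapping.single a (Poly_Mapping.lookup p a)"
  have decomp: "p = (\<Sum>a\<in>Poly_Mapping.keys p. ?s p a)" for p :: laurent
    by (rule poly_mapping_eqI) (simp add: lookup_sum lookup_single when_def in_keys_iff)
  have "p * q = (\<Sum>a\<in>Poly_Mapping.keys p. \<Sum>b\<in>Poly_Mapping.keys q. ?s p a * ?s q b)"
    by (subst decomp[of p], subst decomp[of q]) (simp add: sum_product)
  also have "exp_series n lam \<dots> = (\<Sum>a\<in>Poly_Mapping.keys p. \<Sum>b\<in>Poly_Mapping.keys q.
      (fps_const (Poly_Mapping.lookup p a) * fps_exp (dot n lam a)) *
      (fps_const (Poly_Mapping.lookup q b) * fps_exp (dot n lam b)))"
    by (simp add: exp_series_sum mult_single exp_series_single dot_add fps_exp_add_mult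
        mult_ac flip: fps_const_mult)
  also have "\<dots> = exp_series n lam p * exp_series n lam q"
    by (simp add: exp_series_def sum_product)
  finally show ?thesis .
qed

lemma exp_series_diff: "exp_series n lam (p - q) = exp_series n lam p - exp_series n lam q"
  using exp_series_add[of n lam "p - q" q] by simp

text \<open>At t = 0 every exponential equals 1.\<close>

lemma exp_series_nth_0: "fps_nth (exp_series n lam p) 0 = at_one p"
  by (simp add: exp_series_def at_one_def fps_sum_nth)

lemma exp_series_1 [simp]: "exp_series n lam 1 = 1"
  using exp_series_single[of n lam 0 1] by simp

text \<open>A relation rather than a function: for special \<lambda> a nonzero Laurent polynomial
  may have image 0, so only fractions with a suitable denominator have an expansion.\<close>

definition has_exp_expansion :: "nat \<Rightarrow> (nat \<Rightarrow>\<^sub>0 rat) \<Rightarrow> laurent fract \<Rightarrow> rat fls \<Rightarrow> bool" where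
  "has_exp_expansion n lam f F \<longleftrightarrow> (\<exists>p q. f = Fract p q \<and> exp_series n lam q \<noteq> 0 \<and>
     F = fps_to_fls (exp_series n lam p) / fps_to_fls (exp_series n lam q))"

text \<open>Equal fractions agree after cross-multiplication, and the ring homomorphism carries this
  identity over to series.\<close>

lemma has_exp_expansion_unique:
  assumes "has_exp_expansion n lam f F" "has_exp_expansion n lam f G"
  shows "F = G"
proof -
  from assms obtain p q p' q' where
    p: "f = Fract p q" "exp_series n lam q \<noteq> 0"
      "F = fps_to_fls (exp_series n lam p) / fps_to_fls (exp_series n lam q)" and
    p': "f = Fract p' q'" "exp_series n lam q' \<noteq> 0"
      "G = fps_to_fls (exp_series n lam p') / fps_to_fls (exp_series n lam q')"
    unfolding has_exp_expansion_def by blast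
  have "q \<noteq> 0" "q' \<noteq> 0" using p(2) p'(2) by auto
  then have "p * q' = p' * q" using p(1) p'(1) by (simp add: eq_fract)
  then have "exp_series n lam p * exp_series n lam q' = exp_series n lam p' * exp_series n lam q"
    by (metis exp_series_mult)
  then have "fps_to_fls (exp_series n lam p) * fps_to_fls (exp_series n lam q') =
      fps_to_fls (exp_series n lam p') * fps_to_fls (exp_series n lam q)"
    by (metis fls_times_fps_to_fls)
  moreover have "fps_to_fls (exp_series n lam q) \<noteq> 0" "fps_to_fls (exp_series n lam q') \<noteq> 0"
    using p(2) p'(2) by simp_all
  ultimately show ?thesis
    unfolding p(3) p'(3) by (simp add: frac_eq_eq)
qed

lemma has_exp_expansion_add:
  assumes "has_exp_expansion n lam f F" "has_exp_expansion n lam g G"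
  shows "has_exp_expansion n lam (f + g) (F + G)"
proof -
  from assms obtain p q p' q' where
    p: "f = Fract p q" "exp_series n lam q \<noteq> 0"
      "F = fps_to_fls (exp_series n lam p) / fps_to_fls (exp_series n lam q)" and
    p': "g = Fract p' q'" "exp_series n lam q' \<noteq> 0"
      "G = fps_to_fls (exp_series n lam p') / fps_to_fls (exp_series n lam q')"
    unfolding has_exp_expansion_def by blast
  have "q \<noteq> 0" "q' \<noteq> 0" using p(2) p'(2) by auto
  then have "f + g = Fract (p * q' + p' * q) (q * q')"
    using p(1) p'(1) by simp
  moreover have "F + G = fps_to_fls (exp_series n lam (p * q' + p' * q)) /
      fps_to_fls (exp_series n lam (q * q'))"
    using p(2) p'(2) unfolding p(3) p'(3)
    by (simp add: add_frac_eq exp_series_mult exp_series_add fls_times_fps_to_fls)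
  ultimately show ?thesis unfolding has_exp_expansion_def using p(2) p'(2)
    by (metis exp_series_mult no_zero_divisors)
qed

lemma has_exp_expansion_mult:
  assumes "has_exp_expansion n lam f F" "has_exp_expansion n lam g G"
  shows "has_exp_expansion n lam (f * g) (F * G)"
proof -
  from assms obtain p q p' q' where
    p: "f = Fract p q" "exp_series n lam q \<noteq> 0"
      "F = fps_to_fls (exp_series n lam p) / fps_to_fls (exp_series n lam q)" and
    p': "g = Fract p' q'" "exp_series n lam q' \<noteq> 0"
      "G = fps_to_fls (exp_series n lam p') / fps_to_fls (exp_series n lam q')"
    unfolding has_exp_expansion_def by blast
  then show ?thesis unfolding has_exp_expansion_def
    by (intro exI[of _ "p * p'"] exI[of _ "q * q'"])
      (simp add: exp_series_mult fls_times_fps_to_fls)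
qed

text \<open>That \<open>F\<close> is nonzero means that the numerator has a nonzero image and may
  serve as a denominator.\<close>

lemma has_exp_expansion_inverse:
  assumes "has_exp_expansion n lam f F" "F \<noteq> 0"
  shows "has_exp_expansion n lam (inverse f) (inverse F)"
proof -
  from assms obtain p q where
    p: "f = Fract p q" "exp_series n lam q \<noteq> 0"
      "F = fps_to_fls (exp_series n lam p) / fps_to_fls (exp_series n lam q)"
    unfolding has_exp_expansion_def by blast
  then show ?thesis unfolding has_exp_expansion_def using assms(2)
    by (intro exI[of _ q] exI[of _ p]) auto
qed

lemma has_exp_expansion_fract: "has_exp_expansion n lam (to_fract p) (fps_to_fls (exp_series n lam p))"
  unfolding has_exp_expansion_def by (intro exI[of _ p] exI[of _ 1]) (simp add: to_fract_def)

lemma has_exp_expansion_sum: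
  "(\<And>i. i \<in> A \<Longrightarrow> has_exp_expansion n lam (f i) (F i)) \<Longrightarrow> has_exp_expansion n lam (\<Sum>i\<in>A. f i) (\<Sum>i\<in>A. F i)"
proof (induction A rule: infinite_finite_induct)
  case (insert x A)
  then show ?case by (auto intro: has_exp_expansion_add)
qed (use has_exp_expansion_fract[of n lam 0] in auto)

lemma has_exp_expansion_prod:
  "(\<And>i. i \<in> A \<Longrightarrow> has_exp_expansion n lam (f i) (F i)) \<Longrightarrow> has_exp_expansion n lam (\<Prod>i\<in>A. f i) (\<Prod>i\<in>A. F i)"
proof (induction A rule: infinite_finite_induct)
  case (insert x A)
  then show ?case by (auto intro: has_exp_expansion_mult)
qed (use has_exp_expansion_fract[of n lam 1] in auto)

text \<open>The denominator that witnesses regularity has a nonzero constant term, so the expansion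
  obtained from it is a power series with constant term \<open>r\<close>. Uniqueness passes this on
  to \<open>F\<close>, which may have been assembled from summands with poles.\<close>

lemma specializes_to_nth_0:
  assumes "specializes_to f r" "has_exp_expansion n lam f F"
  shows "r = fls_nth F 0"
proof -
  from assms(1) obtain p q where
    *: "f = Fract p q" "at_one q \<noteq> 0" "r = at_one p / at_one q"
    unfolding specializes_to_def by auto
  let ?p = "exp_series n lam p" and ?q = "exp_series n lam q"
  have q0: "fps_nth ?q 0 \<noteq> 0" using * by (simp add: exp_series_nth_0)
  then have "?q \<noteq> 0" by auto
  then have "has_exp_expansion n lam f (fps_to_fls ?p / fps_to_fls ?q)"
    using * unfolding has_exp_expansion_def by blast
  with assms(2) have "F = fps_to_fls ?p / fps_to_fls ?q" by (rule has_exp_expansion_unique)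
  also have "\<dots> = fps_to_fls (?p * inverse ?q)"
    using q0 by (simp add: fls_times_fps_to_fls fls_inverse_fps_to_fls divide_inverse)
  finally show ?thesis using * q0 by (simp add: exp_series_nth_0 divide_inverse)
qed

section \<open>Todd series and the weights of a summand\<close>

definition todd_factor :: "rat \<Rightarrow> rat fps" where
  "todd_factor b = Abs_fps (\<lambda>k. b ^ k / fact (Suc k))"

text \<open>The product of the series b t / (exp (b t) - 1); its coefficients are the Todd
  polynomials evaluated at the numbers -b.\<close>

definition todd_inverse :: "rat list \<Rightarrow> rat fps" where
  "todd_inverse bs = (\<Prod>b\<leftarrow>bs. inverse (todd_factor b))"

definition weight :: "rat list \<Rightarrow> nat \<Rightarrow> rat" where
  "weight bs l = fps_nth (todd_inverse bs) (length bs - l) / (fact l * (\<Prod>b\<leftarrow>bs. - b))"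

lemma todd_factor_0 [simp]: "fps_nth (todd_factor b) 0 = 1"
  by (simp add: todd_factor_def)

lemma one_minus_exp: "1 - fps_exp b = fps_const (- b) * fps_X * todd_factor b"
proof (rule fps_ext)
  fix k
  show "fps_nth (1 - fps_exp b) k = fps_nth (fps_const (- b) * fps_X * todd_factor b) k"
    by (cases k) (simp_all add: todd_factor_def mult.assoc del: fact_Suc)
qed

lemma prod_one_minus_exp:
  "(\<Prod>b\<leftarrow>bs. 1 - fps_exp b) * todd_inverse bs = fps_const (\<Prod>b\<leftarrow>bs. - b) * fps_X ^ length bs"
proof (induction bs)
  case Nil
  then show ?case by (simp add: todd_inverse_def)
next
  case (Cons b bs)
  have "todd_factor b * inverse (todd_factor b) = 1"
    using inverse_mult_eq_1[of "todd_factor b"] by (simp add: mult.commute)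
  then have *: "(1 - fps_exp b) * inverse (todd_factor b) = fps_const (- b) * fps_X"
    by (simp add: one_minus_exp mult.assoc)
  have "(\<Prod>b\<leftarrow>b # bs. 1 - fps_exp b) * todd_inverse (b # bs) =
     ((1 - fps_exp b) * inverse (todd_factor b)) * ((\<Prod>b\<leftarrow>bs. 1 - fps_exp b) * todd_inverse bs)"
    by (simp add: todd_inverse_def mult_ac)
  also have "\<dots> = fps_const (- b) * fps_X * (fps_const (\<Prod>b\<leftarrow>bs. - b) * fps_X ^ length bs)"
    by (simp only: * Cons)
  also have "\<dots> = (fps_const (- b) * fps_const (\<Prod>b\<leftarrow>bs. - b)) * fps_X ^ length (b # bs)"
    by (simp add: mult_ac del: fps_const_neg fps_const_mult)
  also have "\<dots> = fps_const (\<Prod>b\<leftarrow>b # bs. - b) * fps_X ^ length (b # bs)"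
    by simp
  finally show ?case .
qed

text \<open>The denominator contributes t^s and a constant, so up to this constant the coefficient
  of t^s in \<open>fps_exp a * todd_inverse bs\<close> is wanted: there a^l / l! meets the Todd
  coefficient of index s - l.\<close>

lemma summand_nth_0:
  assumes "\<forall>b\<in>set bs. b \<noteq> 0"
  shows "fls_nth (fps_to_fls (fps_exp a) / fps_to_fls (\<Prod>b\<leftarrow>bs. 1 - fps_exp b)) 0 =
    (\<Sum>l=0..length bs. weight bs l * a ^ l)"
proof -
  let ?s = "length bs" and ?c = "\<Prod>b\<leftarrow>bs. - b" and ?T = "todd_inverse bs"
  let ?P = "\<Prod>b\<leftarrow>bs. 1 - fps_exp b"
  have c: "?c \<noteq> 0" using assms by (induction bs) auto
  have eq: "?P * ?T = fps_const ?c * fps_X ^ ?s" by (rule prod_one_minus_exp)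
  then have ne: "?P \<noteq> 0" "?T \<noteq> 0" using c by auto
  let ?Q = "fps_to_fls (fps_exp a) / fps_to_fls ?P"
  have "?Q * fps_to_fls (?P * ?T) = fps_to_fls (fps_exp a * ?T)"
    using ne by (simp add: fls_times_fps_to_fls)
  \<comment> \<open>Multiplication by t^s is a shift, which moves the coefficient of index 0 to
    index s.\<close>
  then have "fls_shift (- int ?s) (fls_const ?c * ?Q) = fps_to_fls (fps_exp a * ?T)"
    unfolding eq
    by (simp add: fls_times_fps_to_fls fps_to_fls_power mult.assoc[symmetric] mult.commute[of ?Q]
        fls_X_power_times_conv_shift(2)[symmetric])
      (simp add: mult_ac)
  then have "fls_nth (fls_shift (- int ?s) (fls_const ?c * ?Q)) (int ?s) =
      fls_nth (fps_to_fls (fps_exp a * ?T)) (int ?s)"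
    by (rule arg_cong)
  then have "fls_nth ?Q 0 = fps_nth (fps_exp a * ?T) ?s / ?c"
    using c by (simp add: eq_divide_eq mult.commute del: times_divide_eq_right)
  also have "\<dots> = (\<Sum>l=0..?s. weight bs l * a ^ l)"
    by (simp add: fps_mult_nth sum_divide_distrib weight_def field_simps)
  finally show ?thesis .
qed

lemma fls_nth_sum: "fls_nth (\<Sum>i\<in>A. f i) k = (\<Sum>i\<in>A. fls_nth (f i) k)"
  by (induction A rule: infinite_finite_induct) auto

text \<open>Each summand is expanded separately as a Laurent series. Its pole does no harm: the
  coefficients of index 0 add up to that of the whole sum, which is the specialization. The
  exponents \<open>a\<close> are arbitrary so that dilations are covered too.\<close>

lemma specializes_rat_fun:
  assumes sp: "specializes_to (rat_fun D a) r"
    and ne: "\<And>i j. i \<in> gf_index D \<Longrightarrow> j < gf_len D i \<Longrightarrow> dot n lam (gf_den D i j) \<noteq> 0"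
  shows "r = (\<Sum>i\<in>gf_index D. gf_coeff D i *
    (\<Sum>l=0..gf_len D i. weight (map (dot n lam) (snd (snd (gf_terms D ! i)))) l * dot n lam (a i) ^ l))"
proof -
  let ?bs = "\<lambda>i. map (dot n lam) (snd (snd (gf_terms D ! i)))"
  let ?P = "\<lambda>i. \<Prod>b\<leftarrow>?bs i. 1 - fps_exp b"
  let ?F = "\<lambda>i. fls_const (gf_coeff D i) * (fps_to_fls (fps_exp (dot n lam (a i))) / fps_to_fls (?P i))"
  have nz: "\<forall>b\<in>set (?bs i). b \<noteq> 0" if "i \<in> gf_index D" for i
    using ne[OF that] by (auto simp: in_set_conv_nth gf_len_def gf_den_def)
  have "has_exp_expansion n lam (to_fract (scalar (gf_coeff D i)) *
      (to_fract (monomial (a i)) / (\<Prod>j<gf_len D i. 1 - to_fract (monomial (gf_den D i j))))) (?F i)"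
    if i: "i \<in> gf_index D" for i
  proof -
    have 1: "has_exp_expansion n lam (to_fract (scalar (gf_coeff D i))) (fls_const (gf_coeff D i))"
      using has_exp_expansion_fract[of n lam "scalar (gf_coeff D i)"]
      by (simp add: scalar_def exp_series_single)
    have 2: "has_exp_expansion n lam (to_fract (monomial b)) (fps_to_fls (fps_exp (dot n lam b)))" for b
      using has_exp_expansion_fract[of n lam "monomial b"]
      by (simp add: monomial_def exp_series_single)
    have "has_exp_expansion n lam (1 - to_fract (monomial b)) (fps_to_fls (1 - fps_exp (dot n lam b)))" for b
      using has_exp_expansion_fract[of n lam "1 - monomial b"]
      by (simp add: monomial_def exp_series_single exp_series_diff)
    then have "has_exp_expansion n lam (\<Prod>j<gf_len D i. 1 - to_fract (monomial (gf_den D i j)))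
        (\<Prod>j<gf_len D i. fps_to_fls (1 - fps_exp (dot n lam (gf_den D i j))))"
      by (intro has_exp_expansion_prod)
    also have "(\<Prod>j<gf_len D i. fps_to_fls (1 - fps_exp (dot n lam (gf_den D i j)))) =
        fps_to_fls (\<Prod>j<gf_len D i. 1 - fps_exp (dot n lam (gf_den D i j)))"
      (is "prod ?f {..<?s} = fps_to_fls (prod ?g {..<?s})")
    proof -
      have "prod ?f {..<k} = fps_to_fls (prod ?g {..<k})" for k
        by (induction k) (simp_all add: fls_times_fps_to_fls)
      then show ?thesis .
    qed
    also have "(\<Prod>j<gf_len D i. 1 - fps_exp (dot n lam (gf_den D i j))) = ?P i"
      by (simp add: prod.list_conv_set_nth gf_len_def gf_den_def atLeast0LessThan)
    finally have 3: "has_exp_expansion n lam (\<Prod>j<gf_len D i. 1 - to_fract (monomial (gf_den D i j)))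
      (fps_to_fls (?P i))" .
    \<comment> \<open>The linear coefficient of this series is -b.\<close>
    have "fps_nth (1 - fps_exp b) 1 \<noteq> 0" if "b \<in> set (?bs i)" for b
      using nz[OF i] that by auto
    then have "1 - fps_exp b \<noteq> 0" if "b \<in> set (?bs i)" for b
      using that by (metis fps_zero_nth)
    then have "?P i \<noteq> 0"
      by (auto simp: prod_list_zero_iff)
    then show ?thesis
      unfolding divide_inverse
      by (intro has_exp_expansion_mult has_exp_expansion_inverse 1 2 3) simp
  qed
  then have "has_exp_expansion n lam (rat_fun D a) (\<Sum>i\<in>gf_index D. ?F i)"
    unfolding rat_fun_def by (rule has_exp_expansion_sum)
  with sp have "r = fls_nth (\<Sum>i\<in>gf_index D. ?F i) 0"
    by (rule specializes_to_nth_0)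
  also have "\<dots> = (\<Sum>i\<in>gf_index D. fls_nth (?F i) 0)"
    by (rule fls_nth_sum)
  also have "\<dots> = (\<Sum>i\<in>gf_index D. gf_coeff D i *
      (\<Sum>l=0..gf_len D i. weight (?bs i) l * dot n lam (a i) ^ l))"
  proof (intro sum.cong refl)
    fix i assume "i \<in> gf_index D"
    then show "fls_nth (?F i) 0 = gf_coeff D i *
        (\<Sum>l=0..gf_len D i. weight (?bs i) l * dot n lam (a i) ^ l)"
      using summand_nth_0[OF nz, of i "dot n lam (a i)"]
      by (simp only: fls_mult_const_nth gf_len_def length_map)
  qed
  finally show ?thesis .
qed

text \<open>A Laurent polynomial has denominator 1, so its specialization is the sum of its
  coefficients. For infinitely many lattice points \<open>sum\<close> and \<open>card\<close> would
  both give 0.\<close>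

lemma specializes_gen_fun: "specializes_to (to_fract (gen_fun P)) (of_nat (card (lattice_points P)))"
proof -
  have add: "at_one (p + q) = at_one p + at_one q" for p q
    by (simp flip: exp_series_nth_0[of 0 0] add: exp_series_add)
  have "at_one (\<Sum>x\<in>A. f x) = (\<Sum>x\<in>A. at_one (f x))" for A :: "(nat \<Rightarrow>\<^sub>0 int) set" and f
    by (induction A rule: infinite_finite_induct) (auto simp: add, simp_all add: at_one_def)
  then have "at_one (gen_fun P) = of_nat (card (lattice_points P))"
    by (simp add: gen_fun_def monomial_def at_one_def)
  moreover have "at_one 1 = 1" by (simp flip: exp_series_nth_0[of 0 0])
  ultimately show ?thesis
    unfolding specializes_to_def to_fract_def by (intro exI[of _ "gen_fun P"] exI[of _ 1]) simp
qed

section \<open>Growth of lattice point counts\<close>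

lemma lookup_scaleR [simp]:
  "Poly_Mapping.lookup (r *\<^sub>R x) l = r *\<^sub>R Poly_Mapping.lookup x l"
proof -
  have "finite {l. r *\<^sub>R Poly_Mapping.lookup x l \<noteq> 0}"
    by (rule finite_subset[OF _ finite_lookup[of x]]) auto
  then show ?thesis by (simp add: scaleR_poly_mapping_def)
qed

lemma lookup_real_vec [simp]: "Poly_Mapping.lookup (real_vec a) l = of_int (Poly_Mapping.lookup a l)"
  by (simp add: real_vec_def Poly_Mapping.map.rep_eq when_def)

lemma in_vecs_iff: "x \<in> vecs n \<longleftrightarrow> (\<forall>l\<ge>n. Poly_Mapping.lookup x l = 0)"
  by (auto simp: vecs_def in_keys_iff subset_iff) (metis not_le)

lemma subspace_vecs: "subspace (vecs n :: (nat \<Rightarrow>\<^sub>0 real) set)"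
  by (auto simp: subspace_def in_vecs_iff lookup_add)

lemma vecs_subset_span:
  "(vecs n :: (nat \<Rightarrow>\<^sub>0 real) set) \<subseteq> span ((\<lambda>l. Poly_Mapping.single l 1) ` {..<n})"
proof
  fix x :: "nat \<Rightarrow>\<^sub>0 real"
  assume "x \<in> vecs n"
  then have "x = (\<Sum>l<n. Poly_Mapping.lookup x l *\<^sub>R Poly_Mapping.single l 1)"
    by (intro poly_mapping_eqI)
      (auto simp: lookup_sum lookup_single when_def in_vecs_iff not_less sum.delta' if_distrib cong: if_cong)
  also have "\<dots> \<in> span ((\<lambda>l. Poly_Mapping.single l 1) ` {..<n})"
    by (intro span_sum span_scale span_base) auto
  finally show "x \<in> span ((\<lambda>l. Poly_Mapping.single l 1) ` {..<n})" .
qed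

text \<open>The ambient space has infinite dimension. Containment in \<open>vecs n\<close> makes a
  basis of \<open>V\<close> finite, which the exchange bound requires.\<close>

lemma independent_card_le_dim:
  fixes V :: "(nat \<Rightarrow>\<^sub>0 real) set"
  assumes "V \<subseteq> vecs n" "S \<subseteq> span V" "independent S"
  shows "finite S" "card S \<le> dim V"
proof -
  obtain B where B: "B \<subseteq> V" "independent B" "V \<subseteq> span B" "card B = dim V"
    using basis_exists by blast
  have "B \<subseteq> span ((\<lambda>l. Poly_Mapping.single l 1) ` {..<n})"
    using B(1) assms(1) vecs_subset_span by blast
  then have "finite B" using independent_span_bound[OF _ B(2)] by blast
  moreover have "S \<subseteq> span B"
    using assms(2) B(3) by (metis span_minimal subspace_span subset_trans)
  ultimately show "finite S" "card S \<le> dim V"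
    using independent_span_bound[of B S] assms(3) B(4) by auto
qed

text \<open>Take a minimal set of coordinates whose common vanishing forces a vector of
  \<open>span V\<close> to be 0. By minimality each of its coordinates has a vector in
  \<open>span V\<close> that is nonzero there and zero at the others. These vectors are independent,
  so there are at most \<open>dim V\<close> of them.\<close>

lemma separating_coordinates:
  fixes V :: "(nat \<Rightarrow>\<^sub>0 real) set"
  assumes "V \<subseteq> vecs n"
  obtains S where "finite S" "card S \<le> dim V"
    "\<And>x. x \<in> V \<Longrightarrow> (\<And>l. l \<in> S \<Longrightarrow> Poly_Mapping.lookup x l = 0) \<Longrightarrow> x = 0"
proof -
  let ?sep = "\<lambda>S. \<forall>x\<in>span V. (\<forall>l\<in>S. Poly_Mapping.lookup x l = 0) \<longrightarrow> x = 0"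
  have VV: "span V \<subseteq> vecs n" using assms subspace_vecs by (simp add: span_minimal)
  have "?sep {..<n}"
  proof (intro ballI impI poly_mapping_eqI)
    fix x k
    assume x: "x \<in> span V" "\<forall>l\<in>{..<n}. Poly_Mapping.lookup x l = 0"
    then have "x \<in> vecs n" using VV by blast
    then show "Poly_Mapping.lookup x k = Poly_Mapping.lookup 0 k"
      using x(2) by (cases "k < n") (auto simp: in_vecs_iff)
  qed
  then have ne: "{..<n} \<in> {S. S \<subseteq> {..<n} \<and> ?sep S}" (is "_ \<in> ?SS") by simp
  have "finite ?SS" by (rule finite_subset[of _ "Pow {..<n}"]) auto
  then have "\<exists>S\<in>?SS. \<forall>T\<in>?SS. T \<subseteq> S \<longrightarrow> S = T"
    by (rule finite_has_minimal) (use ne in blast)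
  then obtain S where "S \<in> ?SS" and min': "\<forall>T\<in>?SS. T \<subseteq> S \<longrightarrow> S = T" by (rule bexE)
  then have S: "S \<subseteq> {..<n}" "?sep S" by simp_all
  have min: "\<not> ?sep T" if "T \<subset> S" for T
  proof
    assume "?sep T"
    moreover have "T \<subseteq> {..<n}" using that S(1) by (rule subset_trans[OF psubset_imp_subset])
    ultimately have "T \<in> ?SS" by (intro CollectI conjI)
    then have "T \<subseteq> S \<longrightarrow> S = T" by (rule bspec[OF min'])
    then show False using that by auto
  qed
  have "\<exists>x\<in>span V. (\<forall>k\<in>S - {l}. Poly_Mapping.lookup x k = 0) \<and> Poly_Mapping.lookup x l \<noteq> 0"
    if l: "l \<in> S" for l
  proof -
    have "\<not> ?sep (S - {l})" using l by (intro min) auto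
    then obtain x where x: "x \<in> span V" "\<forall>k\<in>S - {l}. Poly_Mapping.lookup x k = 0" "x \<noteq> 0"
      by blast
    then have "Poly_Mapping.lookup x l \<noteq> 0" using S(2) by blast
    then show ?thesis using x by blast
  qed
  then obtain f where f: "\<And>l. l \<in> S \<Longrightarrow> f l \<in> span V"
    "\<And>l k. l \<in> S \<Longrightarrow> k \<in> S \<Longrightarrow> k \<noteq> l \<Longrightarrow> Poly_Mapping.lookup (f l) k = 0"
    "\<And>l. l \<in> S \<Longrightarrow> Poly_Mapping.lookup (f l) l \<noteq> 0"
  proof -
    assume *: "\<And>l. l \<in> S \<Longrightarrow> \<exists>x\<in>span V. (\<forall>k\<in>S - {l}. Poly_Mapping.lookup x k = 0) \<and>
      Poly_Mapping.lookup x l \<noteq> 0"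
    then obtain f where "\<forall>l\<in>S. f l \<in> span V \<and> (\<forall>k\<in>S - {l}. Poly_Mapping.lookup (f l) k = 0) \<and>
      Poly_Mapping.lookup (f l) l \<noteq> 0"
      unfolding Bex_def by metis
    then show thesis by (intro that[of f]) auto
  qed
  have fin: "finite S" using S(1) finite_subset by blast
  have inj: "inj_on f S" by (rule inj_onI) (metis f(2,3))
  have "independent (f ` S)"
  proof (subst independent_explicit_finite_subsets, intro allI impI ballI)
    fix A u v
    assume A: "A \<subseteq> f ` S" "finite A" "(\<Sum>w\<in>A. u w *\<^sub>R w) = 0" "v \<in> A"
    then obtain l where l: "l \<in> S" "v = f l" by blast
    have "0 = Poly_Mapping.lookup (\<Sum>w\<in>A. u w *\<^sub>R w) l" using A by simp
    also have "\<dots> = (\<Sum>w\<in>A. u w * Poly_Mapping.lookup w l)" by (simp add: lookup_sum)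
    also have "\<dots> = (\<Sum>w\<in>A. if w = v then u v * Poly_Mapping.lookup v l else 0)"
    proof (rule sum.cong[OF refl])
      fix w assume "w \<in> A"
      then obtain k where k: "k \<in> S" "w = f k" using A(1) by blast
      show "u w * Poly_Mapping.lookup w l = (if w = v then u v * Poly_Mapping.lookup v l else 0)"
        using f(2)[OF k(1) l(1)] k(2) l(2) by (cases "l = k") auto
    qed
    also have "\<dots> = u v * Poly_Mapping.lookup v l" using A by simp
    finally show "u v = 0" using l f(3) by simp
  qed
  moreover have "f ` S \<subseteq> span V" using f(1) by blast
  ultimately have "card S \<le> dim V"
    using independent_card_le_dim[OF assms] card_image[OF inj] by metis
  then show thesis using that[of S] fin S(2) span_base by blast
qed

section \<open>Lattice points in the dilations of a polytope\<close>

lemma polytope_lookup_bounded: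
  fixes P :: "(nat \<Rightarrow>\<^sub>0 real) set"
  assumes "polytope P"
  obtains C :: nat where "\<And>x l. x \<in> P \<Longrightarrow> \<bar>Poly_Mapping.lookup x l\<bar> \<le> real C"
proof -
  obtain v where v: "finite v" "P = convex hull v" using assms by (auto simp: polytope_def)
  \<comment> \<open>This sum over all generators dominates each single coordinate. The box with this
    half-width is convex, so it contains the hull of the generators.\<close>
  define C where "C = nat \<lceil>\<Sum>x\<in>v. \<Sum>l\<in>Poly_Mapping.keys x. \<bar>Poly_Mapping.lookup x l\<bar>\<rceil>"
  let ?B = "{x :: nat \<Rightarrow>\<^sub>0 real. \<forall>l. \<bar>Poly_Mapping.lookup x l\<bar> \<le> real C}"
  have "v \<subseteq> ?B"
  proof clarify
    fix x l
    assume x: "x \<in> v"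
    have "\<bar>Poly_Mapping.lookup x l\<bar> \<le> (\<Sum>l\<in>Poly_Mapping.keys x. \<bar>Poly_Mapping.lookup x l\<bar>)"
    proof (cases "l \<in> Poly_Mapping.keys x")
      case True
      then show ?thesis using member_le_sum[of l "Poly_Mapping.keys x" "\<lambda>l. \<bar>Poly_Mapping.lookup x l\<bar>"] by simp
    qed (auto simp: in_keys_iff intro: sum_nonneg)
    also have "\<dots> \<le> (\<Sum>x\<in>v. \<Sum>l\<in>Poly_Mapping.keys x. \<bar>Poly_Mapping.lookup x l\<bar>)"
      using v(1) x by (intro member_le_sum) (auto intro: sum_nonneg)
    also have "\<dots> \<le> real C" unfolding C_def by (rule real_nat_ceiling_ge)
    finally show "\<bar>Poly_Mapping.lookup x l\<bar> \<le> real C" .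
  qed
  moreover have "convex ?B"
  proof (rule convexI, clarify)
    fix x y :: "nat \<Rightarrow>\<^sub>0 real" and a b :: real and l
    assume x: "\<forall>l. \<bar>Poly_Mapping.lookup x l\<bar> \<le> real C" and y: "\<forall>l. \<bar>Poly_Mapping.lookup y l\<bar> \<le> real C"
      and ab: "0 \<le> a" "0 \<le> b" "a + b = 1"
    have "\<bar>a * Poly_Mapping.lookup x l + b * Poly_Mapping.lookup y l\<bar> \<le>
        a * \<bar>Poly_Mapping.lookup x l\<bar> + b * \<bar>Poly_Mapping.lookup y l\<bar>"
      using ab by (metis abs_mult abs_of_nonneg abs_triangle_ineq)
    also have "\<dots> \<le> a * C + b * C" using x y ab by (intro add_mono mult_left_mono) auto
    also have "\<dots> = C" using ab by (metis distrib_right mult_1)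
    finally show "\<bar>Poly_Mapping.lookup (a *\<^sub>R x + b *\<^sub>R y) l\<bar> \<le> real C" by (simp add: lookup_add)
  qed
  ultimately have "P \<subseteq> ?B" unfolding v(2) by (rule hull_minimal)
  then show thesis using that by blast
qed

text \<open>Two points of k P differ by k times a difference of points of P, so the coordinates in
  \<open>S\<close> tell the lattice points apart. Each coordinate is an integer between -k C and k
  C, and 2 k C + 1 is at most (2 C + 1) k for positive k.\<close>

lemma card_lattice_points_dilate_le:
  assumes "polytope_in n P" "affine_dim P = int d"
  obtains C :: nat where "\<And>k. k \<ge> 1 \<Longrightarrow> card (lattice_points (dilate k P)) \<le> C * k ^ d"
proof -
  let ?V = "{x - y | x y. x \<in> P \<and> y \<in> P}"
  have P: "polytope P" "P \<subseteq> vecs n" using assms(1) by (auto simp: polytope_in_def)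
  have d: "dim ?V = d" using assms(2) by (simp add: affine_dim_def split: if_splits)
  have "?V \<subseteq> vecs n" using P(2) subspace_vecs[of n] by (auto intro: subspace_diff)
  then obtain S where S: "finite S" "card S \<le> d"
    "\<And>x. x \<in> ?V \<Longrightarrow> (\<And>l. l \<in> S \<Longrightarrow> Poly_Mapping.lookup x l = 0) \<Longrightarrow> x = 0"
    by (rule separating_coordinates) (use d in simp)
  obtain C where C: "\<And>x l. x \<in> P \<Longrightarrow> \<bar>Poly_Mapping.lookup x l\<bar> \<le> real C"
    using polytope_lookup_bounded[OF P(1)] by blast
  have "card (lattice_points (dilate k P)) \<le> (2 * C + 1) ^ d * k ^ d" if k: "k \<ge> 1" for k
  proof -
    let ?L = "lattice_points (dilate k P)"
    let ?r = "\<lambda>\<alpha> :: nat \<Rightarrow>\<^sub>0 int. restrict (Poly_Mapping.lookup \<alpha>) S"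
    let ?I = "{- int (k * C)..int (k * C)}"
    have inj: "inj_on ?r ?L"
    proof (rule inj_onI)
      fix \<alpha> \<beta> assume "\<alpha> \<in> ?L" "\<beta> \<in> ?L" and eq: "?r \<alpha> = ?r \<beta>"
      then obtain x y where x: "x \<in> P" "real_vec \<alpha> = real k *\<^sub>R x"
        and y: "y \<in> P" "real_vec \<beta> = real k *\<^sub>R y"
        by (auto simp: lattice_points_def dilate_def)
      have "Poly_Mapping.lookup (x - y) l = 0" if "l \<in> S" for l
      proof -
        have "Poly_Mapping.lookup \<alpha> l = Poly_Mapping.lookup \<beta> l"
          using eq that by (metis restrict_apply')
        then have "Poly_Mapping.lookup (real_vec \<alpha>) l = Poly_Mapping.lookup (real_vec \<beta>) l" by simp
        then show ?thesis using k unfolding x(2) y(2) by (simp add: lookup_minus)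
      qed
      moreover have "x - y \<in> ?V" using x(1) y(1) by blast
      ultimately have "x - y = 0" by (rule S(3)[rotated])
      then have "real_vec \<alpha> = real_vec \<beta>" using x(2) y(2) by simp
      then show "\<alpha> = \<beta>" by (metis lookup_real_vec of_int_eq_iff poly_mapping_eqI)
    qed
    have img: "?r ` ?L \<subseteq> S \<rightarrow>\<^sub>E ?I"
    proof clarify
      fix \<alpha> assume "\<alpha> \<in> ?L"
      then obtain x where x: "x \<in> P" "real_vec \<alpha> = real k *\<^sub>R x"
        by (auto simp: lattice_points_def dilate_def)
      have "Poly_Mapping.lookup \<alpha> l \<in> ?I" for l
      proof -
        have "\<bar>of_int (Poly_Mapping.lookup \<alpha> l)\<bar> = \<bar>real k * Poly_Mapping.lookup x l\<bar>"
          using arg_cong[OF x(2), of "\<lambda>y. Poly_Mapping.lookup y l"] by simp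
        also have "\<dots> \<le> real k * real C"
          using C[OF x(1), of l] by (simp add: abs_mult mult_left_mono)
        finally have "\<bar>Poly_Mapping.lookup \<alpha> l\<bar> \<le> int (k * C)"
          by (metis of_int_abs of_int_le_iff of_int_of_nat_eq of_nat_mult)
        then show ?thesis by auto
      qed
      then show "?r \<alpha> \<in> S \<rightarrow>\<^sub>E ?I" by auto
    qed
    have "card ?L = card (?r ` ?L)" using card_image[OF inj] by simp
    also have "\<dots> \<le> card (S \<rightarrow>\<^sub>E ?I)" using img S(1) by (intro card_mono finite_PiE) auto
    also have "\<dots> = (2 * (k * C) + 1) ^ card S"
      using S(1) by (simp add: card_PiE nat_add_distrib nat_mult_distrib mult.commute)
    also have "\<dots> \<le> (2 * (k * C) + 1) ^ d" using S(2) by (intro power_increasing) auto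
    also have "\<dots> \<le> ((2 * C + 1) * k) ^ d" using k by (intro power_mono) (auto simp: algebra_simps)
    finally show ?thesis by (simp only: power_mult_distrib)
  qed
  then show thesis using that by blast
qed

text \<open>If the degree exceeded d, the leading term would win at large k: all lower terms and the
  bound itself are at most constants times k^(degree - 1).\<close>

lemma poly_bounded_degree:
  fixes p :: "rat poly"
  assumes "\<And>k :: nat. k \<ge> 1 \<Longrightarrow> \<bar>poly p (of_nat k)\<bar> \<le> C * of_nat k ^ d"
  shows "degree p \<le> d"
proof (rule ccontr)
  assume "\<not> degree p \<le> d"
  then have deg: "degree p > d" by simp
  let ?e = "degree p" and ?c = "\<bar>lead_coeff p\<bar>"
  let ?A = "\<Sum>i<?e. \<bar>coeff p i\<bar>"
  have c: "?c > 0" using deg by auto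
  \<comment> \<open>For such an argument k, the leading coefficient times k exceeds |C| plus the sum
    of the other coefficients, all in absolute value.\<close>
  obtain k0 :: nat where k0: "(\<bar>C\<bar> + ?A) / ?c < of_nat k0" using reals_Archimedean2 by blast
  define k where "k = Suc k0"
  have k: "k \<ge> 1" "(\<bar>C\<bar> + ?A) / ?c < of_nat k" using k0 by (auto simp: k_def)
  let ?k = "of_nat k :: rat"
  have k1: "?k \<ge> 1" using k(1) by simp
  have split: "poly p ?k = lead_coeff p * ?k ^ ?e + (\<Sum>i<?e. coeff p i * ?k ^ i)"
    by (simp add: poly_altdef lessThan_Suc_atMost[symmetric])
  have "?c * ?k ^ ?e = \<bar>lead_coeff p * ?k ^ ?e\<bar>" by (simp add: abs_mult)
  also have "\<dots> \<le> \<bar>poly p ?k\<bar> + \<bar>\<Sum>i<?e. coeff p i * ?k ^ i\<bar>" unfolding split by linarith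
  also have "\<dots> \<le> C * ?k ^ d + (\<Sum>i<?e. \<bar>coeff p i * ?k ^ i\<bar>)"
    using assms[OF k(1)] by (intro add_mono sum_abs) auto
  also have "\<dots> \<le> \<bar>C\<bar> * ?k ^ (?e - 1) + (\<Sum>i<?e. \<bar>coeff p i\<bar> * ?k ^ (?e - 1))"
  proof (intro add_mono sum_mono)
    have "C * ?k ^ d \<le> \<bar>C\<bar> * ?k ^ d" by (intro mult_right_mono) auto
    also have "\<dots> \<le> \<bar>C\<bar> * ?k ^ (?e - 1)"
      using deg k1 by (intro mult_left_mono power_increasing) auto
    finally show "C * ?k ^ d \<le> \<bar>C\<bar> * ?k ^ (?e - 1)" .
    show "\<bar>coeff p i * ?k ^ i\<bar> \<le> \<bar>coeff p i\<bar> * ?k ^ (?e - 1)" if "i \<in> {..<?e}" for i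
      using that k1 by (auto simp: abs_mult intro!: mult_left_mono power_increasing)
  qed
  also have "\<dots> = (\<bar>C\<bar> + ?A) * ?k ^ (?e - 1)" by (simp add: sum_distrib_right distrib_right)
  also have "\<dots> < (?c * ?k) * ?k ^ (?e - 1)"
    using k(2) c k1 by (intro mult_strict_right_mono) (auto simp: field_simps)
  also have "\<dots> = ?c * ?k ^ ?e" using deg by (cases ?e) auto
  finally show False by simp
qed

section \<open>The program\<close>

text \<open>\<open>pw\<close> runs through the entries \<Phi> X^l of \<lambda>, which are recomputed
  instead of stored. \<open>pos\<close> is left behind the vector, so that consecutive calls consume
  consecutive vectors.\<close>

definition dot_com :: "string \<Rightarrow> com" where
  "dot_com x = (x ::= Const 0 ;; ''pw'' ::= Var ''Phi'' ;;
     For ''l'' (Var ''n'')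
       (x ::= Op Add (Var x) (Op Mul (Cell ''G'' (Var ''pos'')) (Var ''pw'')) ;;
        ''pos'' ::= Op Add (Var ''pos'') (Const 1) ;;
        ''pw'' ::= Op Mul (Var ''pw'') (Var ''X'')))"

text \<open>The next coefficient of an in-place division by T_b, with b in \<open>be\<close>. In
  round \<open>h\<close>, \<open>u\<close> becomes b^(h+1) and \<open>e\<close> becomes (h+2)!, so
  their quotient is the coefficient of T_b of index h + 1.\<close>

definition div_step_com :: com where
  "div_step_com = (''y'' ::= Cell ''R'' (Op Add (Var ''k'') (Const 1)) ;;
     ''u'' ::= Const 1 ;; ''e'' ::= Const 1 ;;
     For ''h'' (Op Add (Var ''k'') (Const 1))
       (''u'' ::= Op Mul (Var ''u'') (Var ''be'') ;;
        ''e'' ::= Op Mul (Var ''e'') (Op Add (Var ''h'') (Const 2)) ;;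
        ''y'' ::= Op Sub (Var ''y'')
          (Op Mul (Op Quo (Var ''u'') (Var ''e'')) (Cell ''R'' (Op Sub (Var ''k'') (Var ''h''))))) ;;
     Assign ''R'' (Op Add (Var ''k'') (Const 1)) (Var ''y''))"

definition div_com :: com where
  "div_com = For ''k'' (Var ''s'') div_step_com"

text \<open>Division of the series \<open>r\<close> by T_b, whose constant term is 1, through the
  usual recurrence. The integer quotients are exact once enough factorials divide
  \<open>b\<close>.\<close>

fun div_series :: "int \<Rightarrow> (nat \<Rightarrow> int) \<Rightarrow> nat \<Rightarrow> int" where
  "div_series b r 0 = r 0"
| "div_series b r (Suc k) =
     r (Suc k) - (\<Sum>i<Suc k. (b ^ Suc i div fact (Suc (Suc i))) * div_series b r (k - i))"

text \<open>The content of \<open>y\<close> after \<open>h\<close> rounds of the inner loop; it is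
  stored, so it needs a size bound of its own.\<close>

definition div_partial :: "int \<Rightarrow> (nat \<Rightarrow> int) \<Rightarrow> nat \<Rightarrow> nat \<Rightarrow> int" where
  "div_partial b r k h =
     r (Suc k) - (\<Sum>i<h. (b ^ Suc i div fact (Suc (Suc i))) * div_series b r (k - i))"

definition series_com :: com where
  "series_com = (For ''k'' (Op Add (Var ''s'') (Const 1)) (Assign ''R'' (Var ''k'') (Const 0)) ;;
     Assign ''R'' (Const 0) (Const 1) ;; ''den'' ::= Const 1 ;;
     For ''j'' (Var ''s'')
       (dot_com ''be'' ;; ''den'' ::= Op Mul (Var ''den'') (Op Sub (Const 0) (Var ''be'')) ;; div_com))"

text \<open>The integer counterpart of \<open>todd_inverse\<close>: the series 1, divided by T_b for
  each b in turn.\<close>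

definition inv_series :: "int list \<Rightarrow> nat \<Rightarrow> int" where
  "inv_series bs = foldl (\<lambda>r b. div_series b r) (\<lambda>k. if k = 0 then 1 else 0) bs"

definition neg_prod :: "int list \<Rightarrow> int" where
  "neg_prod bs = (\<Prod>b\<leftarrow>bs. - b)"

text \<open>Fractions are added without cancellation. An addition lengthens numerator and
  denominator by little more than the size of the new fraction, so sizes stay under control without
  a gcd.\<close>

primrec add_fracs :: "(nat \<Rightarrow> int) \<Rightarrow> (nat \<Rightarrow> int) \<Rightarrow> int \<times> int \<Rightarrow> nat \<Rightarrow> int \<times> int" where
  "add_fracs N D st 0 = st"
| "add_fracs N D st (Suc l) = (let (p, q) = add_fracs N D st l in (p * D l + q * N l, q * D l))"

text \<open>With d = l! times \<open>den\<close>, the weight R[s-l] / d is written as R[s-l] d /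
  d^2, since \<open>den\<close> may be negative and output denominators must be positive.\<close>

definition emit_com :: com where
  "emit_com = (''lf'' ::= Const 1 ;; ''ap'' ::= Const 1 ;;
     For ''o'' (Op Add (Var ''s'') (Const 1))
       (''d'' ::= Op Mul (Var ''lf'') (Var ''den'') ;;
        Write (Op Mul (Cell ''R'' (Op Sub (Var ''s'') (Var ''o''))) (Var ''d'')) ;;
        Write (Op Mul (Var ''d'') (Var ''d'')) ;;
        ''RP'' ::= Op Add (Op Mul (Var ''RP'') (Op Mul (Var ''q'') (Var ''d'')))
          (Op Mul (Var ''RQ'') (Op Mul (Op Mul (Var ''p'') (Cell ''R'' (Op Sub (Var ''s'') (Var ''o'')))) (Var ''ap''))) ;;
        ''RQ'' ::= Op Mul (Var ''RQ'') (Op Mul (Var ''q'') (Var ''d'')) ;;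
        ''lf'' ::= Op Mul (Var ''lf'') (Op Add (Var ''o'') (Const 1)) ;;
        ''ap'' ::= Op Mul (Var ''ap'') (Var ''al'')))"

section \<open>Verification of the parts of the program\<close>

locale resources =
  fixes K B :: nat
  assumes K_pos: "1 \<le> K" and small_nat: "\<And>k. k \<le> K \<Longrightarrow> bit_size (int k) \<le> B"
begin

lemma small_0 [simp]: "bit_size 0 \<le> B"
  using small_nat[of 0] by simp

lemma small_1 [simp]: "bit_size 1 \<le> B"
  using small_nat[of 1] K_pos by simp

text \<open>\<open>Q\<close> is assumed for every memory that agrees with \<open>m\<close> outside
  the listed arrays; the rules for the other parts of a summand share this frame form, so they
  compose. The restriction on \<open>x\<close> keeps it distinct from the scratch arrays.\<close>

lemma wp_dot:
  assumes x: "x = ''al'' \<or> x = ''be''"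
    and m: "m ''n'' 0 = int n" "m ''pos'' 0 = int p" "m ''Phi'' 0 = \<Phi>" "m ''X'' 0 = X"
      "\<And>l. l < n \<Longrightarrow> m ''G'' (int p + int l) = g l"
    and bounds: "p + n \<le> K" "\<And>l. l \<le> n \<Longrightarrow> bit_size (\<Phi> * X ^ l) \<le> B"
      "\<And>l. l \<le> n \<Longrightarrow> bit_size (\<Sum>j<l. g j * (\<Phi> * X ^ j)) \<le> B"
    and Q: "\<And>m'. (\<And>y. y \<notin> {x, ''pw'', ''pos'', ''l''} \<Longrightarrow> m' y = m y) \<Longrightarrow>
      m' x 0 = (\<Sum>j<n. g j * (\<Phi> * X ^ j)) \<Longrightarrow> m' ''pos'' 0 = int (p + n) \<Longrightarrow> Q (m', inp, out)"
  shows "wp K B (dot_com x) Q (m, inp, out)"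
proof -
  let ?I = "\<lambda>k (m', inp', out'). (\<forall>y. y \<notin> {x, ''pw'', ''pos'', ''l''} \<longrightarrow> m' y = m y) \<and>
    m' x 0 = (\<Sum>j<k. g j * (\<Phi> * X ^ j)) \<and> m' ''pos'' 0 = int (p + k) \<and> m' ''pw'' 0 = \<Phi> * X ^ k \<and>
    inp' = inp \<and> out' = out"
  have "bit_size \<Phi> \<le> B" using bounds(2)[of 0] by simp
  moreover have "wp K B (For ''l'' (Var ''n'')
       (x ::= Op Add (Var x) (Op Mul (Cell ''G'' (Var ''pos'')) (Var ''pw'')) ;;
        ''pos'' ::= Op Add (Var ''pos'') (Const 1) ;;
        ''pw'' ::= Op Mul (Var ''pw'') (Var ''X''))) Q
     (m(x := (m x)(0 := 0), ''pw'' := (m ''pw'')(0 := \<Phi>)), inp, out)"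
  proof (rule wp_For[where I = ?I and N = n])
    fix k m' inp' out'
    assume k: "k < n" "m' ''l'' 0 = int k" and I: "?I k (m', inp', out')"
    have "bit_size (int (p + k) + 1) \<le> B"
      using small_nat[of "Suc (p + k)"] bounds(1) k by (simp add: ac_simps)
    moreover have "bit_size (\<Phi> * X ^ k * X) \<le> B"
      using bounds(2)[of "Suc k"] k by (simp add: ac_simps)
    moreover have "bit_size ((\<Sum>j<k. g j * (\<Phi> * X ^ j)) + g k * (\<Phi> * X ^ k)) \<le> B"
      using bounds(3)[of "Suc k"] k by simp
    ultimately show "wp K B (x ::= Op Add (Var x) (Op Mul (Cell ''G'' (Var ''pos'')) (Var ''pw'')) ;;
        ''pos'' ::= Op Add (Var ''pos'') (Const 1) ;;
        ''pw'' ::= Op Mul (Var ''pw'') (Var ''X''))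
       (\<lambda>(m', inp', out'). m' ''l'' 0 = int k \<and>
          ?I (Suc k) (m'(''l'' := (m' ''l'')(0 := int k + 1)), inp', out')) (m', inp', out')"
      using I k m x by (elim disjE; simp add: ac_simps)
  qed (use x m Q bounds small_nat in \<open>auto\<close>)
  ultimately show ?thesis using x m by (elim disjE) (simp_all add: dot_com_def)
qed

lemma wp_div_step:
  assumes m: "m ''k'' 0 = int k" "m ''be'' 0 = b"
      "\<And>i. i \<le> k \<Longrightarrow> m ''R'' (int i) = div_series b r i" "m ''R'' (int k + 1) = r (Suc k)"
    and bounds: "Suc k \<le> K" "\<And>h. h \<le> Suc k \<Longrightarrow> bit_size (b ^ h) \<le> B"
      "\<And>h. h \<le> Suc k \<Longrightarrow> bit_size (fact (Suc h)) \<le> B"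
      "\<And>h. h \<le> Suc k \<Longrightarrow> bit_size (div_partial b r k h) \<le> B"
    and Q: "\<And>m'. (\<And>y. y \<notin> {''y'', ''u'', ''e'', ''h'', ''R''} \<Longrightarrow> m' y = m y) \<Longrightarrow>
      m' ''R'' = (m ''R'')(int k + 1 := div_series b r (Suc k)) \<Longrightarrow> Q (m', inp, out)"
  shows "wp K B div_step_com Q (m, inp, out)"
proof -
  let ?I = "\<lambda>h (m', inp', out'). (\<forall>y. y \<notin> {''y'', ''u'', ''e'', ''h''} \<longrightarrow> m' y = m y) \<and>
    m' ''y'' 0 = div_partial b r k h \<and> m' ''u'' 0 = b ^ h \<and> m' ''e'' 0 = fact (Suc h) \<and>
    inp' = inp \<and> out' = out"
  let ?c = "''u'' ::= Op Mul (Var ''u'') (Var ''be'') ;;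
        ''e'' ::= Op Mul (Var ''e'') (Op Add (Var ''h'') (Const 2)) ;;
        ''y'' ::= Op Sub (Var ''y'')
          (Op Mul (Op Quo (Var ''u'') (Var ''e'')) (Cell ''R'' (Op Sub (Var ''k'') (Var ''h''))))"
  have last: "div_partial b r k (Suc k) = div_series b r (Suc k)"
    by (simp add: div_partial_def)
  have step: "div_partial b r k (Suc h) = div_partial b r k h -
      (b * b ^ h div (fact (Suc h) * (int h + 2))) * div_series b r (k - h)" for h
    by (simp add: div_partial_def algebra_simps)
  have "wp K B (For ''h'' (Op Add (Var ''k'') (Const 1)) ?c)
      (wp K B (Assign ''R'' (Op Add (Var ''k'') (Const 1)) (Var ''y'')) Q)
      (m(''y'' := (m ''y'')(0 := r (Suc k)), ''u'' := (m ''u'')(0 := 1), ''e'' := (m ''e'')(0 := 1)),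
       inp, out)"
  proof (rule wp_For[where I = ?I and N = "Suc k"])
    fix h m' inp' out'
    assume h: "h < Suc k" "m' ''h'' 0 = int h" and I: "?I h (m', inp', out')"
    have "m ''R'' (int k - int h) = div_series b r (k - h)"
      using m(3)[of "k - h"] h by (simp add: of_nat_diff)
    moreover have "bit_size (b * b ^ h) \<le> B" using bounds(2)[of "Suc h"] h by simp
    moreover have "bit_size (fact (Suc h) * (int h + 2)) \<le> B"
      using bounds(3)[of "Suc h"] h by (simp add: algebra_simps)
    moreover have "bit_size (div_partial b r k (Suc h)) \<le> B" using bounds(4)[of "Suc h"] h by simp
    moreover have "fact (Suc (Suc h)) = fact (Suc h) * (int h + 2)" by (simp add: algebra_simps)
    ultimately show "wp K B ?c (\<lambda>(m', inp', out'). m' ''h'' 0 = int h \<and>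
          ?I (Suc h) (m'(''h'' := (m' ''h'')(0 := int h + 1)), inp', out')) (m', inp', out')"
      using I h m by (simp add: step mult.commute del: fact_Suc)
  next
    fix m' inp' out'
    assume "?I (Suc k) (m', inp', out')"
    then show "wp K B (Assign ''R'' (Op Add (Var ''k'') (Const 1)) (Var ''y'')) Q (m', inp', out')"
      using bounds(4)[of "Suc k"] m(1) by (simp add: last, intro Q) auto
  qed (use m small_nat bounds(1) in \<open>auto simp: div_partial_def\<close>)
  moreover have "bit_size (r (Suc k)) \<le> B" using bounds(4)[of 0] by (simp add: div_partial_def)
  ultimately show ?thesis using m by (simp add: div_step_com_def)
qed

text \<open>The division overwrites its dividend: after \<open>k\<close> rounds the entries up to
  index \<open>k\<close> belong to the quotient and the later ones still to \<open>r\<close>, which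
  is just what the next coefficient depends on.\<close>

lemma wp_div:
  assumes m: "m ''s'' 0 = int s" "m ''be'' 0 = b" "\<And>i. i \<le> s \<Longrightarrow> m ''R'' (int i) = r i"
    and bounds: "s \<le> K" "\<And>h. h \<le> s \<Longrightarrow> bit_size (b ^ h) \<le> B"
      "\<And>h. h \<le> s \<Longrightarrow> bit_size (fact (Suc h)) \<le> B"
      "\<And>k h. k < s \<Longrightarrow> h \<le> Suc k \<Longrightarrow> bit_size (div_partial b r k h) \<le> B"
    and Q: "\<And>m'. (\<And>y. y \<notin> {''k'', ''y'', ''u'', ''e'', ''h'', ''R''} \<Longrightarrow> m' y = m y) \<Longrightarrow>
      (\<And>i. i \<le> s \<Longrightarrow> m' ''R'' (int i) = div_series b r i) \<Longrightarrow> Q (m', inp, out)"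
  shows "wp K B div_com Q (m, inp, out)"
  unfolding div_com_def
proof (rule wp_For[where N = s and I = "\<lambda>k (m', inp', out').
    (\<forall>y. y \<notin> {''k'', ''y'', ''u'', ''e'', ''h'', ''R''} \<longrightarrow> m' y = m y) \<and>
    (\<forall>i\<le>s. m' ''R'' (int i) = (if i \<le> k then div_series b r i else r i)) \<and>
    inp' = inp \<and> out' = out"], goal_cases)
  case (2 k m' inp' out')
  then have R: "\<And>i. i \<le> s \<Longrightarrow> m' ''R'' (int i) = (if i \<le> k then div_series b r i else r i)"
    and frame: "\<And>y. y \<notin> {''k'', ''y'', ''u'', ''e'', ''h'', ''R''} \<Longrightarrow> m' y = m y"
    and io: "inp' = inp" "out' = out" by simp_all
  show ?case
  proof (rule wp_div_step[where k = k and b = b and r = r])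
    show "m' ''R'' (int k + 1) = r (Suc k)"
      using R[of "Suc k"] 2(1) by (simp add: ac_simps)
    show "m' ''R'' (int i) = div_series b r i" if "i \<le> k" for i
      using R[of i] that 2(1) by simp
    fix m''
    assume frame': "\<And>y. y \<notin> {''y'', ''u'', ''e'', ''h'', ''R''} \<Longrightarrow> m'' y = m' y"
      and R': "m'' ''R'' = (m' ''R'')(int k + 1 := div_series b r (Suc k))"
    have "m'' ''R'' (int i) = (if i \<le> Suc k then div_series b r i else r i)" if "i \<le> s" for i
      unfolding R' using R[OF that] by (cases "i = Suc k") (auto simp del: div_series.simps)
    then show "case (m'', inp', out') of (m', inp', out') \<Rightarrow> m' ''k'' 0 = int k \<and>
      (case (m'(''k'' := (m' ''k'')(0 := int k + 1)), inp', out') of (m', inp', out') \<Rightarrow>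
        (\<forall>y. y \<notin> {''k'', ''y'', ''u'', ''e'', ''h'', ''R''} \<longrightarrow> m' y = m y) \<and>
        (\<forall>i\<le>s. m' ''R'' (int i) = (if i \<le> Suc k then div_series b r i else r i)) \<and>
        inp' = inp \<and> out' = out)"
      using frame frame' io 2(2) by (simp del: div_series.simps)
  qed (use frame 2(1,2) m bounds in auto)
qed (use m bounds small_nat Q in auto)

text \<open>\<open>R\<close> starts as the series 1 and after \<open>j\<close> rounds is
  \<open>inv_series (take j bs)\<close>. A coefficient of a quotient involves no coefficients of
  higher index, so truncation at \<open>length bs\<close> is harmless.\<close>

lemma wp_series:
  assumes m: "m ''n'' 0 = int n" "m ''pos'' 0 = int p" "m ''Phi'' 0 = \<Phi>" "m ''X'' 0 = X"
      "m ''s'' 0 = int (length bs)"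
      "\<And>j l. j < length bs \<Longrightarrow> l < n \<Longrightarrow> m ''G'' (int (p + j * n + l)) = g j l"
    and bs: "\<And>j. j < length bs \<Longrightarrow> bs ! j = (\<Sum>l<n. g j l * (\<Phi> * X ^ l))"
    and bounds: "Suc (length bs) \<le> K" "p + length bs * n \<le> K"
      "\<And>l. l \<le> n \<Longrightarrow> bit_size (\<Phi> * X ^ l) \<le> B"
      "\<And>j l. j < length bs \<Longrightarrow> l \<le> n \<Longrightarrow> bit_size (\<Sum>i<l. g j i * (\<Phi> * X ^ i)) \<le> B"
      "\<And>j. j \<le> length bs \<Longrightarrow> bit_size (neg_prod (take j bs)) \<le> B"
      "\<And>j h. j < length bs \<Longrightarrow> h \<le> length bs \<Longrightarrow> bit_size (bs ! j ^ h) \<le> B"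
      "\<And>h. h \<le> length bs \<Longrightarrow> bit_size (fact (Suc h)) \<le> B"
      "\<And>j k h. j < length bs \<Longrightarrow> k < length bs \<Longrightarrow> h \<le> Suc k \<Longrightarrow>
         bit_size (div_partial (bs ! j) (inv_series (take j bs)) k h) \<le> B"
    and Q: "\<And>m'. (\<And>y. y \<notin> {''be'', ''pw'', ''pos'', ''l'', ''den'', ''j'', ''k'', ''y'', ''u'', ''e'', ''h'', ''R''} \<Longrightarrow> m' y = m y) \<Longrightarrow>
      (\<And>i. i \<le> length bs \<Longrightarrow> m' ''R'' (int i) = inv_series bs i) \<Longrightarrow>
      m' ''den'' 0 = neg_prod bs \<Longrightarrow> m' ''pos'' 0 = int (p + length bs * n) \<Longrightarrow> Q (m', inp, out)"
  shows "wp K B series_com Q (m, inp, out)"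
proof -
  let ?s = "length bs"
  let ?W = "{''be'', ''pw'', ''pos'', ''l'', ''den'', ''j'', ''k'', ''y'', ''u'', ''e'', ''h'', ''R''}"
  let ?I = "\<lambda>j (m', inp', out'). (\<forall>y. y \<notin> ?W \<longrightarrow> m' y = m y) \<and>
    (\<forall>i\<le>?s. m' ''R'' (int i) = inv_series (take j bs) i) \<and> m' ''den'' 0 = neg_prod (take j bs) \<and>
    m' ''pos'' 0 = int (p + j * n) \<and> inp' = inp \<and> out' = out"
  let ?c = "dot_com ''be'' ;; ''den'' ::= Op Mul (Var ''den'') (Op Sub (Const 0) (Var ''be'')) ;; div_com"
  have loop: "wp K B (For ''j'' (Var ''s'') ?c) Q (m0, inp, out)"
    if m0: "\<And>y. y \<notin> {''k'', ''R'', ''den''} \<Longrightarrow> m0 y = m y" "m0 ''den'' 0 = 1"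
      "\<And>i. i \<le> ?s \<Longrightarrow> m0 ''R'' (int i) = (if i = 0 then 1 else 0)" for m0
  proof (rule wp_For[where I = ?I and N = ?s])
    show "?I 0 (m0(''j'' := (m0 ''j'')(0 := 0)), inp, out)"
      using m0 m by (simp add: inv_series_def neg_prod_def)
  next
    fix j m' inp' out'
    assume j: "j < ?s" "m' ''j'' 0 = int j" and I: "?I j (m', inp', out')"
    have R: "\<And>i. i \<le> ?s \<Longrightarrow> m' ''R'' (int i) = inv_series (take j bs) i"
      and frame: "\<And>y. y \<notin> ?W \<Longrightarrow> m' y = m y"
      and io: "inp' = inp" "out' = out" "m' ''den'' 0 = neg_prod (take j bs)"
        "m' ''pos'' 0 = int (p + j * n)" using I by simp_all
    have "(j + 1) * n \<le> ?s * n" using j by (intro mult_right_mono) auto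
    then have jn: "p + j * n + n \<le> K" using bounds(2) by simp
    have tk: "take (Suc j) bs = take j bs @ [bs ! j]" using j by (simp add: take_Suc_conv_app_nth)
    have np: "neg_prod (take (Suc j) bs) = neg_prod (take j bs) * - (bs ! j)"
      unfolding tk by (simp add: neg_prod_def)
    have iser: "inv_series (take (Suc j) bs) = div_series (bs ! j) (inv_series (take j bs))"
      unfolding tk by (simp add: inv_series_def)
    have "wp K B (dot_com ''be'') (wp K B (''den'' ::= Op Mul (Var ''den'') (Op Sub (Const 0) (Var ''be'')) ;; div_com)
      (\<lambda>(m', inp', out'). m' ''j'' 0 = int j \<and>
          ?I (Suc j) (m'(''j'' := (m' ''j'')(0 := int j + 1)), inp', out'))) (m', inp', out')"
    proof (rule wp_dot[where n = n and p = "p + j * n" and \<Phi> = \<Phi> and X = X and g = "g j"])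
      show "m' ''G'' (int (p + j * n) + int l) = g j l" if "l < n" for l
        using m(6)[OF j(1) that] frame[of "''G''"] by simp
      fix m1
      assume frame1: "\<And>y. y \<notin> {''be'', ''pw'', ''pos'', ''l''} \<Longrightarrow> m1 y = m' y"
        and be: "m1 ''be'' 0 = (\<Sum>l<n. g j l * (\<Phi> * X ^ l))" and pos: "m1 ''pos'' 0 = int (p + j * n + n)"
      have be: "m1 ''be'' 0 = bs ! j" using be bs[OF j(1)] by simp
      have "wp K B div_com (\<lambda>(m', inp', out'). m' ''j'' 0 = int j \<and>
          ?I (Suc j) (m'(''j'' := (m' ''j'')(0 := int j + 1)), inp', out'))
          (m1(''den'' := (m1 ''den'')(0 := neg_prod (take (Suc j) bs))), inp', out')"
      proof (rule wp_div[where s = ?s and b = "bs ! j" and r = "inv_series (take j bs)"])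
        fix m2
        assume frame2: "\<And>y. y \<notin> {''k'', ''y'', ''u'', ''e'', ''h'', ''R''} \<Longrightarrow>
            m2 y = (m1(''den'' := (m1 ''den'')(0 := neg_prod (take (Suc j) bs)))) y"
          and R2: "\<And>i. i \<le> ?s \<Longrightarrow> m2 ''R'' (int i) = div_series (bs ! j) (inv_series (take j bs)) i"
        show "case (m2, inp', out') of (m', inp', out') \<Rightarrow> m' ''j'' 0 = int j \<and>
          ?I (Suc j) (m'(''j'' := (m' ''j'')(0 := int j + 1)), inp', out')"
          using frame frame1 frame2 R2 io pos j(2) by (simp add: iser ac_simps)
      qed (use be frame1 frame R m(5) bounds j(1) in simp_all)
      then show "wp K B (''den'' ::= Op Mul (Var ''den'') (Op Sub (Const 0) (Var ''be'')) ;; div_com)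
      (\<lambda>(m', inp', out'). m' ''j'' 0 = int j \<and>
          ?I (Suc j) (m'(''j'' := (m' ''j'')(0 := int j + 1)), inp', out')) (m1, inp', out')"
        using bounds(5)[of "Suc j"] j(1) be frame1 io by (simp add: np)
    qed (use m frame io jn bounds j(1) in simp_all)
    then show "wp K B ?c (\<lambda>(m', inp', out'). m' ''j'' 0 = int j \<and>
          ?I (Suc j) (m'(''j'' := (m' ''j'')(0 := int j + 1)), inp', out')) (m', inp', out')"
      by simp
  qed (use m Q bounds(1) small_nat in \<open>auto\<close>)
  show ?thesis unfolding series_com_def wp.simps(5)
  proof (rule wp_For[where N = "Suc ?s" and I = "\<lambda>k (m', inp', out').
      (\<forall>y. y \<notin> {''k'', ''R''} \<longrightarrow> m' y = m y) \<and> (\<forall>i<k. m' ''R'' (int i) = 0) \<and> inp' = inp \<and> out' = out"],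
      goal_cases)
    case (4 m' inp' out')
    then have "wp K B (For ''j'' (Var ''s'') ?c) Q (m'(''R'' := (m' ''R'')(0 := 1),
        ''den'' := (m' ''den'')(0 := 1)), inp, out)"
      by (intro loop) simp_all
    then show ?case using 4 by simp
  qed (use m bounds(1) small_nat in \<open>auto simp: less_Suc_eq\<close>)
qed

text \<open>One pass writes the weights and adds the terms p/q times weight times a^l to the running
  fraction. \<open>N\<close> and \<open>D\<close> enter through equations so that the named
  functions of a concrete summand can take their place.\<close>

lemma wp_emit:
  assumes m: "m ''s'' 0 = int s" "m ''den'' 0 = \<delta>" "m ''al'' 0 = a" "m ''p'' 0 = p" "m ''q'' 0 = q"
      "\<And>i. i \<le> s \<Longrightarrow> m ''R'' (int i) = r i" "m ''RP'' 0 = fst st" "m ''RQ'' 0 = snd st"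
    and N: "\<And>l. N l = p * r (s - l) * a ^ l" and D: "\<And>l. D l = q * (fact l * \<delta>)"
    and bounds: "Suc s \<le> K" "\<And>l. l \<le> Suc s \<Longrightarrow> bit_size (fact l) \<le> B"
      "\<And>l. l \<le> Suc s \<Longrightarrow> bit_size (a ^ l) \<le> B"
      "\<And>l. l \<le> s \<Longrightarrow> bit_size (fact l * \<delta>) \<le> B"
      "\<And>l. l \<le> Suc s \<Longrightarrow> bit_size (fst (add_fracs N D st l)) \<le> B"
      "\<And>l. l \<le> Suc s \<Longrightarrow> bit_size (snd (add_fracs N D st l)) \<le> B"
    and Q: "\<And>m'. (\<And>y. y \<notin> {''lf'', ''ap'', ''o'', ''d'', ''RP'', ''RQ''} \<Longrightarrow> m' y = m y) \<Longrightarrow>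
      m' ''RP'' 0 = fst (add_fracs N D st (Suc s)) \<Longrightarrow> m' ''RQ'' 0 = snd (add_fracs N D st (Suc s)) \<Longrightarrow>
      Q (m', inp, out @ concat (map (\<lambda>l. [r (s - l) * (fact l * \<delta>), (fact l * \<delta>) * (fact l * \<delta>)]) [0..<Suc s]))"
  shows "wp K B emit_com Q (m, inp, out)"
proof -
  let ?W = "{''lf'', ''ap'', ''o'', ''d'', ''RP'', ''RQ''}"
  let ?O = "\<lambda>k. concat (map (\<lambda>l. [r (s - l) * (fact l * \<delta>), (fact l * \<delta>) * (fact l * \<delta>)]) [0..<k])"
  show ?thesis unfolding emit_com_def wp.simps(5)
  proof (simp, rule wp_For[where N = "Suc s" and I = "\<lambda>l (m', inp', out').
      (\<forall>y. y \<notin> ?W \<longrightarrow> m' y = m y) \<and> m' ''lf'' 0 = fact l \<and> m' ''ap'' 0 = a ^ l \<and>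
      m' ''RP'' 0 = fst (add_fracs N D st l) \<and> m' ''RQ'' 0 = snd (add_fracs N D st l) \<and>
      inp' = inp \<and> out' = out @ ?O l"], goal_cases)
    case (2 l m' inp' out')
    obtain P1 Q1 where st: "add_fracs N D st l = (P1, Q1)" by fastforce
    have R: "m ''R'' (int s - int l) = r (s - l)"
      using m(6)[of "s - l"] 2(1) by (simp add: of_nat_diff)
    have "bit_size (fact l * (int l + 1)) \<le> B" using bounds(2)[of "Suc l"] 2(1) by (simp add: algebra_simps)
    moreover have "bit_size (a ^ l * a) \<le> B" using bounds(3)[of "Suc l"] 2(1) by (simp add: ac_simps)
    moreover have "bit_size (fact l * \<delta>) \<le> B" using bounds(4)[of l] 2(1) by simp
    moreover have "bit_size (P1 * (q * (fact l * \<delta>)) + Q1 * (p * r (s - l) * a ^ l)) \<le> B"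
      using bounds(5)[of "Suc l"] 2(1) by (simp add: st N D)
    moreover have "bit_size (Q1 * (q * (fact l * \<delta>))) \<le> B"
      using bounds(6)[of "Suc l"] 2(1) by (simp add: st N D)
    ultimately show ?case
      using 2 m R by (simp add: st N D)
  qed (use m bounds(1) small_nat Q in \<open>auto\<close>)
qed

end

section \<open>Magnitudes of the computed integers\<close>

lemma div_sum_le:
  fixes G Z :: int
  assumes "0 \<le> G" "2 * G \<le> Z"
  shows "(\<Sum>i<Suc k. G ^ Suc i * Z ^ (k - i)) \<le> 2 * G * Z ^ k"
proof (induction k)
  case 0
  then show ?case using assms by simp
next
  case (Suc k)
  have Z: "0 \<le> Z" using assms by simp
  \<comment> \<open>A geometric sum of ratio G / Z, at most 1/2, treated without division: apart
    from its first term it is G times the previous sum.\<close>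
  have "(\<Sum>i<Suc (Suc k). G ^ Suc i * Z ^ (Suc k - i)) =
      G * Z ^ Suc k + (\<Sum>i<Suc k. G ^ Suc (Suc i) * Z ^ (k - i))"
    by (subst sum.lessThan_Suc_shift) simp
  also have "(\<Sum>i<Suc k. G ^ Suc (Suc i) * Z ^ (k - i)) = G * (\<Sum>i<Suc k. G ^ Suc i * Z ^ (k - i))"
    by (simp only: sum_distrib_left power_Suc mult.assoc)
  also have "G * Z ^ Suc k + \<dots> \<le> G * Z ^ Suc k + G * (2 * G * Z ^ k)"
    using Suc assms by (intro add_left_mono mult_left_mono) auto
  also have "\<dots> \<le> G * Z ^ Suc k + G * (Z * Z ^ k)"
    using assms Z by (intro add_left_mono mult_left_mono mult_right_mono) auto
  finally show ?case by simp
qed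

text \<open>One division raises the growth rate of the coefficients from H to Z = H + 2 G, since the
  recurrence gives at most H Z^k + 2 G Z^k. The quotients by factorials are simply bounded by their
  dividends.\<close>

lemma div_partial_bound:
  assumes "\<And>i. i \<le> s \<Longrightarrow> \<bar>r i\<bar> \<le> H ^ i" "0 \<le> H" "\<bar>b\<bar> \<le> G"
    and "\<And>i. i \<le> k \<Longrightarrow> \<bar>div_series b r i\<bar> \<le> (H + 2 * G) ^ i" "k < s" "h \<le> Suc k"
  shows "\<bar>div_partial b r k h\<bar> \<le> (H + 2 * G) ^ Suc k"
proof -
  let ?Z = "H + 2 * G"
  have G: "0 \<le> G" using assms(3) by simp
  have c: "\<bar>b ^ Suc i div fact (Suc (Suc i))\<bar> \<le> G ^ Suc i" for i
  proof -
    have "\<bar>b ^ Suc i div fact (Suc (Suc i))\<bar> \<le> \<bar>b ^ Suc i\<bar>" by (rule abs_div_le)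
    also have "\<dots> = \<bar>b\<bar> ^ Suc i" by (rule power_abs)
    also have "\<dots> \<le> G ^ Suc i" using assms(3) by (intro power_mono) auto
    finally show ?thesis .
  qed
  have "\<bar>\<Sum>i<h. (b ^ Suc i div fact (Suc (Suc i))) * div_series b r (k - i)\<bar> \<le>
      (\<Sum>i<h. \<bar>(b ^ Suc i div fact (Suc (Suc i))) * div_series b r (k - i)\<bar>)"
    by (rule sum_abs)
  also have "\<dots> \<le> (\<Sum>i<h. G ^ Suc i * ?Z ^ (k - i))"
    unfolding abs_mult using assms(4) G by (intro sum_mono mult_mono c) auto
  also have "\<dots> \<le> (\<Sum>i<Suc k. G ^ Suc i * ?Z ^ (k - i))"
    using assms(2,6) G by (intro sum_mono2) auto
  also have "\<dots> \<le> 2 * G * ?Z ^ k" using G assms(2) by (intro div_sum_le) auto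
  finally have "\<bar>div_partial b r k h\<bar> \<le> \<bar>r (Suc k)\<bar> + 2 * G * ?Z ^ k"
    unfolding div_partial_def by linarith
  also have "\<bar>r (Suc k)\<bar> \<le> H * H ^ k" using assms(1)[of "Suc k"] assms(5) by simp
  also have "H * H ^ k \<le> H * ?Z ^ k"
    using assms(2) G by (intro mult_left_mono power_mono) auto
  finally show ?thesis by (simp add: algebra_simps)
qed

lemma div_series_bound:
  assumes "\<And>i. i \<le> s \<Longrightarrow> \<bar>r i\<bar> \<le> H ^ i" "0 \<le> H" "\<bar>b\<bar> \<le> G" "k \<le> s"
  shows "\<bar>div_series b r k\<bar> \<le> (H + 2 * G) ^ k"
  using assms(4)
proof (induction k rule: less_induct)
  case (less k)
  show ?case
  proof (cases k)
    case 0
    then show ?thesis using assms(1)[of 0] by simp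
  next
    case (Suc j)
    have "div_series b r (Suc j) = div_partial b r j (Suc j)" by (simp add: div_partial_def)
    then show ?thesis
      using div_partial_bound[where k = j and h = "Suc j", OF assms(1-3)] less Suc by simp
  qed
qed

text \<open>Each division adds only 2 G to the growth rate, which is therefore linear in the number
  of factors.\<close>

lemma inv_series_bound:
  assumes "\<And>b. b \<in> set bs \<Longrightarrow> \<bar>b\<bar> \<le> G" "0 \<le> G"
  shows "\<bar>inv_series bs k\<bar> \<le> (1 + 2 * int (length bs) * G) ^ k"
  using assms(1)
proof (induction bs arbitrary: k rule: rev_induct)
  case Nil
  then show ?case by (simp add: inv_series_def)
next
  case (snoc b bs)
  have "\<bar>div_series b (inv_series bs) k\<bar> \<le> ((1 + 2 * int (length bs) * G) + 2 * G) ^ k"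
    using snoc assms(2) by (intro div_series_bound[where s = k]) auto
  then show ?case by (simp add: inv_series_def algebra_simps)
qed

lemma neg_prod_bound:
  "(\<And>b. b \<in> set bs \<Longrightarrow> \<bar>b\<bar> \<le> G) \<Longrightarrow> 0 \<le> G \<Longrightarrow> \<bar>neg_prod bs\<bar> \<le> G ^ length bs"
  by (induction bs) (auto simp: neg_prod_def abs_mult intro!: mult_mono)

text \<open>Each addition costs one factor 2 M. The exponent \<open>t\<close> records the additions
  made before, so that bounds chain from one summand to the next.\<close>

lemma add_fracs_bound:
  assumes "\<And>l. l < k \<Longrightarrow> \<bar>N l\<bar> \<le> M" "\<And>l. l < k \<Longrightarrow> \<bar>D l\<bar> \<le> M"
    and "\<bar>fst st\<bar> \<le> (2 * M) ^ t" "\<bar>snd st\<bar> \<le> (2 * M) ^ t" "0 \<le> M"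
  shows "\<bar>fst (add_fracs N D st k)\<bar> \<le> (2 * M) ^ (t + k)" "\<bar>snd (add_fracs N D st k)\<bar> \<le> (2 * M) ^ (t + k)"
proof -
  have "\<bar>fst (add_fracs N D st k)\<bar> \<le> (2 * M) ^ (t + k) \<and> \<bar>snd (add_fracs N D st k)\<bar> \<le> (2 * M) ^ (t + k)"
    using assms(1,2)
  proof (induction k)
    case 0
    then show ?case using assms by simp
  next
    case (Suc k)
    obtain p q where pq: "add_fracs N D st k = (p, q)" by fastforce
    have IH: "\<bar>p\<bar> \<le> (2 * M) ^ (t + k)" "\<bar>q\<bar> \<le> (2 * M) ^ (t + k)" using Suc pq by auto
    have "\<bar>p * D k\<bar> \<le> (2 * M) ^ (t + k) * M" "\<bar>q * N k\<bar> \<le> (2 * M) ^ (t + k) * M"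
      "\<bar>q * D k\<bar> \<le> (2 * M) ^ (t + k) * M"
      unfolding abs_mult using Suc.prems IH assms(5) by (auto intro!: mult_mono)
    moreover have "(2 * M) ^ (t + Suc k) = (2 * M) ^ (t + k) * M + (2 * M) ^ (t + k) * M" by simp
    moreover have "0 \<le> (2 * M) ^ (t + k) * M" using assms(5) by simp
    ultimately show ?case
      using abs_triangle_ineq[of "p * D k" "q * N k"]
      unfolding add_fracs.simps pq Let_def prod.case fst_conv snd_conv by linarith
  qed
  then show "\<bar>fst (add_fracs N D st k)\<bar> \<le> (2 * M) ^ (t + k)" "\<bar>snd (add_fracs N D st k)\<bar> \<le> (2 * M) ^ (t + k)"
    by auto
qed

section \<open>Layout of the input and the complete program\<close>

lemma nth_concat_uniform:
  assumes "\<And>v. v \<in> set vs \<Longrightarrow> length v = n" "j < length vs" "l < n"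
  shows "concat vs ! (j * n + l) = vs ! j ! l"
  using assms
proof (induction vs arbitrary: j)
  case (Cons v vs)
  then show ?case
    by (cases j) (auto simp: nth_append)
qed simp

lemma length_concat_uniform:
  "(\<And>v. v \<in> set vs \<Longrightarrow> length v = n) \<Longrightarrow> length (concat vs) = length vs * n"
  by (induction vs) auto

text \<open>A summand is kept as \<open>(p, q, vs)\<close>, where \<open>p / q\<close> is its coefficient and \<open>vs\<close> lists the
  numerator exponent followed by the denominator exponents.\<close>

type_synonym summand = "int \<times> int \<times> int list list"

text \<open>The subtraction discounts the numerator exponent: the tape announces the number of
  denominator exponents only.\<close>

definition enc_summand :: "summand \<Rightarrow> int list" where
  "enc_summand = (\<lambda>(p, q, vs). [p, q, int (length vs - 1)] @ concat vs)"

definition get_com :: com where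
  "get_com = (Read ''G'' (Var ''pos'') ;; ''pos'' ::= Op Add (Var ''pos'') (Const 1))"

text \<open>The unary dimension and the number of summands go into \<open>n\<close> and
  \<open>N\<close>, all the rest into \<open>G\<close>. After three entries of a summand the count s
  of its denominators is at \<open>pos - 1\<close>, and n (1 + s) entries follow.\<close>

definition read_com :: com where
  "read_com = (Read ''z'' (Const 0) ;;
     While (Var ''z'') (''n'' ::= Op Add (Var ''n'') (Const 1) ;; Read ''z'' (Const 0)) ;;
     Read ''N'' (Const 0) ;;
     For ''i'' (Var ''N'')
       (get_com ;; get_com ;; get_com ;;
        ''c'' ::= Op Mul (Var ''n'')
          (Op Add (Const 1) (Cell ''G'' (Op Sub (Var ''pos'') (Const 1)))) ;;
        For ''k'' (Var ''c'') get_com))"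

text \<open>One plus the sum of all squares is a base that exceeds every absolute value and is found
  without comparisons. The entries of \<lambda> are integers, written with denominator 1.\<close>

definition lambda_com :: com where
  "lambda_com = (''X'' ::= Const 1 ;; ''Phi'' ::= Const 1 ;;
     For ''k'' (Var ''pos'')
       (''X'' ::= Op Add (Var ''X'') (Op Mul (Cell ''G'' (Var ''k'')) (Cell ''G'' (Var ''k''))) ;;
        ''Phi'' ::= Op Mul (Var ''Phi'') (Op Add (Var ''k'') (Const 1))) ;;
     ''pw'' ::= Var ''Phi'' ;;
     For ''l'' (Var ''n'')
       (Write (Var ''pw'') ;; Write (Const 1) ;; ''pw'' ::= Op Mul (Var ''pw'') (Var ''X'')))"

definition summand_com :: com where
  "summand_com = (''p'' ::= Cell ''G'' (Var ''pos'') ;;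
     ''q'' ::= Cell ''G'' (Op Add (Var ''pos'') (Const 1)) ;;
     ''s'' ::= Cell ''G'' (Op Add (Var ''pos'') (Const 2)) ;;
     ''pos'' ::= Op Add (Var ''pos'') (Const 3) ;;
     dot_com ''al'' ;; series_com ;; emit_com)"

text \<open>Besides writing \<open>\<lambda>\<close> and the weights, the program accumulates their combination in (a) as the
  unreduced fraction \<open>RP / RQ\<close>, so that a variant without the \<^const>\<open>Write\<close> commands serves for (a).\<close>

definition weights_com :: com where
  "weights_com = (read_com ;; lambda_com ;;
     ''pos'' ::= Const 0 ;; ''RP'' ::= Const 0 ;; ''RQ'' ::= Const 1 ;;
     For ''i'' (Var ''N'') summand_com)"

text \<open>\<open>dim_0\<close> matters for the running time: vectors of length 0 take no room on
  the tape, so their number, written in binary, would otherwise not be bounded by the tape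
  size.\<close>

locale raw_instance =
  fixes n :: nat and ts :: "summand list"
  assumes vs_ne: "\<And>p q vs. (p, q, vs) \<in> set ts \<Longrightarrow> vs \<noteq> []"
    and vs_len: "\<And>p q vs v. (p, q, vs) \<in> set ts \<Longrightarrow> v \<in> set vs \<Longrightarrow> length v = n"
    and dim_0: "\<And>p q vs. (p, q, vs) \<in> set ts \<Longrightarrow> n = 0 \<Longrightarrow> length vs = 1"
begin

definition "gs = concat (map enc_summand ts)"
definition "tape = replicate n 1 @ [0, int (length ts)] @ gs"
definition "X = 1 + (\<Sum>k<length gs. gs ! k * gs ! k)"
definition \<Phi> :: int where "\<Phi> = fact (length gs)"
definition "ev v = (\<Sum>l<n. v ! l * (\<Phi> * X ^ l))"
definition "off i = length (concat (map enc_summand (take i ts)))"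

definition "alpha i = (case ts ! i of (p, q, vs) \<Rightarrow> ev (hd vs))"
definition "betas i = (case ts ! i of (p, q, vs) \<Rightarrow> map ev (tl vs))"
text \<open>\<open>numer i l / denom i l\<close> is to be the term of index \<open>l\<close> of
  summand \<open>i\<close>, coefficient included.\<close>

definition "numer i l = (case ts ! i of (p, q, vs) \<Rightarrow>
  p * inv_series (betas i) (length (betas i) - l) * alpha i ^ l)"
definition "denom i l = (case ts ! i of (p, q, vs) \<Rightarrow> q * (fact l * neg_prod (betas i)))"

primrec acc :: "nat \<Rightarrow> int \<times> int" where
  "acc 0 = (0, 1)"
| "acc (Suc i) = add_fracs (numer i) (denom i) (acc i) (Suc (length (betas i)))"

definition "lambda_out k = concat (map (\<lambda>l. [\<Phi> * X ^ l, 1]) [0..<k])"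
definition "weights_out i = concat (map (\<lambda>l.
  [inv_series (betas i) (length (betas i) - l) * (fact l * neg_prod (betas i)),
   (fact l * neg_prod (betas i)) * (fact l * neg_prod (betas i))]) [0..<Suc (length (betas i))])"

definition "K = tape_size tape + 2"
text \<open>The largest stored values are the running fractions: at most K additions of fractions
  with 14 K^3 bits stay within 15 K^4 bits.\<close>

definition "B = 16 * K ^ 4"

lemma sizes: "n + length gs + 4 \<le> K" "4 \<le> K"
  using length_le_tape_size[of tape] by (simp_all add: K_def tape_def)

lemma gs_le: "x \<in> set gs \<Longrightarrow> \<bar>x\<bar> \<le> 2 ^ K"
proof -
  assume "x \<in> set gs"
  then have "bit_size x \<le> tape_size gs"
    unfolding tape_size_def by (intro member_le_sum_list) auto
  then have "bit_size x \<le> Suc K" by (simp add: K_def tape_def tape_size_append tape_size_def)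
  then show ?thesis by (simp add: bit_size_le_iff)
qed

lemma gs_nth_le: "k < length gs \<Longrightarrow> \<bar>gs ! k\<bar> \<le> 2 ^ K"
  using gs_le by simp

text \<open>The remaining K^4 of \<open>B\<close> absorbs the sign bit and the passage to a strict
  inequality.\<close>

lemma small: "\<bar>v\<bar> \<le> 2 ^ e \<Longrightarrow> e \<le> 15 * K ^ 4 \<Longrightarrow> bit_size v \<le> B"
proof -
  assume v: "\<bar>v\<bar> \<le> 2 ^ e" "e \<le> 15 * K ^ 4"
  have "\<bar>v\<bar> < 2 ^ Suc e" using v(1) by (simp, smt (verit) zero_less_power)
  then have "bit_size v \<le> Suc (Suc e)" by (rule bit_size_le)
  also have "2 \<le> K ^ 4" using power_mono[of 4 K 4] sizes by simp
  then have "Suc (Suc e) \<le> B" using v(2) by (simp add: B_def)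
  finally show ?thesis .
qed

lemma K_le_pow2: "int (2 * K + 1) \<le> 2 ^ K"
proof -
  have "4 \<le> k \<Longrightarrow> 2 * k + 1 \<le> (2::nat) ^ k" for k
    by (induction k rule: nat_induct_at_least) auto
  from this[OF sizes(2)] show ?thesis
    by (metis of_nat_le_iff of_nat_numeral of_nat_power)
qed

lemma nat_le_pow2: "k \<le> 2 * K + 1 \<Longrightarrow> int k \<le> 2 ^ K"
  using K_le_pow2 by linarith

lemma K_pow_mono: "i \<le> j \<Longrightarrow> K ^ i \<le> K ^ j"
  using sizes(2) by (intro power_increasing) auto

sublocale resources K B
proof
  show "1 \<le> K" using sizes by simp
  fix k assume "k \<le> K"
  then have "\<bar>int k\<bar> \<le> 2 ^ K" using nat_le_pow2[of k] by simp
  moreover have "K \<le> 15 * K ^ 4" using K_pow_mono[of 1 4] by simp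
  ultimately show "bit_size (int k) \<le> B" by (rule small)
qed

lemma X_le: "1 \<le> X" "X \<le> 2 ^ (3 * K)"
proof -
  have "0 \<le> (\<Sum>k<length gs. gs ! k * gs ! k)" by (intro sum_nonneg) auto
  then show "1 \<le> X" by (simp add: X_def)
  have "(\<Sum>k<length gs. gs ! k * gs ! k) \<le> (\<Sum>k<length gs. 2 ^ K * 2 ^ K)"
  proof (rule sum_mono)
    fix k assume "k \<in> {..<length gs}"
    then have "\<bar>gs ! k\<bar> * \<bar>gs ! k\<bar> \<le> 2 ^ K * 2 ^ K" using gs_nth_le by (intro mult_mono) auto
    then show "gs ! k * gs ! k \<le> 2 ^ K * 2 ^ K" by (simp add: abs_mult[symmetric])
  qed
  then have "X \<le> 1 + int (length gs) * (2 ^ K * 2 ^ K)" by (simp add: X_def)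
  also have "1 \<le> (2::int) ^ K * 2 ^ K" by (simp add: power_add[symmetric])
  then have "1 + int (length gs) * (2 ^ K * 2 ^ K) \<le> (1 + int (length gs)) * (2 ^ K * 2 ^ K)"
    by (simp add: distrib_right)
  also have "\<dots> \<le> 2 ^ K * (2 ^ K * 2 ^ K)"
    using nat_le_pow2[of "Suc (length gs)"] sizes by (intro mult_right_mono) auto
  also have "\<dots> = 2 ^ (K + (K + K))" by (simp only: power_add)
  finally show "X \<le> 2 ^ (3 * K)" by (simp add: mult.commute[of 3] numeral_3_eq_3)
qed

lemma fact_le: "k \<le> K \<Longrightarrow> fact k \<le> (2::int) ^ (K ^ 2)"
proof -
  assume k: "k \<le> K"
  have "fact k \<le> (of_nat (k ^ k) :: int)" by (rule fact_le_power)
  also have "\<dots> = int k ^ k" by simp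
  also have "\<dots> \<le> (2 ^ K) ^ k" using nat_le_pow2[of k] k by (intro power_mono) auto
  also have "\<dots> \<le> (2 ^ K) ^ K" using k by (intro power_increasing) auto
  finally show ?thesis by (simp add: power_mult[symmetric] power2_eq_square)
qed

lemma \<Phi>_pos: "1 \<le> \<Phi>"
  by (simp add: \<Phi>_def)

lemma \<Phi>X_le: "l \<le> n \<Longrightarrow> 0 \<le> \<Phi> * X ^ l" "l \<le> n \<Longrightarrow> \<Phi> * X ^ l \<le> 2 ^ (4 * K ^ 2)"
proof -
  assume l: "l \<le> n"
  show "0 \<le> \<Phi> * X ^ l" using \<Phi>_pos X_le by simp
  have "\<Phi> \<le> 2 ^ (K ^ 2)" unfolding \<Phi>_def using sizes by (intro fact_le) simp
  moreover have "X ^ l \<le> 2 ^ (3 * K ^ 2)"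
  proof -
    have "X ^ l \<le> (2 ^ (3 * K)) ^ l" using X_le by (intro power_mono) auto
    also have "\<dots> \<le> (2 ^ (3 * K)) ^ K" using l sizes by (intro power_increasing) auto
    finally show ?thesis by (simp add: power_mult[symmetric] power2_eq_square mult.assoc)
  qed
  ultimately have "\<Phi> * X ^ l \<le> 2 ^ (K ^ 2) * 2 ^ (3 * K ^ 2)"
    using \<Phi>_pos X_le by (intro mult_mono) auto
  then show "\<Phi> * X ^ l \<le> 2 ^ (4 * K ^ 2)" by (simp add: power_add[symmetric])
qed

text \<open>All partial sums are covered, because the program stores each of them.\<close>

lemma ev_partial_le:
  assumes "\<And>l. l < n \<Longrightarrow> \<bar>g l\<bar> \<le> 2 ^ K" "l \<le> n"
  shows "\<bar>\<Sum>j<l. g j * (\<Phi> * X ^ j)\<bar> \<le> 2 ^ (6 * K ^ 2)"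
proof -
  have "\<bar>\<Sum>j<l. g j * (\<Phi> * X ^ j)\<bar> \<le> (\<Sum>j<l. \<bar>g j * (\<Phi> * X ^ j)\<bar>)" by (rule sum_abs)
  also have "\<dots> \<le> (\<Sum>j<l. 2 ^ K * 2 ^ (4 * K ^ 2))"
    unfolding abs_mult[of "g _"] using assms \<Phi>X_le by (intro sum_mono mult_mono) auto
  also have "\<dots> = int l * (2 ^ K * 2 ^ (4 * K ^ 2))" by simp
  also have "\<dots> \<le> 2 ^ K * (2 ^ K * 2 ^ (4 * K ^ 2))"
    using nat_le_pow2[of l] assms sizes by (intro mult_right_mono) auto
  also have "\<dots> = 2 ^ (K + (K + 4 * K ^ 2))" by (simp only: power_add)
  also have "\<dots> \<le> 2 ^ (6 * K ^ 2)"
    using K_pow_mono[of 1 2] by (intro power_increasing) auto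
  finally show ?thesis .
qed

lemma nth_gs:
  assumes "i < length ts" "k < length (enc_summand (ts ! i))"
  shows "off i + k < length gs" "gs ! (off i + k) = enc_summand (ts ! i) ! k"
proof -
  have "gs = concat (map enc_summand (take i ts)) @ enc_summand (ts ! i) @
      concat (map enc_summand (drop (Suc i) ts))"
    unfolding gs_def by (subst id_take_nth_drop[OF assms(1)]) simp
  then show "off i + k < length gs" "gs ! (off i + k) = enc_summand (ts ! i) ! k"
    using assms(2) by (simp_all add: off_def nth_append)
qed

lemma off_Suc: "i < length ts \<Longrightarrow> off (Suc i) = off i + length (enc_summand (ts ! i))"
  by (simp add: off_def take_Suc_conv_app_nth)

lemma off_0 [simp]: "off 0 = 0" and off_all: "off (length ts) = length gs"
  by (simp_all add: off_def gs_def)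

lemma off_le: "off i \<le> length gs"
proof -
  have "gs = concat (map enc_summand (take i ts)) @ concat (map enc_summand (drop i ts))"
    unfolding gs_def by (metis append_take_drop_id concat_append map_append)
  then show ?thesis unfolding off_def by (metis le_add1 length_append)
qed

text \<open>An elimination rule that collects the positions in \<open>gs\<close> of all parts of a
  summand. Its length inequality bounds the number of denominators by the tape: either each vector
  takes at least one cell, or n = 0 and there are no denominators.\<close>

lemma summand_cases:
  assumes "i < length ts"
  obtains p q v vs where "ts ! i = (p, q, v # vs)" "length v = n" "\<And>w. w \<in> set vs \<Longrightarrow> length w = n"
    "length (enc_summand (ts ! i)) = 3 + n + length vs * n"
    "off (Suc i) = off i + 3 + n + length vs * n" "Suc (length vs) + 2 \<le> 3 + n + length vs * n"
    "alpha i = ev v" "betas i = map ev vs"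
    "\<And>l. l < n \<Longrightarrow> gs ! (off i + 3 + l) = v ! l"
    "\<And>j l. j < length vs \<Longrightarrow> l < n \<Longrightarrow> gs ! (off i + 3 + n + j * n + l) = vs ! j ! l"
    "gs ! off i = p" "gs ! (off i + 1) = q" "gs ! (off i + 2) = int (length vs)"
proof -
  obtain p q ws where t: "ts ! i = (p, q, ws)" by (cases "ts ! i")
  have mem: "(p, q, ws) \<in> set ts" using assms t by (metis nth_mem)
  obtain v vs where ws: "ws = v # vs" using vs_ne[OF mem] by (cases ws) auto
  have len: "\<And>w. w \<in> set (v # vs) \<Longrightarrow> length w = n" using vs_len[OF mem] ws by blast
  have lenc: "length (concat vs) = length vs * n" using len by (intro length_concat_uniform) auto
  have lene: "length (enc_summand (ts ! i)) = 3 + n + length vs * n"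
    using len by (simp add: t ws enc_summand_def lenc)
  have "gs ! (off i + 3 + l) = v ! l" if "l < n" for l
    using nth_gs(2)[OF assms, of "3 + l"] that len lene
    by (simp add: t ws enc_summand_def nth_append ac_simps numeral_3_eq_3)
  moreover have "gs ! (off i + 3 + n + j * n + l) = vs ! j ! l" if "j < length vs" "l < n" for j l
  proof -
    have "Suc j * n \<le> length vs * n" using that by (intro mult_right_mono) auto
    then have jl: "j * n + l < length vs * n" using that(2) by simp
    have "gs ! (off i + (3 + (n + (j * n + l)))) = enc_summand (ts ! i) ! (3 + (n + (j * n + l)))"
      using jl lene by (intro nth_gs(2) assms) simp
    also have "\<dots> = concat vs ! (j * n + l)"
      using len by (simp add: t ws enc_summand_def nth_append numeral_3_eq_3)
    also have "\<dots> = vs ! j ! l" using len that by (intro nth_concat_uniform) auto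
    finally show ?thesis by (simp add: ac_simps)
  qed
  moreover have "gs ! off i = p" "gs ! (off i + 1) = q" "gs ! (off i + 2) = int (length vs)"
    using nth_gs(2)[OF assms, of 0] nth_gs(2)[OF assms, of 1] nth_gs(2)[OF assms, of 2] lene
    by (simp_all add: t ws enc_summand_def numeral_2_eq_2)
  moreover have "length vs \<le> length vs * n + n"
    using dim_0[OF mem] ws by (cases n) auto
  ultimately show thesis
    using that[of p q v vs] t ws len lene off_Suc[OF assms] by (simp add: alpha_def betas_def)
qed

section \<open>Verification of the input phase and of the choice of \<lambda>\<close>

lemma length_ts_le: "length ts \<le> length gs"
proof -
  have "length us \<le> length (concat (map enc_summand us))" for us
    by (induction us) (auto simp: enc_summand_def split: prod.splits)
  then show ?thesis by (simp add: gs_def)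
qed

definition reading :: "nat \<Rightarrow> state \<Rightarrow> bool" where
  "reading p = (\<lambda>(m, inp, out). m ''n'' 0 = int n \<and> m ''N'' 0 = int (length ts) \<and>
     m ''pos'' 0 = int p \<and> inp = drop p gs \<and> (\<forall>k<p. m ''G'' (int k) = gs ! k) \<and> out = [])"

lemma gs_small: "k < length gs \<Longrightarrow> bit_size (gs ! k) \<le> B"
  using small[OF gs_nth_le, of k] K_pow_mono[of 1 4] by simp

lemma wp_get:
  assumes "reading p (m, inp, out)" "p < length gs"
    and "\<And>m'. (\<And>y. y \<notin> {''G'', ''pos''} \<Longrightarrow> m' y = m y) \<Longrightarrow> reading (Suc p) (m', drop (Suc p) gs, []) \<Longrightarrow>
      Q (m', drop (Suc p) gs, [])"
  shows "wp K B get_com Q (m, inp, out)"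
proof -
  have m: "m ''n'' 0 = int n" "m ''N'' 0 = int (length ts)" "m ''pos'' 0 = int p"
    "inp = drop p gs" "\<And>k. k < p \<Longrightarrow> m ''G'' (int k) = gs ! k" "out = []"
    using assms(1) by (auto simp: reading_def)
  have inp: "drop p gs = gs ! p # drop (Suc p) gs" using assms(2) by (simp add: Cons_nth_drop_Suc)
  have "bit_size (int p + 1) \<le> B" using small_nat[of "Suc p"] assms(2) sizes by (simp add: ac_simps)
  then show ?thesis
    using m gs_small[OF assms(2)]
    by (simp add: get_com_def inp, intro assms(3)) (auto simp: reading_def less_Suc_eq)
qed

lemma wp_gets:
  assumes "reading p (m, inp, out)" "p + c \<le> length gs" "m ''c'' 0 = int c"
    and "\<And>m'. (\<And>y. y \<notin> {''G'', ''pos'', ''k''} \<Longrightarrow> m' y = m y) \<Longrightarrow>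
      reading (p + c) (m', drop (p + c) gs, []) \<Longrightarrow> Q (m', drop (p + c) gs, [])"
  shows "wp K B (For ''k'' (Var ''c'') get_com) Q (m, inp, out)"
proof (rule wp_For[where N = c and I = "\<lambda>k (m', inp', out').
    (\<forall>y. y \<notin> {''G'', ''pos'', ''k''} \<longrightarrow> m' y = m y) \<and> reading (p + k) (m', inp', out')"], goal_cases)
  case 1
  then show ?case using assms(1) by (simp add: reading_def)
next
  case (2 k m' inp' out')
  then have k: "k < c" "m' ''k'' 0 = int k" and frame: "\<And>y. y \<notin> {''G'', ''pos'', ''k''} \<Longrightarrow> m' y = m y"
    and r: "reading (p + k) (m', inp', out')" by simp_all
  show ?case
  proof (rule wp_get[OF r])
    show "p + k < length gs" using k assms(2) by simp
    fix m''
    assume frame': "\<And>y. y \<notin> {''G'', ''pos''} \<Longrightarrow> m'' y = m' y"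
      and r': "reading (Suc (p + k)) (m'', drop (Suc (p + k)) gs, [])"
    then show "case (m'', drop (Suc (p + k)) gs, []) of (m', inp', out') \<Rightarrow> m' ''k'' 0 = int k \<and>
       (case (m'(''k'' := (m' ''k'')(0 := int k + 1)), inp', out') of (m', inp', out') \<Rightarrow>
         (\<forall>y. y \<notin> {''G'', ''pos'', ''k''} \<longrightarrow> m' y = m y) \<and> reading (p + Suc k) (m', inp', out'))"
      using k frame by (simp add: reading_def)
  qed
next
  case (3 k m' inp' out')
  then show ?case using assms(3) by simp
next
  case (4 m' inp' out')
  then have "inp' = drop (p + c) gs" "out' = []" by (simp_all add: reading_def)
  then show ?case using 4 assms(4)[of m'] by simp
qed (use assms(2) sizes small_nat in auto)

lemma wp_read:
  assumes "\<And>m. reading (length gs) (m, [], []) \<Longrightarrow> Q (m, [], [])"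
  shows "wp K B read_com Q (\<lambda>_ _. 0, tape, [])"
proof -
  let ?c = "get_com ;; get_com ;; get_com ;;
        ''c'' ::= Op Mul (Var ''n'')
          (Op Add (Const 1) (Cell ''G'' (Op Sub (Var ''pos'') (Const 1)))) ;;
        For ''k'' (Var ''c'') get_com"
  have terms: "wp K B (For ''i'' (Var ''N'') ?c) Q (m, gs, [])" if "reading 0 (m, gs, [])" for m
  proof (rule wp_For[where N = "length ts" and I = "\<lambda>i. reading (off i)"], goal_cases)
    case 1
    then show ?case using that by (simp add: reading_def)
  next
    case (2 i m inp out)
    note i = 2(1) and mi = 2(2) and r0 = 2(3)
    obtain vs :: "int list list" where t: "length (enc_summand (ts ! i)) = 3 + n + length vs * n"
      "off (Suc i) = off i + 3 + n + length vs * n" "gs ! (off i + 2) = int (length vs)"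
      by (rule summand_cases[OF i]) blast
    have le: "off i + 3 + n + length vs * n \<le> length gs" using off_le[of "Suc i"] t(2) by simp
    show ?case unfolding wp.simps(5)
    proof (rule wp_get[OF r0], goal_cases)
      case (2 m1)
      show ?case
      proof (rule wp_get[OF 2(2)], goal_cases)
        case (2 m2)
        note fr2 = 2(1)
        show ?case
        proof (rule wp_get[OF 2(2)], goal_cases)
          case (2 m3)
          let ?p = "Suc (Suc (Suc (off i)))" and ?cc = "n + length vs * n"
          have m3: "m3 ''n'' 0 = int n" "m3 ''pos'' 0 = int ?p"
            "m3 ''G'' (int (off i + 2)) = int (length vs)"
            using 2(2) t(3) by (auto simp: reading_def)
          then have val: "m3 ''n'' 0 * (1 + m3 ''G'' (m3 ''pos'' 0 - 1)) = int ?cc"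
            by (simp add: algebra_simps)
          have mi3: "m3 ''i'' 0 = int i"
            using 2(1) fr2 \<open>\<And>y. y \<notin> {''G'', ''pos''} \<Longrightarrow> m1 y = m y\<close> mi by simp
          have r3: "reading ?p (m3(''c'' := (m3 ''c'')(0 := int ?cc)), drop ?p gs, [])"
            using 2(2) by (simp add: reading_def)
          have "wp K B (For ''k'' (Var ''c'') get_com)
             (\<lambda>(m, inp, out). m ''i'' 0 = int i \<and>
                reading (off (Suc i)) (m(''i'' := (m ''i'')(0 := int i + 1)), inp, out))
             (m3(''c'' := (m3 ''c'')(0 := int ?cc)), drop ?p gs, [])"
          proof (rule wp_gets[OF r3, where c = ?cc])
            fix m'
            assume fr: "\<And>y. y \<notin> {''G'', ''pos'', ''k''} \<Longrightarrow> m' y = (m3(''c'' := (m3 ''c'')(0 := int ?cc))) y"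
              and r': "reading (?p + ?cc) (m', drop (?p + ?cc) gs, [])"
            have "?p + ?cc = off (Suc i)" using t(2) by simp
            then show "case (m', drop (?p + ?cc) gs, []) of (m, inp, out) \<Rightarrow> m ''i'' 0 = int i \<and>
                reading (off (Suc i)) (m(''i'' := (m ''i'')(0 := int i + 1)), inp, out)"
              using fr r' mi3 by (simp add: reading_def)
          qed (use le in simp_all)
          moreover have "bit_size (int ?cc) \<le> B" using le sizes by (intro small_nat) simp
          ultimately show ?case using val by simp
        qed (use le in simp)
      qed (use le in simp)
    qed (use le in simp)
  next
    case (3 k m inp out)
    then show ?case by (simp add: reading_def)
  next
    case (4 m inp out)
    then show ?case using assms[of m] by (simp add: off_all reading_def)
  qed (use sizes small_nat length_ts_le in auto)
  have gsN: "bit_size (int (length ts)) \<le> B"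
    using length_ts_le sizes by (intro small_nat) simp
  \<comment> \<open>The number in \<open>z\<close> has been read but not yet acted upon, so the
    invariant puts it back in front of the remaining input.\<close>
  let ?I = "\<lambda>k (m :: mem, inp, out :: int list). k \<le> n \<and> m ''n'' 0 = int k \<and> m ''pos'' 0 = 0 \<and> out = [] \<and>
    m ''z'' 0 # inp = replicate (n - k) 1 @ 0 # int (length ts) # gs"
  have rest: "wp K B (Read ''N'' (Const 0) ;; For ''i'' (Var ''N'') ?c) Q (m, inp, out)"
    if "?I n (m, inp, out)" for m inp out
  proof -
    have "reading 0 (m(''N'' := (m ''N'')(0 := int (length ts))), gs, [])"
      using that by (simp add: reading_def)
    from terms[OF this] show ?thesis using that gsN by simp
  qed
  have loop: "wp K B (While (Var ''z'') (''n'' ::= Op Add (Var ''n'') (Const 1) ;; Read ''z'' (Const 0)))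
      (wp K B (Read ''N'' (Const 0) ;; For ''i'' (Var ''N'') ?c) Q) (m, inp, out)"
    if "?I 0 (m, inp, out)" for m inp out
  proof (rule wp_While[where N = n and I = ?I])
    fix k s
    assume k: "k < n" and I: "?I k s"
    obtain m inp out where s: "s = (m, inp, out)" by (cases s)
    have rep: "replicate (n - k) 1 = 1 # replicate (n - Suc k) (1::int)"
      using k by (metis Suc_diff_Suc replicate_Suc)
    then have inp: "m ''z'' 0 = 1" "inp = replicate (n - Suc k) 1 @ 0 # int (length ts) # gs"
      using I s by simp_all
    have ne: "inp \<noteq> []" "bit_size (hd inp) \<le> B" "hd inp # tl inp = inp"
      using inp(2) by (cases "n - Suc k"; simp)+
    have "bit_size (int k + 1) \<le> B" using small_nat[of "Suc k"] k sizes by (simp add: ac_simps)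
    then show "aval (fst s) (Var ''z'') \<noteq> 0 \<and>
        wp K B (''n'' ::= Op Add (Var ''n'') (Const 1) ;; Read ''z'' (Const 0)) (?I (Suc k)) s"
      using I k s inp ne by simp
  next
    fix s assume "?I n s"
    then show "aval (fst s) (Var ''z'') = 0 \<and> wp K B (Read ''N'' (Const 0) ;; For ''i'' (Var ''N'') ?c) Q s"
      using rest by (cases s) (auto simp del: wp.simps)
  qed (use that sizes in auto)
  let ?m = "(\<lambda>_ _. 0)(''z'' := (\<lambda>_. 0)(0 := hd tape)) :: mem"
  have tape: "tape \<noteq> []" by (simp add: tape_def)
  have "hd tape = 0 \<or> hd tape = 1" by (simp add: tape_def hd_append)
  then have hd: "bit_size (hd tape) \<le> B" by auto
  have "hd tape # tl tape = replicate n 1 @ 0 # int (length ts) # gs"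
    using tape by (simp add: tape_def)
  then have "?I 0 (?m, tl tape, [])" by simp
  from loop[OF this] show ?thesis
    unfolding read_com_def wp.simps(5) wp.simps(3) prod.case using tape hd by (simp del: wp.simps)
qed

lemma wp_lambda:
  assumes r: "reading (length gs) (m, inp, out)"
    and Q: "\<And>m'. m' ''n'' 0 = int n \<Longrightarrow> m' ''N'' 0 = int (length ts) \<Longrightarrow>
      (\<And>k. k < length gs \<Longrightarrow> m' ''G'' (int k) = gs ! k) \<Longrightarrow> m' ''X'' 0 = X \<Longrightarrow> m' ''Phi'' 0 = \<Phi> \<Longrightarrow>
      Q (m', inp, lambda_out n)"
  shows "wp K B lambda_com Q (m, inp, out)"
proof -
  have m: "m ''n'' 0 = int n" "m ''N'' 0 = int (length ts)" "m ''pos'' 0 = int (length gs)"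
    "\<And>k. k < length gs \<Longrightarrow> m ''G'' (int k) = gs ! k" "out = []"
    using r by (auto simp: reading_def)
  let ?X = "\<lambda>k. 1 + (\<Sum>i<k. gs ! i * gs ! i)"
  have K4: "4 * K ^ 2 \<le> 15 * K ^ 4" "3 * K \<le> 15 * K ^ 4" "K ^ 2 \<le> 15 * K ^ 4"
    using K_pow_mono[of 2 4] K_pow_mono[of 1 4] by simp_all
  have X: "bit_size (?X k) \<le> B" if "k \<le> length gs" for k
  proof -
    have "?X k \<le> X" unfolding X_def using that by (intro add_left_mono sum_mono2) auto
    moreover have "0 \<le> (\<Sum>i<k. gs ! i * gs ! i)" by (intro sum_nonneg) auto
    ultimately have "\<bar>?X k\<bar> \<le> 2 ^ (3 * K)" using X_le by simp
    then show ?thesis using K4 by (intro small[of _ "3 * K"])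
  qed
  have F: "bit_size (fact k) \<le> B" if "k \<le> length gs" for k
    using that sizes K4 fact_le[of k] by (intro small[of _ "K ^ 2"]) auto
  let ?W = "{''k'', ''X'', ''Phi''}"
  let ?c = "''pw'' ::= Op Mul (Var ''pw'') (Var ''X'')"
  have second: "wp K B (For ''l'' (Var ''n'') (Write (Var ''pw'') ;; Write (Const 1) ;; ?c)) Q
      (m0(''pw'' := (m0 ''pw'')(0 := \<Phi>)), inp, [])"
    if m0: "\<And>y. y \<notin> ?W \<Longrightarrow> m0 y = m y" "m0 ''X'' 0 = X" "m0 ''Phi'' 0 = \<Phi>" for m0
  proof (rule wp_For[where N = n and I = "\<lambda>l (m', inp', out').
      (\<forall>y. y \<notin> {''l'', ''pw''} \<longrightarrow> m' y = m0 y) \<and> m' ''pw'' 0 = \<Phi> * X ^ l \<and> inp' = inp \<and>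
      out' = lambda_out l"], goal_cases)
    case 1
    then show ?case by (simp add: lambda_out_def)
  next
    case (2 l m' inp' out')
    have "\<bar>\<Phi> * X ^ Suc l\<bar> \<le> 2 ^ (4 * K ^ 2)" using \<Phi>X_le[of "Suc l"] 2(1) by (simp del: power_Suc)
    then have "bit_size (\<Phi> * X ^ Suc l) \<le> B" using K4 by (intro small[of _ "4 * K ^ 2"])
    then show ?case using 2 m0 by (simp add: lambda_out_def ac_simps)
  next
    case (4 m' inp' out')
    then show ?case using m0 m Q[of m'] by simp
  qed (use m m0 sizes small_nat in auto)
  have "wp K B (For ''k'' (Var ''pos'')
       (''X'' ::= Op Add (Var ''X'') (Op Mul (Cell ''G'' (Var ''k'')) (Cell ''G'' (Var ''k''))) ;;
        ''Phi'' ::= Op Mul (Var ''Phi'') (Op Add (Var ''k'') (Const 1))))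
      (wp K B (''pw'' ::= Var ''Phi'' ;;
        For ''l'' (Var ''n'') (Write (Var ''pw'') ;; Write (Const 1) ;; ?c)) Q)
      (m(''X'' := (m ''X'')(0 := 1), ''Phi'' := (m ''Phi'')(0 := 1)), inp, [])"
  proof (rule wp_For[where N = "length gs" and I = "\<lambda>k (m', inp', out').
      (\<forall>y. y \<notin> ?W \<longrightarrow> m' y = m y) \<and> m' ''X'' 0 = ?X k \<and> m' ''Phi'' 0 = fact k \<and>
      inp' = inp \<and> out' = []"], goal_cases)
    case (2 k m' inp' out')
    have "bit_size (fact k * (int k + 1)) \<le> B" using F[of "Suc k"] 2(1) by (simp add: algebra_simps)
    then show ?case using 2 m X[of "Suc k"] by (simp add: algebra_simps)
  next
    case (4 m' inp' out')
    then have "wp K B (For ''l'' (Var ''n'') (Write (Var ''pw'') ;; Write (Const 1) ;; ?c)) Q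
      (m'(''pw'' := (m' ''pw'')(0 := \<Phi>)), inp, [])"
      by (intro second) (simp_all add: X_def \<Phi>_def)
    then show ?case using 4 F[of "length gs"] by (simp add: \<Phi>_def)
  qed (use m sizes small_nat in auto)
  then show ?thesis using m by (simp add: lambda_com_def)
qed

section \<open>Sizes of the values belonging to one summand\<close>

lemma pow2_le: "x \<le> 2 ^ e \<Longrightarrow> e \<le> e' \<Longrightarrow> x \<le> (2::int) ^ e'"
  by (rule order_trans[OF _ power_increasing]) auto

lemma K_cubes: "K ^ 2 \<le> K ^ 3" "K \<le> K ^ 3" "K ^ 3 \<le> K ^ 4" "K ^ 3 * K = K ^ 4" "1 \<le> K ^ 3"
  "K ^ 2 * K = K ^ 3"
  using K_pow_mono[of 2 3] K_pow_mono[of 1 3] K_pow_mono[of 3 4] K_pow_mono[of 0 3]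
  by (simp_all add: power_numeral_reduce)

lemma cube_small: "\<bar>v\<bar> \<le> 2 ^ (e * K ^ 3) \<Longrightarrow> e \<le> 15 \<Longrightarrow> bit_size v \<le> B"
  by (erule small) (use K_cubes(3) in \<open>auto intro: mult_le_mono\<close>)

text \<open>With exponents up to K a quadratic bit bound turns into a cubic one. This serves for
  powers of the values at \<lambda>, for products of the denominators and for series
  coefficients.\<close>

lemma power_le_cube:
  fixes b :: int
  assumes "\<bar>b\<bar> \<le> 2 ^ (e * K ^ 2)" "h \<le> K"
  shows "\<bar>b ^ h\<bar> \<le> 2 ^ (e * K ^ 3)"
proof -
  have "\<bar>b ^ h\<bar> \<le> (2 ^ (e * K ^ 2)) ^ h" unfolding power_abs using assms(1) by (intro power_mono) auto
  also have "\<dots> \<le> (2 ^ (e * K ^ 2)) ^ K" using assms(2) by (intro power_increasing) auto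
  also have "\<dots> = 2 ^ (e * K ^ 3)" by (simp only: power_mult[symmetric] mult.assoc K_cubes)
  finally show ?thesis .
qed

lemma summand_bounds:
  assumes "i < length ts"
  shows "\<bar>alpha i\<bar> \<le> 2 ^ (6 * K ^ 2)" "b \<in> set (betas i) \<Longrightarrow> \<bar>b\<bar> \<le> 2 ^ (6 * K ^ 2)"
    "length (betas i) + 4 \<le> K"
proof -
  obtain p q v vs where t: "ts ! i = (p, q, v # vs)"
    "length (enc_summand (ts ! i)) = 3 + n + length vs * n"
    "off (Suc i) = off i + 3 + n + length vs * n" "Suc (length vs) + 2 \<le> 3 + n + length vs * n"
    "alpha i = ev v" "betas i = map ev vs"
    "\<And>l. l < n \<Longrightarrow> gs ! (off i + 3 + l) = v ! l"
    "\<And>j l. j < length vs \<Longrightarrow> l < n \<Longrightarrow> gs ! (off i + 3 + n + j * n + l) = vs ! j ! l"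
    by (rule summand_cases[OF assms]) blast
  have le: "off i + 3 + n + length vs * n \<le> length gs" using off_le[of "Suc i"] t(3) by simp
  have "\<bar>v ! l\<bar> \<le> 2 ^ K" if "l < n" for l
    using gs_nth_le[of "off i + 3 + l"] t(7)[OF that] that le by simp
  then show "\<bar>alpha i\<bar> \<le> 2 ^ (6 * K ^ 2)"
    unfolding t(5) ev_def by (intro ev_partial_le) auto
  show "length (betas i) + 4 \<le> K" using t(4,6) le sizes by simp
  assume "b \<in> set (betas i)"
  then obtain j where j: "j < length vs" "b = ev (vs ! j)"
    using t(6) by (auto simp: in_set_conv_nth)
  have "Suc j * n \<le> length vs * n" using j by (intro mult_right_mono) auto
  then have "\<bar>vs ! j ! l\<bar> \<le> 2 ^ K" if "l < n" for l
    using gs_nth_le[of "off i + 3 + n + j * n + l"] t(8)[OF j(1) that] that le by simp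
  then show "\<bar>b\<bar> \<le> 2 ^ (6 * K ^ 2)"
    unfolding j(2) ev_def by (intro ev_partial_le) auto
qed

text \<open>The growth rate 1 + 2 j G with G = 2^(6 K^2) costs at most K bits more than G, hence at
  most 7 K^2, and its powers at most 7 K^3.\<close>

lemma inv_series_le:
  assumes "i < length ts" "j \<le> length (betas i)" "k \<le> length (betas i)"
  shows "\<bar>inv_series (take j (betas i)) k\<bar> \<le> 2 ^ (7 * K ^ 3)"
    and "j < length (betas i) \<Longrightarrow> k < length (betas i) \<Longrightarrow> h \<le> Suc k \<Longrightarrow>
      \<bar>div_partial (betas i ! j) (inv_series (take j (betas i))) k h\<bar> \<le> 2 ^ (7 * K ^ 3)"
proof -
  let ?G = "2 ^ (6 * K ^ 2) :: int"
  note b = summand_bounds[OF assms(1)]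
  have H: "\<bar>inv_series (take j (betas i)) k\<bar> \<le> (1 + 2 * int j * ?G) ^ k" if "j \<le> length (betas i)" for j k
    using inv_series_bound[of "take j (betas i)" ?G k] b(2) that
    by (auto dest: in_set_takeD simp: min_absorb2)
  have pow: "(1 + 2 * int j * ?G) ^ k \<le> 2 ^ (7 * K ^ 3)" if "j \<le> K" "k \<le> K" for j k
  proof -
    have "1 + 2 * int j * ?G \<le> (1 + 2 * int j) * ?G" by (simp add: distrib_right)
    also have "\<dots> \<le> 2 ^ K * ?G"
      using nat_le_pow2[of "1 + 2 * j"] that(1) by (intro mult_right_mono) auto
    also have "\<dots> = 2 ^ (K + 6 * K ^ 2)" by (simp only: power_add)
    also have "\<dots> \<le> 2 ^ (7 * K ^ 2)" using K_pow_mono[of 1 2] by (intro power_increasing) auto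
    finally have "\<bar>1 + 2 * int j * ?G\<bar> \<le> 2 ^ (7 * K ^ 2)" by simp
    from power_le_cube[OF this that(2)] show ?thesis by simp
  qed
  show "\<bar>inv_series (take j (betas i)) k\<bar> \<le> 2 ^ (7 * K ^ 3)"
    using H[OF assms(2), of k] pow[of j k] assms b(3) by simp
  assume jk: "j < length (betas i)" "k < length (betas i)" "h \<le> Suc k"
  have bj: "\<bar>betas i ! j\<bar> \<le> ?G" using b(2) jk by simp
  have "\<bar>div_partial (betas i ! j) (inv_series (take j (betas i))) k h\<bar> \<le>
      ((1 + 2 * int j * ?G) + 2 * ?G) ^ Suc k"
    by (rule div_partial_bound[where s = "length (betas i)", OF H _ bj div_series_bound[where s = k, OF H _ bj]])
      (use jk in auto)
  also have "\<dots> = (1 + 2 * int (Suc j) * ?G) ^ Suc k" by (simp add: algebra_simps)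
  also have "\<dots> \<le> 2 ^ (7 * K ^ 3)" using jk b(3) by (intro pow) auto
  finally show "\<bar>div_partial (betas i ! j) (inv_series (take j (betas i))) k h\<bar> \<le> 2 ^ (7 * K ^ 3)" .
qed

lemma neg_prod_le:
  assumes "i < length ts"
  shows "\<bar>neg_prod (take j (betas i))\<bar> \<le> 2 ^ (6 * K ^ 3)"
proof -
  let ?G = "2 ^ (6 * K ^ 2) :: int"
  note b = summand_bounds[OF assms]
  have "\<bar>neg_prod (take j (betas i))\<bar> \<le> ?G ^ length (take j (betas i))"
    by (rule neg_prod_bound) (auto intro: b(2) dest: in_set_takeD)
  also have "\<dots> \<le> 2 ^ (6 * K ^ 3)"
    using power_le_cube[of ?G 6 "length (take j (betas i))"] b(3) by simp
  finally show ?thesis .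
qed

lemma numer_denom_le:
  assumes "i < length ts" "l \<le> length (betas i)"
  shows "\<bar>fact l * neg_prod (betas i)\<bar> \<le> 2 ^ (7 * K ^ 3)"
    "\<bar>numer i l\<bar> \<le> 2 ^ (14 * K ^ 3)" "\<bar>denom i l\<bar> \<le> 2 ^ (14 * K ^ 3)"
proof -
  note b = summand_bounds[OF assms(1)]
  obtain p q v vs where t: "ts ! i = (p, q, v # vs)"
    "length (enc_summand (ts ! i)) = 3 + n + length vs * n"
    "gs ! off i = p" "gs ! (off i + 1) = q"
    by (rule summand_cases[OF assms(1)]) blast
  have pq: "\<bar>p\<bar> \<le> 2 ^ K" "\<bar>q\<bar> \<le> 2 ^ K"
    using gs_nth_le[of "off i"] gs_nth_le[of "off i + 1"] t nth_gs(1)[OF assms(1), of 0]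
      nth_gs(1)[OF assms(1), of 1] by simp_all
  have "\<bar>fact l * neg_prod (betas i)\<bar> \<le> 2 ^ (K ^ 2) * 2 ^ (6 * K ^ 3)"
    using fact_le[of l] assms(2) b(3) neg_prod_le[OF assms(1), of "length (betas i)"]
    unfolding abs_mult by (intro mult_mono) auto
  also have "\<dots> = 2 ^ (K ^ 2 + 6 * K ^ 3)" by (simp only: power_add)
  finally show d: "\<bar>fact l * neg_prod (betas i)\<bar> \<le> 2 ^ (7 * K ^ 3)"
    by (rule pow2_le) (use K_cubes in simp)
  have "\<bar>denom i l\<bar> \<le> 2 ^ K * 2 ^ (7 * K ^ 3)"
    unfolding denom_def t prod.case abs_mult[of q] using pq d by (intro mult_mono) auto
  also have "\<dots> = 2 ^ (K + 7 * K ^ 3)" by (simp only: power_add)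
  finally show "\<bar>denom i l\<bar> \<le> 2 ^ (14 * K ^ 3)"
    by (rule pow2_le) (use K_cubes in simp)
  have "\<bar>inv_series (betas i) (length (betas i) - l)\<bar> \<le> 2 ^ (7 * K ^ 3)"
    using inv_series_le(1)[OF assms(1), of "length (betas i)" "length (betas i) - l"] by simp
  moreover have "\<bar>alpha i ^ l\<bar> \<le> 2 ^ (6 * K ^ 3)"
    using b(1,3) assms(2) by (intro power_le_cube) auto
  ultimately have "\<bar>numer i l\<bar> \<le> (2 ^ K * 2 ^ (7 * K ^ 3)) * 2 ^ (6 * K ^ 3)"
    unfolding numer_def t prod.case abs_mult using pq by (intro mult_mono) auto
  also have "\<dots> = 2 ^ (K + 7 * K ^ 3 + 6 * K ^ 3)" by (simp only: power_add)
  finally show "\<bar>numer i l\<bar> \<le> 2 ^ (14 * K ^ 3)"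
    by (rule pow2_le) (use K_cubes in simp)
qed

text \<open>The tape position \<open>off i\<close> bounds the number of additions so far: a summand
  with s denominators contributes s + 1 fractions and occupies at least s + 3 cells. So the exponent
  stays within K over the whole run.\<close>

lemma acc_le:
  assumes "i \<le> length ts"
  shows "\<bar>fst (acc i)\<bar> \<le> (2 * 2 ^ (14 * K ^ 3)) ^ off i \<and> \<bar>snd (acc i)\<bar> \<le> (2 * 2 ^ (14 * K ^ 3)) ^ off i"
  using assms
proof (induction i)
  case (Suc i)
  then have i: "i < length ts" by simp
  let ?M = "2 ^ (14 * K ^ 3) :: int"
  obtain vs :: "int list list" where
    t: "off (Suc i) = off i + 3 + n + length vs * n" "Suc (length vs) + 2 \<le> 3 + n + length vs * n"
      "betas i = map ev vs"
    by (rule summand_cases[OF i]) blast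
  have "off i + Suc (length (betas i)) \<le> off (Suc i)" using t by simp
  then have "(2 * ?M) ^ (off i + Suc (length (betas i))) \<le> (2 * ?M) ^ off (Suc i)"
    by (intro power_increasing) (auto simp: power_Suc[symmetric] simp del: power_Suc)
  then show ?case
    using add_fracs_bound[of "Suc (length (betas i))" "numer i" ?M "denom i" "acc i" "off i"]
      numer_denom_le[OF i] Suc by (simp del: add_fracs.simps power_Suc)
qed simp

lemma add_fracs_le:
  assumes i: "i < length ts" and l: "l \<le> Suc (length (betas i))"
  shows "bit_size (fst (add_fracs (numer i) (denom i) (acc i) l)) \<le> B"
    "bit_size (snd (add_fracs (numer i) (denom i) (acc i) l)) \<le> B"
proof -
  let ?M = "2 ^ (14 * K ^ 3) :: int"
  obtain vs :: "int list list" where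
    t: "off (Suc i) = off i + 3 + n + length vs * n" "Suc (length vs) + 2 \<le> 3 + n + length vs * n"
      "betas i = map ev vs"
    by (rule summand_cases[OF i]) blast
  have "off i + l \<le> K" using t l off_le[of "Suc i"] sizes by simp
  then have "(2 * ?M) ^ (off i + l) \<le> (2 * ?M) ^ K"
    by (intro power_increasing) (auto simp: power_Suc[symmetric] simp del: power_Suc)
  also have "2 * ?M = 2 ^ (14 * K ^ 3 + 1)" by simp
  also have "(2 ^ (14 * K ^ 3 + 1)) ^ K \<le> (2::int) ^ (15 * K ^ 4)"
  proof -
    \<comment> \<open>The extra 1 per round is the factor 2 of an addition.\<close>
    have "(14 * K ^ 3 + 1) * K \<le> 15 * K ^ 3 * K" using K_cubes by (intro mult_right_mono) auto
    also have "\<dots> = 15 * K ^ 4" by (simp only: mult.assoc K_cubes)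
    finally show ?thesis unfolding power_mult[symmetric] by (intro power_increasing) auto
  qed
  finally have M: "(2 * ?M) ^ (off i + l) \<le> 2 ^ (15 * K ^ 4)" by simp
  have "\<bar>fst (add_fracs (numer i) (denom i) (acc i) l)\<bar> \<le> (2 * ?M) ^ (off i + l)"
    "\<bar>snd (add_fracs (numer i) (denom i) (acc i) l)\<bar> \<le> (2 * ?M) ^ (off i + l)"
    by (rule add_fracs_bound; use acc_le[of i] i l numer_denom_le[OF i] in simp)+
  then show "bit_size (fst (add_fracs (numer i) (denom i) (acc i) l)) \<le> B"
    "bit_size (snd (add_fracs (numer i) (denom i) (acc i) l)) \<le> B"
    using M by (auto intro!: small[of _ "15 * K ^ 4"])
qed

section \<open>Verification of the main loop\<close>

definition ready :: "nat \<Rightarrow> state \<Rightarrow> bool" where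
  "ready i = (\<lambda>(m, inp, out). m ''n'' 0 = int n \<and> m ''N'' 0 = int (length ts) \<and>
     (\<forall>k<length gs. m ''G'' (int k) = gs ! k) \<and> m ''X'' 0 = X \<and> m ''Phi'' 0 = \<Phi> \<and>
     m ''pos'' 0 = int (off i) \<and> m ''RP'' 0 = fst (acc i) \<and> m ''RQ'' 0 = snd (acc i) \<and>
     out = lambda_out n @ concat (map weights_out [0..<i]))"

lemma wp_summand:
  assumes i: "i < length ts" and ready: "ready i (m, inp, out)"
    and Q: "\<And>m' out'. m' ''i'' = m ''i'' \<Longrightarrow> ready (Suc i) (m', inp, out') \<Longrightarrow> Q (m', inp, out')"
  shows "wp K B summand_com Q (m, inp, out)"
proof -
  have m: "m ''n'' 0 = int n" "m ''N'' 0 = int (length ts)"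
    "\<And>k. k < length gs \<Longrightarrow> m ''G'' (int k) = gs ! k" "m ''X'' 0 = X" "m ''Phi'' 0 = \<Phi>"
    "m ''pos'' 0 = int (off i)" "m ''RP'' 0 = fst (acc i)" "m ''RQ'' 0 = snd (acc i)"
    "out = lambda_out n @ concat (map weights_out [0..<i])"
    using ready by (auto simp: ready_def)
  obtain p q v vs where t: "ts ! i = (p, q, v # vs)"
    "off (Suc i) = off i + 3 + n + length vs * n" "Suc (length vs) + 2 \<le> 3 + n + length vs * n"
    "alpha i = ev v" "betas i = map ev vs"
    "\<And>l. l < n \<Longrightarrow> gs ! (off i + 3 + l) = v ! l"
    "\<And>j l. j < length vs \<Longrightarrow> l < n \<Longrightarrow> gs ! (off i + 3 + n + j * n + l) = vs ! j ! l"
    "gs ! off i = p" "gs ! (off i + 1) = q" "gs ! (off i + 2) = int (length vs)"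
    by (rule summand_cases[OF i]) blast
  let ?s = "length vs"
  have le: "off i + 3 + n + ?s * n \<le> length gs" using off_le[of "Suc i"] t(2) by simp
  note b = summand_bounds[OF i]
  have s: "length (betas i) = ?s" using t(5) by simp
  have K4: "4 * K ^ 2 \<le> 15 * K ^ 4" "6 * K ^ 2 \<le> 15 * K ^ 4" "K ^ 2 \<le> 15 * K ^ 4"
    using K_pow_mono[of 2 4] by simp_all
  have PX: "bit_size (\<Phi> * X ^ l) \<le> B" if "l \<le> n" for l
    using \<Phi>X_le[OF that] K4 by (intro small[of _ "4 * K ^ 2"]) auto
  have F: "bit_size (fact h) \<le> B" if "h \<le> K" for h
    using fact_le[OF that] K4 by (intro small[of _ "K ^ 2"]) auto
  have vl: "\<bar>v ! l\<bar> \<le> 2 ^ K" if "l < n" for l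
    using gs_nth_le[of "off i + 3 + l"] t(6)[OF that] that le by simp
  have G: "m ''G'' (int k) = gs ! k" if "k < off i + 3 + n + ?s * n" for k
    using m(3)[of k] le that by simp
  have jl: "j * n + l < ?s * n" if "j < ?s" "l < n" for j l
  proof -
    have "Suc j * n \<le> ?s * n" using that by (intro mult_right_mono) auto
    then show ?thesis using that by simp
  qed
  have vsl: "\<bar>vs ! j ! l\<bar> \<le> 2 ^ K" if "j < ?s" "l < n" for j l
    using gs_nth_le[of "off i + 3 + n + j * n + l"] t(7)[OF that] jl[OF that] le by simp
  let ?m0 = "m(''p'' := (m ''p'')(0 := p), ''q'' := (m ''q'')(0 := q), ''s'' := (m ''s'')(0 := int ?s),
    ''pos'' := (m ''pos'')(0 := int (off i + 3)))"
  have "wp K B (dot_com ''al'') (wp K B (series_com ;; emit_com) Q) (?m0, inp, out)"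
  proof (rule wp_dot[where n = n and p = "off i + 3" and \<Phi> = \<Phi> and X = X and g = "\<lambda>l. v ! l"])
    show "?m0 ''G'' (int (off i + 3) + int l) = v ! l" if "l < n" for l
      using G[of "off i + 3 + l"] t(6)[OF that] that by simp
    show "bit_size (\<Sum>j<l. v ! j * (\<Phi> * X ^ j)) \<le> B" if "l \<le> n" for l
      using ev_partial_le[OF vl that] K4 by (intro small[of _ "6 * K ^ 2"])
    fix m1
    assume fr1: "\<And>y. y \<notin> {''al'', ''pw'', ''pos'', ''l''} \<Longrightarrow> m1 y = ?m0 y"
      and "m1 ''al'' 0 = (\<Sum>j<n. v ! j * (\<Phi> * X ^ j))" and pos1: "m1 ''pos'' 0 = int (off i + 3 + n)"
    then have al: "m1 ''al'' 0 = alpha i" by (simp add: t(4) ev_def)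
    have "wp K B series_com (wp K B emit_com Q) (m1, inp, out)"
    proof (rule wp_series[where n = n and p = "off i + 3 + n" and \<Phi> = \<Phi> and X = X and bs = "betas i"
          and g = "\<lambda>j l. vs ! j ! l"])
      show "m1 ''G'' (int (off i + 3 + n + j * n + l)) = vs ! j ! l"
        if "j < length (betas i)" "l < n" for j l
        using fr1[of "''G''"] G[of "off i + 3 + n + j * n + l"] jl[of j l] t(7)[of j l] that s by simp
      show "betas i ! j = (\<Sum>l<n. vs ! j ! l * (\<Phi> * X ^ l))" if "j < length (betas i)" for j
        using that by (simp add: t(5) ev_def)
      show "bit_size (\<Sum>k<l. vs ! j ! k * (\<Phi> * X ^ k)) \<le> B" if "j < length (betas i)" "l \<le> n" for j l
        using ev_partial_le[OF vsl that(2)] that(1) s K4 by (intro small[of _ "6 * K ^ 2"]) auto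
      show "bit_size (neg_prod (take j (betas i))) \<le> B" for j
        using neg_prod_le[OF i] by (rule cube_small) simp
      show "bit_size (betas i ! j ^ h) \<le> B" if "j < length (betas i)" "h \<le> length (betas i)" for j h
        using that b(2,3) by (intro cube_small[OF power_le_cube[where e = 6]]) auto
      show "bit_size (div_partial (betas i ! j) (inv_series (take j (betas i))) k h) \<le> B"
        if "j < length (betas i)" "k < length (betas i)" "h \<le> Suc k" for j k h
        using inv_series_le(2)[OF i _ _ that] that by (intro cube_small[where e = 7]) auto
      fix m2
      assume fr2: "\<And>y. y \<notin> {''be'', ''pw'', ''pos'', ''l'', ''den'', ''j'', ''k'', ''y'', ''u'', ''e'', ''h'', ''R''} \<Longrightarrow> m2 y = m1 y"
        and R: "\<And>k. k \<le> length (betas i) \<Longrightarrow> m2 ''R'' (int k) = inv_series (betas i) k"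
        and den: "m2 ''den'' 0 = neg_prod (betas i)"
        and pos2: "m2 ''pos'' 0 = int (off i + 3 + n + length (betas i) * n)"
      have "N = numer i \<Longrightarrow> N l = p * inv_series (betas i) (?s - l) * alpha i ^ l"
        "D = denom i \<Longrightarrow> D l = q * (fact l * neg_prod (betas i))" for N D l
        by (simp_all add: numer_def denom_def t(1) s)
      then show "wp K B emit_com Q (m2, inp, out)"
      proof (intro wp_emit[where s = ?s and \<delta> = "neg_prod (betas i)" and a = "alpha i" and p = p and q = q
          and r = "inv_series (betas i)" and st = "acc i" and N = "numer i" and D = "denom i"])
        show "bit_size (alpha i ^ l) \<le> B" if "l \<le> Suc ?s" for l
          using that b(1,3) s by (intro cube_small[OF power_le_cube[where e = 6]]) auto
        show "bit_size (fact l * neg_prod (betas i)) \<le> B" if "l \<le> ?s" for l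
          using numer_denom_le(1)[OF i, of l] that s by (intro cube_small[where e = 7]) auto
        show "bit_size (fst (add_fracs (numer i) (denom i) (acc i) l)) \<le> B" if "l \<le> Suc ?s" for l
          using add_fracs_le(1)[OF i, of l] that s by simp
        show "bit_size (snd (add_fracs (numer i) (denom i) (acc i) l)) \<le> B" if "l \<le> Suc ?s" for l
          using add_fracs_le(2)[OF i, of l] that s by simp
        fix m3
        assume fr3: "\<And>y. y \<notin> {''lf'', ''ap'', ''o'', ''d'', ''RP'', ''RQ''} \<Longrightarrow> m3 y = m2 y"
          and RP: "m3 ''RP'' 0 = fst (add_fracs (numer i) (denom i) (acc i) (Suc ?s))"
          and RQ: "m3 ''RQ'' 0 = snd (add_fracs (numer i) (denom i) (acc i) (Suc ?s))"
        show "Q (m3, inp, out @ concat (map (\<lambda>l. [inv_series (betas i) (?s - l) * (fact l * neg_prod (betas i)),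
            (fact l * neg_prod (betas i)) * (fact l * neg_prod (betas i))]) [0..<Suc ?s]))"
        proof (rule Q)
          show "m3 ''i'' = m ''i''" using fr1 fr2 fr3 by simp
          show "ready (Suc i) (m3, inp, out @ concat (map (\<lambda>l. [inv_series (betas i) (?s - l) * (fact l * neg_prod (betas i)),
            (fact l * neg_prod (betas i)) * (fact l * neg_prod (betas i))]) [0..<Suc ?s]))"
            unfolding ready_def prod.case
            using fr1 fr2 fr3 m RP RQ pos2 t(2)
            by (simp add: s weights_out_def del: add_fracs.simps upt_Suc)
              (simp add: s weights_out_def del: add_fracs.simps)
        qed
      qed (use fr1 fr2 al R den m s F b(3) in simp_all)
    qed (use fr1 pos1 m s b(3) le sizes PX F in \<open>simp_all del: fact_Suc\<close>)
    then show "wp K B (series_com ;; emit_com) Q (m1, inp, out)" by simp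
  qed (use m le sizes PX in simp_all)
  moreover have "bit_size p \<le> B" "bit_size q \<le> B" "bit_size (int ?s) \<le> B" "bit_size (int (off i + 3)) \<le> B"
    using gs_small[of "off i"] gs_small[of "off i + 1"] gs_small[of "off i + 2"] t le sizes
      small_nat[of "off i + 3"] by simp_all
  moreover have "m ''G'' (int (off i)) = p" "m ''G'' (int (off i) + 1) = q" "m ''G'' (int (off i) + 2) = int ?s"
    using G[of "off i"] G[of "off i + 1"] G[of "off i + 2"] t by (simp_all add: ac_simps)
  ultimately show ?thesis using m by (simp add: summand_com_def ac_simps)
qed

theorem wp_weights:
  assumes "\<And>m. ready (length ts) (m, [], out) \<Longrightarrow> Q (m, [], out)"
    and out: "out = lambda_out n @ concat (map weights_out [0..<length ts])"
  shows "wp K B weights_com Q (\<lambda>_ _. 0, tape, [])"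
  unfolding weights_com_def wp.simps(5)
proof (rule wp_read, rule wp_lambda, assumption, goal_cases)
  case (1 m m')
  let ?m = "m'(''pos'' := (m' ''pos'')(0 := 0), ''RP'' := (m' ''RP'')(0 := 0), ''RQ'' := (m' ''RQ'')(0 := 1))"
  have "wp K B (For ''i'' (Var ''N'') summand_com) Q (?m, [], lambda_out n)"
  proof (rule wp_For[where N = "length ts" and I = "\<lambda>i (m, inp, out). inp = [] \<and> ready i (m, inp, out)"], goal_cases)
    case 1
    then show ?case using \<open>m' ''n'' 0 = _\<close> \<open>m' ''N'' 0 = _\<close> \<open>m' ''X'' 0 = _\<close> \<open>m' ''Phi'' 0 = _\<close>
        \<open>\<And>k. k < length gs \<Longrightarrow> m' ''G'' (int k) = gs ! k\<close>
      by (simp add: ready_def)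
  next
    case (2 i m inp out)
    then have r: "ready i (m, inp, out)" by auto
    show ?case
      by (rule wp_summand[OF 2(1) r]) (use 2 in \<open>simp add: ready_def\<close>)
  next
    case (3 i m inp out)
    then show ?case by (simp add: ready_def)
  next
    case (4 m inp out')
    then show ?case using assms(1)[of m] by (simp add: ready_def out)
  next
    case 5
    then show ?case using length_ts_le sizes by simp
  next
    case (6 k)
    then show ?case using length_ts_le sizes by (intro small_nat) simp
  qed
  then show ?case by simp
qed

end

section \<open>Correctness\<close>

lemma todd_inverse_append: "todd_inverse (bs @ [b]) = todd_inverse bs * inverse (todd_factor b)"
  by (simp add: todd_inverse_def)

text \<open>Comparing coefficients in f = T_b (f / T_b) and isolating the constant term 1 of T_b
  gives the recurrence of \<open>div_series\<close>. The divisors that occur are (i + 2)! with i <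
  s, and these divide b because (s + 1)! does.\<close>

lemma div_series_correct:
  assumes r: "\<And>k. k \<le> s \<Longrightarrow> of_int (r k) = fps_nth f k" and b: "fact (Suc s) dvd b" and k: "k \<le> s"
  shows "of_int (div_series b r k) = fps_nth (f * inverse (todd_factor (of_int b))) k"
  using k
proof (induction k rule: less_induct)
  case (less k)
  let ?t = "todd_factor (of_int b)"
  let ?g = "f * inverse ?t"
  have f: "f = ?t * ?g"
    using inverse_mult_eq_1[of ?t] by (simp add: mult.left_commute mult.commute)
  show ?case
  proof (cases k)
    case 0
    then show ?thesis using r[of 0] by simp
  next
    case (Suc j)
    have c: "of_int (b ^ Suc i div fact (Suc (Suc i))) = fps_nth ?t (Suc i)" if "i < Suc j" for i
    proof -
      have "fact (Suc (Suc i)) dvd (fact (Suc s) :: int)" using that less.prems Suc by (intro fact_dvd) simp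
      then have "fact (Suc (Suc i)) dvd b" using b by (rule dvd_trans)
      then have "fact (Suc (Suc i)) dvd b ^ Suc i" by (simp add: dvd_mult2 del: fact_Suc)
      then have "(of_int (b ^ Suc i div fact (Suc (Suc i))) :: rat) =
          of_int (b ^ Suc i) / of_int (fact (Suc (Suc i)))"
        by (rule of_int_div)
      then show ?thesis by (simp add: todd_factor_def del: fact_Suc)
    qed
    have "fps_nth f (Suc j) = fps_nth (?t * ?g) (Suc j)" by (rule arg_cong[OF f])
    also have "\<dots> = (\<Sum>i=0..Suc j. fps_nth ?t i * fps_nth ?g (Suc j - i))" by (rule fps_mult_nth)
    also have "\<dots> = fps_nth ?g (Suc j) + (\<Sum>i<Suc j. fps_nth ?t (Suc i) * fps_nth ?g (j - i))"
      unfolding atLeast0AtMost lessThan_Suc_atMost[symmetric]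
      by (subst sum.lessThan_Suc_shift) simp
    finally have "fps_nth ?g (Suc j) =
        fps_nth f (Suc j) - (\<Sum>i<Suc j. fps_nth ?t (Suc i) * fps_nth ?g (j - i))" by simp
    also have "(\<Sum>i<Suc j. fps_nth ?t (Suc i) * fps_nth ?g (j - i)) =
        (\<Sum>i<Suc j. of_int (b ^ Suc i div fact (Suc (Suc i))) * of_int (div_series b r (j - i)))"
      using c less Suc by (intro sum.cong refl arg_cong2[where f = "(*)"]) auto
    also have "fps_nth f (Suc j) = of_int (r (Suc j))" using r[of "Suc j"] less.prems Suc by simp
    finally show ?thesis
      unfolding Suc div_series.simps of_int_diff of_int_sum of_int_mult by (rule sym)
  qed
qed

lemma inv_series_correct:
  assumes "\<And>b. b \<in> set bs \<Longrightarrow> fact (Suc s) dvd b" "k \<le> s"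
  shows "of_int (inv_series bs k) = fps_nth (todd_inverse (map of_int bs)) k"
  using assms
proof (induction bs arbitrary: k rule: rev_induct)
  case Nil
  then show ?case by (simp add: inv_series_def todd_inverse_def)
next
  case (snoc b bs)
  have "inv_series (bs @ [b]) = div_series b (inv_series bs)" by (simp add: inv_series_def)
  then show ?case
    using div_series_correct[of s "inv_series bs" "todd_inverse (map of_int bs)" b k] snoc
    by (simp add: todd_inverse_append)
qed

lemma weight_eq:
  assumes "\<And>b. b \<in> set bs \<Longrightarrow> fact (Suc (length bs)) dvd b"
  shows "weight (map of_int bs) l =
    of_int (inv_series bs (length bs - l)) / of_int (fact l * neg_prod bs)"
proof -
  have "(of_int (neg_prod bs) :: rat) = (\<Prod>b\<leftarrow>map of_int bs. - b)"
    by (induction bs) (simp_all add: neg_prod_def)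
  then show ?thesis
    using inv_series_correct[of bs "length bs" "length bs - l"] assms by (simp add: weight_def)
qed

lemma base_sum_bound:
  fixes X :: int
  assumes "\<And>l. l < n \<Longrightarrow> \<bar>b l\<bar> < X"
  shows "\<bar>\<Sum>l<n. b l * X ^ l\<bar> < X ^ n"
  using assms
proof (induction n)
  case (Suc n)
  have X: "0 < X" using Suc.prems[of n] by simp
  have "\<bar>b n * X ^ n\<bar> \<le> (X - 1) * X ^ n"
    unfolding abs_mult using Suc.prems[of n] X by (intro mult_mono) auto
  then have "\<bar>b n * X ^ n\<bar> + X ^ n \<le> X ^ Suc n" by (simp add: algebra_simps)
  then show ?case using Suc by (simp del: power_Suc)
qed simp

text \<open>Digits may be negative, but the highest nonzero digit contributes at least its power of
  X, which exceeds the absolute value of everything below it.\<close>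

lemma base_sum_nonzero:
  fixes X :: int
  assumes "\<And>l. l < n \<Longrightarrow> \<bar>b l\<bar> < X" "\<exists>l<n. b l \<noteq> 0"
  shows "(\<Sum>l<n. b l * X ^ l) \<noteq> 0"
  using assms
proof (induction n)
  case (Suc n)
  show ?case
  proof (cases "b n = 0")
    case True
    then have "\<exists>l<n. b l \<noteq> 0" using Suc.prems(2) less_Suc_eq by auto
    then show ?thesis using Suc True by simp
  next
    case False
    have "0 < X" using Suc.prems(1)[of n] by simp
    then have "1 * X ^ n \<le> \<bar>b n\<bar> * \<bar>X ^ n\<bar>" using False by (intro mult_mono) auto
    then have "X ^ n \<le> \<bar>b n * X ^ n\<bar>" by (simp add: abs_mult)
    moreover have "\<bar>\<Sum>l<n. b l * X ^ l\<bar> < X ^ n" using Suc.prems(1) by (intro base_sum_bound) simp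
    ultimately show ?thesis by simp
  qed
qed simp

lemma add_fracs_correct:
  assumes "snd st \<noteq> 0" "\<And>l. l < k \<Longrightarrow> D l \<noteq> 0"
  shows "snd (add_fracs N D st k) \<noteq> 0 \<and>
    of_int (fst (add_fracs N D st k)) / of_int (snd (add_fracs N D st k)) =
    of_int (fst st) / of_int (snd st) + (\<Sum>l<k. of_int (N l) / (of_int (D l) :: rat))"
  using assms(2)
proof (induction k)
  case 0
  then show ?case using assms(1) by simp
next
  case (Suc k)
  obtain p q where pq: "add_fracs N D st k = (p, q)" by fastforce
  have IH: "q \<noteq> 0" "of_int p / of_int q =
      of_int (fst st) / of_int (snd st) + (\<Sum>l<k. of_int (N l) / (of_int (D l) :: rat))"
    using Suc pq by auto
  have "D k \<noteq> 0" using Suc.prems by simp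
  then have "of_int (p * D k + q * N k) / (of_int (q * D k) :: rat) =
      of_int p / of_int q + of_int (N k) / of_int (D k)"
    using IH(1) by (simp add: field_simps)
  then show ?case using IH pq \<open>D k \<noteq> 0\<close> by simp
qed

section \<open>Rational output\<close>

lemma codes_rats_append:
  "codes_rats rs ys \<Longrightarrow> codes_rats rs' ys' \<Longrightarrow> codes_rats (rs @ rs') (ys @ ys')"
  unfolding codes_rats_def
proof (elim exE conjE, goal_cases)
  case (1 ps ps')
  then show ?case by (intro exI[of _ "ps @ ps'"]) auto
qed

lemma codes_rats_Nil: "codes_rats [] []"
  unfolding codes_rats_def by (intro exI[of _ "[]"]) simp

lemma codes_rats_concat:
  "(\<And>x. x \<in> set xs \<Longrightarrow> codes_rats (f x) (g x)) \<Longrightarrow>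
    codes_rats (concat (map f xs)) (concat (map g xs))"
  by (induction xs) (auto intro: codes_rats_append codes_rats_Nil)

lemma codes_rats_map:
  assumes "\<And>x. x \<in> set xs \<Longrightarrow> q x > 0" "\<And>x. x \<in> set xs \<Longrightarrow> f x = of_int (p x) / of_int (q x)"
  shows "codes_rats (map f xs) (concat (map (\<lambda>x. [p x, q x]) xs))"
  unfolding codes_rats_def using assms
  by (intro exI[of _ "map (\<lambda>x. (p x, q x)) xs"]) (auto simp: comp_def)

section \<open>Instances given by rational generating functions\<close>

definition raw_terms :: "gf_data \<Rightarrow> summand list" where
  "raw_terms D = map (\<lambda>(\<epsilon>, a, bs). (fst (quotient_of \<epsilon>), snd (quotient_of \<epsilon>),
     map (enc_vec (gf_dim D)) (a # bs))) (gf_terms D)"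

locale gf_instance =
  fixes D :: gf_data
  assumes valid: "valid_gf D"
begin

abbreviation "n \<equiv> gf_dim D"

lemma den_ne:
  assumes "(\<epsilon>, a, bs) \<in> set (gf_terms D)" "b \<in> set bs"
  shows "b \<in> vecs n" "b \<noteq> 0"
proof -
  obtain i where i: "i < length (gf_terms D)" "gf_terms D ! i = (\<epsilon>, a, bs)"
    using assms(1) by (auto simp: in_set_conv_nth)
  obtain j where j: "j < length bs" "b = bs ! j" using assms(2) by (auto simp: in_set_conv_nth)
  have "gf_den D i j \<in> vecs n \<and> gf_den D i j \<noteq> 0"
    using valid i j unfolding valid_gf_def by (simp add: gf_index_def gf_len_def)
  then show "b \<in> vecs n" "b \<noteq> 0" using i j by (auto simp: gf_den_def)
qed

sublocale raw_instance n "raw_terms D"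
proof
  fix p q vs
  assume "(p, q, vs) \<in> set (raw_terms D)"
  then obtain \<epsilon> a bs where t: "(\<epsilon>, a, bs) \<in> set (gf_terms D)" "vs = map (enc_vec n) (a # bs)"
    by (auto simp: raw_terms_def)
  show "vs \<noteq> []" using t by simp
  show "length v = n" if "v \<in> set vs" for v using t that by (auto simp: enc_vec_def)
  show "length vs = 1" if "n = 0"
  proof -
    \<comment> \<open>In dimension 0 the only vector is 0, which validity excludes as a denominator
      exponent.\<close>
    have "bs = []"
    proof (rule ccontr)
      assume "bs \<noteq> []"
      then have "hd bs \<in> vecs n" "hd bs \<noteq> 0" using den_ne[OF t(1), of "hd bs"] by auto
      then show False using that by (auto simp: vecs_def)
    qed
    then show ?thesis using t by simp
  qed
qed

lemma tape_eq: "tape = enc_gf D"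
  unfolding tape_def gs_def
  by (auto simp: enc_gf_def raw_terms_def enc_summand_def comp_def
      intro!: arg_cong[where f = concat] map_cong)

definition lam :: "nat \<Rightarrow>\<^sub>0 rat" where
  "lam = (\<Sum>l<n. Poly_Mapping.single l (of_int (\<Phi> * X ^ l)))"

lemma lookup_lam: "Poly_Mapping.lookup lam l = (if l < n then of_int (\<Phi> * X ^ l) else 0)"
  by (simp add: lam_def lookup_sum lookup_single when_def)

lemma lam_vecs: "lam \<in> vecs n"
  by (simp add: in_vecs_iff lookup_lam)

lemma dot_lam: "dot n lam a = of_int (ev (enc_vec n a))"
  by (simp add: dot_def ev_def enc_vec_def lookup_lam mult.commute)

lemma nth_raw: "i < length (gf_terms D) \<Longrightarrow> raw_terms D ! i =
  (fst (quotient_of (gf_coeff D i)), snd (quotient_of (gf_coeff D i)),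
   map (enc_vec n) (gf_num D i # snd (snd (gf_terms D ! i))))"
  by (simp add: raw_terms_def gf_coeff_def gf_num_def split: prod.splits)

lemma length_raw [simp]: "length (raw_terms D) = length (gf_terms D)"
  by (simp add: raw_terms_def)

lemma index_iff: "i \<in> gf_index D \<longleftrightarrow> i < length (gf_terms D)"
  by (simp add: gf_index_def)

lemma alpha_eq: "i \<in> gf_index D \<Longrightarrow> of_int (alpha i) = dot n lam (gf_num D i)"
  by (simp add: alpha_def nth_raw index_iff dot_lam)

lemma betas_eq: "i \<in> gf_index D \<Longrightarrow> betas i = map (\<lambda>b. ev (enc_vec n b)) (snd (snd (gf_terms D ! i)))"
  by (simp add: betas_def nth_raw index_iff comp_def)

lemma length_betas: "i \<in> gf_index D \<Longrightarrow> length (betas i) = gf_len D i"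
  by (simp add: betas_eq gf_len_def)

lemma map_betas: "i \<in> gf_index D \<Longrightarrow> map of_int (betas i) = map (dot n lam) (snd (snd (gf_terms D ! i)))"
  by (simp add: betas_eq dot_lam)

text \<open>An integer satisfies |x| \<le> x^2, and x^2 is one of the terms of X - 1.\<close>

lemma abs_lt_X: "x \<in> set gs \<Longrightarrow> \<bar>x\<bar> < X"
proof -
  assume "x \<in> set gs"
  then obtain k where k: "k < length gs" "x = gs ! k" by (auto simp: in_set_conv_nth)
  have "x * x \<le> (\<Sum>k<length gs. gs ! k * gs ! k)"
    unfolding k(2) using k(1) by (intro member_le_sum[where f = "\<lambda>k. gs ! k * gs ! k"]) auto
  moreover have "\<bar>x\<bar> * 1 \<le> \<bar>x\<bar> * \<bar>x\<bar>"
    by (cases "x = 0") (simp, intro mult_left_mono, auto)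
  then have "\<bar>x\<bar> \<le> x * x" by simp
  ultimately show ?thesis by (simp add: X_def)
qed

lemma beta_nonzero: "i \<in> gf_index D \<Longrightarrow> b \<in> set (betas i) \<Longrightarrow> b \<noteq> 0"
proof -
  assume i: "i \<in> gf_index D" and "b \<in> set (betas i)"
  obtain \<epsilon> a bs where t: "gf_terms D ! i = (\<epsilon>, a, bs)" by (cases "gf_terms D ! i")
  then obtain c where c: "c \<in> set bs" "b = ev (enc_vec n c)"
    using \<open>b \<in> set (betas i)\<close> by (auto simp: betas_eq[OF i])
  have mem: "(\<epsilon>, a, bs) \<in> set (gf_terms D)" using i t by (metis index_iff nth_mem)
  have "\<bar>Poly_Mapping.lookup c l\<bar> < X" if "l < n" for l
  proof (rule abs_lt_X)
    let ?t = "(fst (quotient_of \<epsilon>), snd (quotient_of \<epsilon>), map (enc_vec n) (a # bs))"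
    have "?t \<in> set (raw_terms D)"
      using mem by (auto simp: raw_terms_def intro!: image_eqI[where x = "(\<epsilon>, a, bs)"])
    moreover have "Poly_Mapping.lookup c l \<in> set (enc_vec n c)"
      using that by (simp add: enc_vec_def)
    then have "Poly_Mapping.lookup c l \<in> set (enc_summand ?t)"
      using c(1) by (auto simp: enc_summand_def)
    ultimately show "Poly_Mapping.lookup c l \<in> set gs"
      unfolding gs_def set_concat set_map by blast
  qed
  moreover have "\<exists>l<n. Poly_Mapping.lookup c l \<noteq> 0"
  proof (rule ccontr)
    assume "\<not> ?thesis"
    then have "Poly_Mapping.lookup c l = 0" for l
      using den_ne(1)[OF mem c(1)] by (cases "l < n") (auto simp: in_vecs_iff)
    then have "c = 0" by (intro poly_mapping_eqI) simp
    then show False using den_ne(2)[OF mem c(1)] by simp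
  qed
  ultimately have "(\<Sum>l<n. Poly_Mapping.lookup c l * X ^ l) \<noteq> 0" by (rule base_sum_nonzero)
  moreover have "b = \<Phi> * (\<Sum>l<n. Poly_Mapping.lookup c l * X ^ l)"
    by (simp add: c(2) ev_def enc_vec_def sum_distrib_left ac_simps)
  ultimately show "b \<noteq> 0" using \<Phi>_pos by simp
qed

text \<open>\<Phi> is the factorial of the number of entries of \<open>gs\<close>, and a summand
  with s denominators alone accounts for at least s + 3 of them.\<close>

lemma fact_dvd_beta:
  assumes "i \<in> gf_index D" "b \<in> set (betas i)"
  shows "fact (Suc (length (betas i))) dvd b"
proof -
  have i: "i < length (raw_terms D)" using assms(1) by (simp add: index_iff)
  obtain vs :: "int list list" where
    t: "off (Suc i) = off i + 3 + n + length vs * n" "Suc (length vs) + 2 \<le> 3 + n + length vs * n"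
      "betas i = map ev vs"
    by (rule summand_cases[OF i]) blast
  have "Suc (length (betas i)) \<le> length gs" using t off_le[of "Suc i"] by simp
  then have "fact (Suc (length (betas i))) dvd \<Phi>" unfolding \<Phi>_def by (rule fact_dvd)
  moreover have "\<Phi> dvd b"
    using assms(2) t(3) by (auto simp: ev_def intro!: dvd_sum dvd_mult[OF dvd_triv_left])
  ultimately show ?thesis by (rule dvd_trans)
qed

definition wt :: "nat \<Rightarrow> nat \<Rightarrow> rat" where
  "wt i l = weight (map (dot n lam) (snd (snd (gf_terms D ! i)))) l"

lemma wt_eq:
  assumes "i \<in> gf_index D"
  shows "wt i l = of_int (inv_series (betas i) (length (betas i) - l)) / of_int (fact l * neg_prod (betas i))"
  unfolding wt_def map_betas[OF assms, symmetric]
  by (rule weight_eq) (rule fact_dvd_beta[OF assms])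

lemma neg_prod_ne: "i \<in> gf_index D \<Longrightarrow> neg_prod (betas i) \<noteq> 0"
  using beta_nonzero[of i] by (auto simp: neg_prod_def prod_list_zero_iff)

lemma dot_den_ne:
  assumes "i \<in> gf_index D" "j < gf_len D i"
  shows "dot n lam (gf_den D i j) \<noteq> 0"
proof -
  have "ev (enc_vec n (gf_den D i j)) \<in> set (betas i)"
    using assms by (auto simp: betas_eq gf_den_def gf_len_def)
  then show ?thesis using beta_nonzero[OF assms(1)] by (simp add: dot_lam)
qed

text \<open>\<open>lam\<close> and \<open>wt\<close> come from the data alone, so \<open>a\<close>
  remains free: the same weights serve for \<open>gf_num D\<close> and for the shifted exponents of
  the dilations.\<close>

lemma specialization:
  "specializes_to (rat_fun D a) r \<Longrightarrow>
    r = (\<Sum>i\<in>gf_index D. gf_coeff D i * (\<Sum>l=0..gf_len D i. wt i l * dot n lam (a i) ^ l))"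
  unfolding wt_def by (rule specializes_rat_fun[OF _ dot_den_ne])

lemma acc_correct:
  "k \<le> length (gf_terms D) \<Longrightarrow> snd (acc k) \<noteq> 0 \<and> of_int (fst (acc k)) / of_int (snd (acc k)) =
    (\<Sum>i<k. gf_coeff D i * (\<Sum>l=0..gf_len D i. wt i l * dot n lam (gf_num D i) ^ l))"
proof (induction k)
  case (Suc k)
  then have k: "k \<in> gf_index D" by (simp add: index_iff)
  let ?q = "quotient_of (gf_coeff D k)"
  have q: "snd ?q > 0" "gf_coeff D k = of_int (fst ?q) / of_int (snd ?q)"
    by (rule quotient_of_denom_pos') (simp add: quotient_of_div)
  have t: "raw_terms D ! k = (fst ?q, snd ?q, map (enc_vec n) (gf_num D k # snd (snd (gf_terms D ! k))))"
    using k nth_raw by (simp add: index_iff)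
  have den: "denom k l \<noteq> 0" for l
    using q(1) neg_prod_ne[OF k] by (simp add: denom_def t)
  have "of_int (numer k l) / of_int (denom k l) = gf_coeff D k * (wt k l * dot n lam (gf_num D k) ^ l)" for l
    by (subst q(2)) (simp add: numer_def denom_def t wt_eq[OF k] alpha_eq[OF k])
  then have "(\<Sum>l<Suc (length (betas k)). of_int (numer k l) / of_int (denom k l)) =
      gf_coeff D k * (\<Sum>l=0..gf_len D k. wt k l * dot n lam (gf_num D k) ^ l)"
    unfolding length_betas[OF k] by (simp only: sum_distrib_left lessThan_Suc_atMost atLeast0AtMost)
  then show ?case
    using add_fracs_correct[of "acc k" "Suc (length (betas k))" "denom k" "numer k"] den Suc
    by (simp del: add_fracs.simps sum.lessThan_Suc add: sum.lessThan_Suc[of _ k])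
qed simp

lemma codes_weights:
  "codes_rats (enc_vec n lam @ concat (map (\<lambda>i. map (wt i) [0..<Suc (gf_len D i)]) [0..<length (gf_terms D)]))
     (lambda_out n @ concat (map weights_out [0..<length (gf_terms D)]))"
proof (rule codes_rats_append)
  show "codes_rats (enc_vec n lam) (lambda_out n)"
    unfolding enc_vec_def lambda_out_def by (rule codes_rats_map) (auto simp: lookup_lam)
  have "codes_rats (map (wt i) [0..<Suc (gf_len D i)]) (weights_out i)" if i: "i \<in> gf_index D" for i
    unfolding weights_out_def length_betas[OF i]
  proof (rule codes_rats_map)
    fix l
    have "fact l * neg_prod (betas i) \<noteq> 0" using neg_prod_ne[OF i] by simp
    then show "0 < (fact l * neg_prod (betas i)) * (fact l * neg_prod (betas i))"
      by (metis not_square_less_zero linorder_neqE_linordered_idom mult_eq_0_iff)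
    show "wt i l = of_int (inv_series (betas i) (gf_len D i - l) * (fact l * neg_prod (betas i))) /
        of_int ((fact l * neg_prod (betas i)) * (fact l * neg_prod (betas i)))"
      using neg_prod_ne[OF i] by (simp add: wt_eq[OF i] length_betas[OF i])
  qed
  then show "codes_rats (concat (map (\<lambda>i. map (wt i) [0..<Suc (gf_len D i)]) [0..<length (gf_terms D)]))
     (concat (map weights_out [0..<length (gf_terms D)]))"
    by (intro codes_rats_concat) (auto simp: index_iff)
qed

lemma weights_com_exec:
  "\<exists>t m. exec weights_com (\<lambda>_ _. 0, enc_gf D, []) t
      (m, [], lambda_out n @ concat (map weights_out [0..<length (gf_terms D)])) \<and>
     t \<le> poly (time_bound weights_com) K * B \<and> mem_bounded B m \<and>
     m ''RP'' 0 = fst (acc (length (gf_terms D))) \<and> m ''RQ'' 0 = snd (acc (length (gf_terms D)))"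
proof -
  let ?out = "lambda_out n @ concat (map weights_out [0..<length (raw_terms D)])"
  let ?Q = "\<lambda>(m, inp, out). inp = [] \<and> out = ?out \<and> ready (length (raw_terms D)) (m, [], ?out)"
  have wp: "wp K B weights_com ?Q (\<lambda>_ _. 0, tape, [])"
    by (rule wp_weights) auto
  have "mem_bounded B (fst (\<lambda>_ _. 0, tape, []))"
    by (simp add: mem_bounded_def)
  from wp_sound[OF wp this] obtain t s where "exec weights_com (\<lambda>_ _. 0, tape, []) t s"
    "t \<le> poly (time_bound weights_com) K * B" "?Q s" "mem_bounded B (fst s)"
    by blast
  then show ?thesis
    unfolding tape_eq by (cases s) (auto simp: ready_def)
qed

end

section \<open>The Ehrhart polynomial\<close>

lemma sum_powers_expand:
  fixes A V :: "'i \<Rightarrow> 'a :: comm_ring_1"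
  assumes "\<And>i. i \<in> I \<Longrightarrow> s i \<le> S"
  shows "(\<Sum>i\<in>I. c i * (\<Sum>l=0..s i. w i l * (A i + x * V i) ^ l)) =
    (\<Sum>m\<le>S. (\<Sum>i\<in>I. c i * V i ^ m * (\<Sum>l=m..s i. of_nat (l choose m) * w i l * A i ^ (l - m))) * x ^ m)"
proof -
  have inner: "(\<Sum>l=0..s i. w i l * (A i + x * V i) ^ l) =
      (\<Sum>m\<le>S. V i ^ m * (\<Sum>l=m..s i. of_nat (l choose m) * w i l * A i ^ (l - m)) * x ^ m)"
    if i: "i \<in> I" for i
  proof -
    let ?f = "\<lambda>l m. V i ^ m * (of_nat (l choose m) * w i l * A i ^ (l - m)) * x ^ m"
    \<comment> \<open>The binomial sum is padded with zeros up to \<open>S\<close>, which makes the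
      range of \<open>m\<close> independent of \<open>l\<close> and \<open>i\<close>, so that the
      sums can be exchanged.\<close>
    have "w i l * (A i + x * V i) ^ l = (\<Sum>m\<le>S. if m \<le> l then ?f l m else 0)" if l: "l \<le> s i" for l
    proof -
      have "(A i + x * V i) ^ l = (x * V i + A i) ^ l" by (simp add: add.commute)
      also have "\<dots> = (\<Sum>m\<le>l. of_nat (l choose m) * (x * V i) ^ m * A i ^ (l - m))"
        by (rule binomial_ring)
      finally have "w i l * (A i + x * V i) ^ l = (\<Sum>m\<le>l. ?f l m)"
        by (simp add: sum_distrib_left power_mult_distrib mult_ac)
      also have "\<dots> = (\<Sum>m\<le>S. if m \<le> l then ?f l m else 0)"
        using l assms[OF i] by (intro sum.mono_neutral_cong_left) auto
      finally show ?thesis .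
    qed
    then have "(\<Sum>l=0..s i. w i l * (A i + x * V i) ^ l) =
        (\<Sum>l=0..s i. \<Sum>m\<le>S. if m \<le> l then ?f l m else 0)"
      by (intro sum.cong) auto
    also have "\<dots> = (\<Sum>m\<le>S. \<Sum>l=0..s i. if m \<le> l then ?f l m else 0)" by (rule sum.swap)
    also have "\<dots> = (\<Sum>m\<le>S. \<Sum>l=m..s i. ?f l m)"
      by (intro sum.cong refl sum.mono_neutral_cong_right) auto
    also have "\<dots> = (\<Sum>m\<le>S. V i ^ m * (\<Sum>l=m..s i. of_nat (l choose m) * w i l * A i ^ (l - m)) * x ^ m)"
      by (simp add: sum_distrib_left sum_distrib_right)
    finally show ?thesis .
  qed
  have "(\<Sum>i\<in>I. c i * (\<Sum>l=0..s i. w i l * (A i + x * V i) ^ l)) =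
      (\<Sum>i\<in>I. \<Sum>m\<le>S. c i * V i ^ m * (\<Sum>l=m..s i. of_nat (l choose m) * w i l * A i ^ (l - m)) * x ^ m)"
    by (rule sum.cong[OF refl], subst inner, assumption, subst sum_distrib_left)
      (simp only: mult.assoc)
  also have "\<dots> = (\<Sum>m\<le>S. \<Sum>i\<in>I. c i * V i ^ m * (\<Sum>l=m..s i. of_nat (l choose m) * w i l * A i ^ (l - m)) * x ^ m)"
    by (rule sum.swap)
  finally show ?thesis by (simp add: sum_distrib_right)
qed

text \<open>The polynomial agrees at all positive integers with a count of order k^d for the
  dimension d, so its coefficients above d vanish.\<close>

lemma truncate_at_affine_dim:
  fixes c :: "nat \<Rightarrow> rat"
  assumes P: "polytope_in n P"
    and count: "\<And>k. k \<ge> 1 \<Longrightarrow> of_nat (card (lattice_points (dilate k P))) = (\<Sum>m\<le>S. c m * of_nat k ^ m)"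
    and k: "k \<ge> 1"
  shows "of_nat (card (lattice_points (dilate k P))) =
    (\<Sum>m | int m \<le> min (int S) (affine_dim P). c m * of_nat k ^ m)"
proof (cases "P = {}")
  case True
  \<comment> \<open>The dimension -1 of the empty set leaves no index, in accordance with a count of
    0.\<close>
  then have "{m. int m \<le> min (int S) (affine_dim P)} = {}" by (auto simp: affine_dim_def)
  moreover have "card (lattice_points (dilate k P)) = 0"
    using True by (simp add: lattice_points_def dilate_def)
  ultimately show ?thesis by (simp only: sum.empty of_nat_0)
next
  case False
  then obtain d where d: "affine_dim P = int d" by (simp add: affine_dim_def)
  obtain C where C: "\<And>k. k \<ge> 1 \<Longrightarrow> card (lattice_points (dilate k P)) \<le> C * k ^ d"
    using card_lattice_points_dilate_le[OF P d] by blast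
  define p where "p = (\<Sum>m\<le>S. monom (c m) m)"
  have poly: "poly p x = (\<Sum>m\<le>S. c m * x ^ m)" for x
    by (simp add: p_def poly_sum poly_monom)
  have "degree p \<le> d"
  proof (rule poly_bounded_degree[where C = "of_nat C"])
    fix k :: nat assume k: "k \<ge> 1"
    have "poly p (of_nat k) = of_nat (card (lattice_points (dilate k P)))"
      using count[OF k] by (simp add: poly)
    moreover have "(of_nat (card (lattice_points (dilate k P))) :: rat) \<le> of_nat (C * k ^ d)"
      using C[OF k] by (simp only: of_nat_le_iff)
    ultimately show "\<bar>poly p (of_nat k)\<bar> \<le> of_nat C * of_nat k ^ d" by simp
  qed
  moreover have "coeff p m = c m" if "m \<le> S" for m
    using that by (simp add: p_def coeff_sum)
  ultimately have zero: "c m = 0" if "m \<le> S" "d < m" for m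
    using that coeff_eq_0[of p m] by simp
  have "of_nat (card (lattice_points (dilate k P))) = (\<Sum>m\<le>S. c m * of_nat k ^ m)" by (rule count[OF k])
  also have "\<dots> = (\<Sum>m | int m \<le> min (int S) (affine_dim P). c m * of_nat k ^ m)"
    using zero by (intro sum.mono_neutral_right) (auto simp: d)
  finally show ?thesis .
qed

text \<open>The final fraction RP / RQ is written as RP RQ / RQ^2 to make its denominator
  positive.\<close>

definition value_com :: com where
  "value_com = (strip_writes weights_com ;;
     Write (Op Mul (Var ''RP'') (Var ''RQ'')) ;; Write (Op Mul (Var ''RQ'') (Var ''RQ'')))"

text \<open>Composition with x + 2 turns the tape size into \<open>K\<close>, and the monomial
  becomes the bit bound \<open>B\<close>.\<close>

definition run_time :: "com \<Rightarrow> nat poly" where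
  "run_time c = pcompose (time_bound c * monom 16 4) [:2, 1:]"

context gf_instance
begin

lemma poly_run_time: "poly (run_time c) (tape_size (enc_gf D)) = poly (time_bound c) K * B"
  by (simp add: run_time_def poly_pcompose poly_monom K_def B_def tape_eq add.commute)

lemma specialize_gen_fun:
  assumes "rat_fun D a = to_fract (gen_fun P)"
  shows "of_nat (card (lattice_points P)) =
    (\<Sum>i\<in>gf_index D. gf_coeff D i * (\<Sum>l=0..gf_len D i. wt i l * dot n lam (a i) ^ l))"
  using specializes_gen_fun[of P] unfolding assms[symmetric] by (rule specialization)

text \<open>Regrouping a + (k - 1) v as (a - v) + k v isolates k, so that the binomial theorem
  yields a polynomial in k.\<close>

lemma dot_shift: "dot n lam (a + frag_cmul (int k - 1) v) = dot n lam (a - v) + of_nat k * dot n lam v"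
  by (simp add: dot_def lookup_add lookup_minus algebra_simps sum.distrib sum_subtractf sum_distrib_left)

lemma ehrhart:
  assumes P: "integral_polytope_in n P"
    and gf: "\<And>k. k \<ge> 1 \<Longrightarrow> rat_fun D (\<lambda>i. gf_num D i + frag_cmul (int k - 1) (v i)) =
      to_fract (gen_fun (dilate k P))"
    and k: "k \<ge> 1"
  shows "of_nat (card (lattice_points (dilate k P))) =
    (\<Sum>m | int m \<le> min (int (Max (gf_len D ` gf_index D))) (affine_dim P).
       (\<Sum>i\<in>gf_index D. gf_coeff D i * dot n lam (v i) ^ m *
          (\<Sum>l=m..gf_len D i. of_nat (l choose m) * wt i l * dot n lam (gf_num D i - v i) ^ (l - m))) *
       of_nat k ^ m)"
proof (rule truncate_at_affine_dim[OF _ _ k])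
  show "polytope_in n P" using P by (simp add: integral_polytope_in_def)
  fix k :: nat assume k: "k \<ge> 1"
  have "of_nat (card (lattice_points (dilate k P))) =
    (\<Sum>i\<in>gf_index D. gf_coeff D i * (\<Sum>l=0..gf_len D i. wt i l *
       (dot n lam (gf_num D i - v i) + of_nat k * dot n lam (v i)) ^ l))"
    using specialize_gen_fun[OF gf[OF k]] by (simp only: dot_shift)
  also have "\<dots> = (\<Sum>m\<le>Max (gf_len D ` gf_index D).
       (\<Sum>i\<in>gf_index D. gf_coeff D i * dot n lam (v i) ^ m *
          (\<Sum>l=m..gf_len D i. of_nat (l choose m) * wt i l * dot n lam (gf_num D i - v i) ^ (l - m))) *
       of_nat k ^ m)"
    \<comment> \<open>Without summands \<open>Max\<close> is taken of the empty set and unspecified;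
      then the premise is vacuous and every sum over \<open>i\<close> is empty.\<close>
    by (rule sum_powers_expand) (simp add: gf_index_def)
  finally show "of_nat (card (lattice_points (dilate k P))) = \<dots>" .
qed

text \<open>The time bound is that of \<open>weights_com\<close> followed by the two final writes,
  since removing the other writes only saves time.\<close>

lemma value_com_correct:
  assumes r: "specializes_to (rat_fun D (gf_num D)) r"
  shows "\<exists>t ys. computes value_com (enc_gf D) t ys \<and>
    t \<le> poly (run_time (weights_com ;; Write (Op Mul (Var ''RP'') (Var ''RQ'')) ;;
      Write (Op Mul (Var ''RQ'') (Var ''RQ'')))) (tape_size (enc_gf D)) \<and> codes_rats [r] ys"
proof -
  let ?W = "Write (Op Mul (Var ''RP'') (Var ''RQ'')) ;; Write (Op Mul (Var ''RQ'') (Var ''RQ''))"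
  let ?a = "acc (length (gf_terms D))"
  obtain t1 m out where 1: "exec weights_com (\<lambda>_ _. 0, enc_gf D, []) t1 (m, [], out)"
    "t1 \<le> poly (time_bound weights_com) K * B" "mem_bounded B m"
    "m ''RP'' 0 = fst ?a" "m ''RQ'' 0 = snd ?a"
    using weights_com_exec by blast
  from exec_strip_writes[OF 1(1), of "[]"] obtain t2 where
    2: "t2 \<le> t1" "exec (strip_writes weights_com) (\<lambda>_ _. 0, enc_gf D, []) t2 (m, [], [])"
    by auto
  let ?ys = "[fst ?a * snd ?a, snd ?a * snd ?a]"
  have "wp K B ?W (\<lambda>s. s = (m, [], ?ys)) (m, [], [])" using 1(4,5) by simp
  from wp_sound[OF this] obtain t3 where
    3: "exec ?W (m, [], []) t3 (m, [], ?ys)" "t3 \<le> poly (time_bound ?W) K * B"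
    using 1(3) by auto
  have "computes value_com (enc_gf D) (1 + t2 + t3) ?ys"
    unfolding computes_def value_com_def using exec.Seq[OF 2(2) 3(1)] by blast
  moreover have "1 \<le> B" using mem_bounded_pos[OF 1(3)] .
  then have "1 + t2 + t3 \<le> poly (run_time (weights_com ;; ?W)) (tape_size (enc_gf D))"
    unfolding poly_run_time using 1(2) 2(1) 3(2)
    by (simp only: time_bound.simps(5)[of weights_com] poly_add poly_1 distrib_right)
  moreover have "codes_rats [r] ?ys"
  proof -
    have a: "snd ?a \<noteq> 0" "of_int (fst ?a) / of_int (snd ?a) = r"
      using acc_correct[of "length (gf_terms D)"] specialization[OF r] by (simp_all add: gf_index_def)
    have "r = of_int (fst ?a * snd ?a) / of_int (snd ?a * snd ?a)" using a by simp
    moreover have "snd ?a * snd ?a > 0" using a(1) by (simp add: zero_less_mult_iff) linarith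
    ultimately show ?thesis
      using codes_rats_map[of "[()]" "\<lambda>_. snd ?a * snd ?a" "\<lambda>_. r" "\<lambda>_. fst ?a * snd ?a"] by simp
  qed
  ultimately show ?thesis by blast
qed

end

theorem theorem2p22:
  shows
    "(\<exists>c. polytime_algorithm c enc_gf
        (\<lambda>D. valid_gf D \<and> (\<exists>r. specializes_to (rat_fun D (gf_num D)) r))
        (\<lambda>D ys. \<exists>r. specializes_to (rat_fun D (gf_num D)) r \<and> codes_rats [r] ys)) \<and>
     (\<exists>c. polytime_algorithm c enc_gf
        (\<lambda>D. valid_gf D \<and> (\<exists>P. polytope_in (gf_dim D) P \<and> represents D P))
        (\<lambda>D ys. \<exists>(lam :: nat \<Rightarrow>\<^sub>0 rat) (w :: rat list list).
           codes_rats (enc_vec (gf_dim D) lam @ concat w) ys \<and>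
           lam \<in> vecs (gf_dim D) \<and>
           (\<forall>i\<in>gf_index D. \<forall>j<gf_len D i. dot (gf_dim D) lam (gf_den D i j) \<noteq> 0) \<and>
           length w = length (gf_terms D) \<and>
           (\<forall>i\<in>gf_index D. length (w ! i) = gf_len D i + 1) \<and>
           (\<forall>P. polytope_in (gf_dim D) P \<and> represents D P \<longrightarrow>
              of_nat (card (lattice_points P)) =
                (\<Sum>i\<in>gf_index D. gf_coeff D i *
                   (\<Sum>l=0..gf_len D i. w ! i ! l * dot (gf_dim D) lam (gf_num D i) ^ l))) \<and>
           (\<forall>P v. integral_polytope_in (gf_dim D) P \<and>
              (\<forall>i\<in>gf_index D. v i \<in> vecs (gf_dim D)) \<and>
              (\<forall>k\<ge>1. rat_fun D (\<lambda>i. gf_num D i + frag_cmul (int k - 1) (v i)) =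
                        to_fract (gen_fun (dilate k P))) \<longrightarrow>
              (\<forall>k\<ge>1. of_nat (card (lattice_points (dilate k P))) =
                (\<Sum>m | int m \<le> min (int (Max (gf_len D ` gf_index D))) (affine_dim P).
                   (\<Sum>i\<in>gf_index D. gf_coeff D i * dot (gf_dim D) lam (v i) ^ m *
                      (\<Sum>l=m..gf_len D i. of_nat (l choose m) * w ! i ! l *
                         dot (gf_dim D) lam (gf_num D i - v i) ^ (l - m))) *
                   of_nat k ^ m)))))"
  (is "(\<exists>c. ?A c) \<and> (\<exists>c. polytime_algorithm c enc_gf ?promise ?correct)")
proof
  let ?T = "run_time (weights_com ;; Write (Op Mul (Var ''RP'') (Var ''RQ'')) ;;
    Write (Op Mul (Var ''RQ'') (Var ''RQ'')))"
  have "?A value_com"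
    unfolding polytime_algorithm_def
  proof (intro exI[of _ ?T] allI impI)
    fix D
    assume "valid_gf D \<and> (\<exists>r. specializes_to (rat_fun D (gf_num D)) r)"
    then obtain r where "gf_instance D" and r: "specializes_to (rat_fun D (gf_num D)) r"
      by (auto intro: gf_instance.intro)
    from gf_instance.value_com_correct[OF this] r
    show "\<exists>t ys. computes value_com (enc_gf D) t ys \<and> t \<le> poly ?T (tape_size (enc_gf D)) \<and>
        (\<exists>r. specializes_to (rat_fun D (gf_num D)) r \<and> codes_rats [r] ys)"
      by blast
  qed
  then show "\<exists>c. ?A c" by blast
next
  have "polytime_algorithm weights_com enc_gf ?promise ?correct"
    unfolding polytime_algorithm_def
  proof (intro exI[of _ "run_time weights_com"] allI impI)
    fix D
    assume "?promise D"
    then interpret gf_instance D by unfold_locales simp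
    let ?ys = "lambda_out n @ concat (map weights_out [0..<length (gf_terms D)])"
    let ?w = "map (\<lambda>i. map (wt i) [0..<Suc (gf_len D i)]) [0..<length (gf_terms D)]"
    obtain t m where "exec weights_com (\<lambda>_ _. 0, enc_gf D, []) t (m, [], ?ys)"
      "t \<le> poly (time_bound weights_com) K * B"
      using weights_com_exec by blast
    then have run: "computes weights_com (enc_gf D) t ?ys"
      "t \<le> poly (run_time weights_com) (tape_size (enc_gf D))"
      unfolding computes_def poly_run_time by blast+
    have w: "?w ! i ! l = wt i l" if "i \<in> gf_index D" "l \<le> gf_len D i" for i l
      using that by (simp add: gf_index_def del: upt_Suc)
    have "?correct D ?ys"
    proof (intro exI[of _ lam] exI[of _ ?w] conjI ballI allI impI)
      show "codes_rats (enc_vec n lam @ concat ?w) ?ys" by (rule codes_weights)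
      show "lam \<in> vecs n" by (rule lam_vecs)
      show "dot n lam (gf_den D i j) \<noteq> 0" if "i \<in> gf_index D" "j < gf_len D i" for i j
        using that by (rule dot_den_ne)
      show "length ?w = length (gf_terms D)" by simp
      show "length (?w ! i) = gf_len D i + 1" if "i \<in> gf_index D" for i
        using that by (simp add: gf_index_def del: upt_Suc)
      show "of_nat (card (lattice_points P)) = (\<Sum>i\<in>gf_index D. gf_coeff D i *
          (\<Sum>l=0..gf_len D i. ?w ! i ! l * dot n lam (gf_num D i) ^ l))"
        if "polytope_in n P \<and> represents D P" for P
        using specialize_gen_fun[of "gf_num D" P] that by (simp add: represents_def w del: upt_Suc cong: sum.cong_simp)
      show "of_nat (card (lattice_points (dilate k P))) =
          (\<Sum>m | int m \<le> min (int (Max (gf_len D ` gf_index D))) (affine_dim P).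
             (\<Sum>i\<in>gf_index D. gf_coeff D i * dot n lam (v i) ^ m *
                (\<Sum>l=m..gf_len D i. of_nat (l choose m) * ?w ! i ! l *
                   dot n lam (gf_num D i - v i) ^ (l - m))) * of_nat k ^ m)"
        if "integral_polytope_in n P \<and> (\<forall>i\<in>gf_index D. v i \<in> vecs n) \<and>
            (\<forall>k\<ge>1. rat_fun D (\<lambda>i. gf_num D i + frag_cmul (int k - 1) (v i)) =
              to_fract (gen_fun (dilate k P)))" "1 \<le> k" for P v k
        using ehrhart[of P v k] that by (simp add: w del: upt_Suc cong: sum.cong_simp)
    qed
    with run show "\<exists>t ys. computes weights_com (enc_gf D) t ys \<and>
        t \<le> poly (run_time weights_com) (tape_size (enc_gf D)) \<and> ?correct D ys"
      by blast
  qed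
  then show "\<exists>c. polytime_algorithm c enc_gf ?promise ?correct" by blast
qed

end
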